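(* The $C^1$ smooth polar spline functions in the set $\{N^{pol}_l : l=1,\dots,n\}$, $n=n^s(n^t-2)+3$, defined in the context for a single polar point, are linearly independent, locally supported, and form a convex partition of unity on the polar parametric domain $\Omega^{pol}$.
   Context: **Univariate $C^1$ rational splines.** An open knot vector of degree $p\in\mathbb{N}$ on $[x_1,x_2]$ is $[\xi_1,\dots,\xi_{k+p+1}]$, non-decreasing, with $\xi_1=\dots=\xi_{p+1}=x_1<\xi_{p+2}$ and $\xi_k<\xi_{k+1}=\dots=\xi_{k+p+1}=x_2$; it is assumed that $p\ge2$ and that interior knots have multiplicity between $1$ and $p-1$. With the associated B-splines $b_{j,p}$ (Cox–de Boor recursion, taken left continuous at $x_2$) and positive weights $w_1,\dots,w_k$, the NURBS are $b^w_{j,p}=w_jb_{j,p}/\sum_i w_ib_{i,p}$. Given $m$ such knot vectors (degrees $p^{(i)}$, numbers of B-splines $k^{(i)}$, knots $\xi^{(i)}_j$, intervals $[x^{(i)}_1,x^{(i)}_2]$) and weight vectors $\mathbf{w}^{(i)}$, translate the intervals so that they are placed consecutively and form a single interval, translate the NURBS accordingly, and extend each by zero outside its segment (segments taken half-open on the right, except the last one, which is closed). List all of them in a column vector $\mathbf{b}=(b_1,\dots,b_{\mu_m})^T$, where $\mu_0=0$, $\mu_i=\sum_{\ell\le i}k^{(\ell)}$; put $\eta_i=\mu_i-2i$ and $$\alpha^{(i)}=\frac{p^{(i)}}{x_2^{(i)}-\xi^{(i)}_{k^{(i)}}}\frac{w^{(i)}_{k^{(i)}-1}}{w^{(i)}_{k^{(i)}}},\qquad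 \beta^{(i)}=\frac{p^{(i+1)}}{\xi^{(i+1)}_{p^{(i+1)}+2}-x_1^{(i+1)}}\frac{w^{(i+1)}_2}{w^{(i+1)}_1}$$ ($i=1,\dots,m-1$; in the periodic setting also $i=m$, with $i+1$ identified with $1$). Let $\mathbf{H}^c$ be the $\eta_m\times(\mu_m-2)$ matrix whose only non-zero entries are $H^c_{\eta_{i-1}+j,\mu_{i-1}+j}=1$ ($1\le i\le m$, $1\le j\le k^{(i)}-2$) and, for $1\le i\le m-1$, $H^c_{\eta_i,\mu_i-1}=H^c_{\eta_i,\mu_i}=\alpha^{(i)}/(\alpha^{(i)}+\beta^{(i)})$, $H^c_{\eta_i+1,\mu_i-1}=H^c_{\eta_i+1,\mu_i}=\beta^{(i)}/(\alpha^{(i)}+\beta^{(i)})$. The non-periodic basis consists of the entries of $\mathrm{diag}(1,\mathbf{H}^c,1)\,\mathbf{b}$, and the periodic basis of the entries of $[\mathbf{h}|\mathbf{H}^c|\mathbf{h}]\,\mathbf{b}$, where $\mathbf{h}$ is the column with top entry $\beta^{(m)}/(\alpha^{(m)}+\beta^{(m)})$, bottom entry $\alpha^{(m)}/(\alpha^{(m)}+\beta^{(m)})$ and zeros elsewhere. **Tensor product.** Let $\Omega^s=[0,s_2]$, $\Omega^t=[0,t_2]$, $\Omega=\Omega^s\times\Omega^t$. Choose one collection of open knot vectors and weight vectors whose translated intervals form $\Omega^s$, and another (possibly with a different number of segments, degrees and weights) whose translated intervals form $\Omega^t$. Let $B^s_i$, $i=1,\dots,n^s$, be the periodic basis built from the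 first collection, and $B^t_j$, $j=1,\dots,n^t$, the non-periodic basis built from the second collection. Put $B_{ij}(s,t)=B^s_i(s)B^t_j(t)$. **Polar map.** Let $\rho_j=\frac{j-1}{n^t-1}$, $\theta_i=2\pi+\frac{(1-2i)\pi}{n^s}$, $\mathbf{F}_{ij}=(\rho_j\cos\theta_i,\rho_j\sin\theta_i)$, and let $\mathbf{F}:\Omega\to\Omega^{pol}$ be $$\mathbf{F}(s,t)=(u,v)=\sum_{i=1}^{n^s}\sum_{j=1}^{n^t}\mathbf{F}_{ij}B_{ij}(s,t),\qquad \Omega^{pol}=\mathbf{F}(\Omega).$$ The edge $t=0$ is collapsed to the polar point $(0,0)$. Let $B^{pol}_{ij}$ be the image of $B_{ij}$ under $\mathbf{F}$, i.e. $B^{pol}_{ij}(\mathbf{F}(s,t))=B_{ij}(s,t)$ (in general multivalued at the polar point). **Polar splines.** Arrange the $B^{pol}_{ij}$ in a vector $\mathbf{B}$ with $B^{pol}_{ij}$ in position $i+(j-1)n^s$. Let $\bar{\mathbf{E}}$ be the $3\times 2n^s$ matrix whose columns $1,\dots,n^s$ all equal $(\frac13,\frac13,\frac13)^T$ and whose column $n^s+i$, $i=1,\dots,n^s$, is $$\begin{bmatrix}\frac13&0&\frac13\\-\frac16&\frac{\sqrt3}{6}&\frac13\\-\frac16&-\frac{\sqrt3}{6}&\frac13\end{bmatrix}\begin{bmatrix}\cos\theta_i\\ \sin\theta_i\\1\end{bmatrix}.$$ Let $\mathbf{E}=\mathrm{diag}(\bar{\mathbf{E}},\mathbf{I})$ (block-diagonal)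 with $\mathbf{I}$ the identity of size $n^s(n^t-2)$. The polar spline functions are $(N^{pol}_1,\dots,N^{pol}_n)^T=\mathbf{E}\mathbf{B}$. **Terminology.** A polar spline function $g$ on $\Omega^{pol}$ is $C^1$ smooth at the polar point if $\big(g,\frac{\partial g}{\partial u},\frac{\partial g}{\partial v}\big)(u,v)$ converges to a real triple as $(u,v)\to(0,0)$. "Convex partition of unity" means non-negative functions summing to $1$. "Locally supported" refers to the locality of the functions $B^{pol}_{ij}$, transferred to the $N^{pol}_l$ through the sparsity of $\mathbf{E}$. *)

theory Defs
  imports "HOL-Analysis.Analysis"
begin

text \<open>All families (knots, weights, B-splines, matrix rows and columns, segments) are indexed from 1
  and are represented by functions on \<^typ>\<open>nat\<close>; values at other indices are irrelevant.\<close>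

section \<open>Univariate rational splines\<close>

record segment =
  deg :: nat
  dim :: nat
  knot :: "nat \<Rightarrow> real"
  wt :: "nat \<Rightarrow> real"

definition left_end :: "segment \<Rightarrow> real" where
  "left_end g = knot g 1"

definition right_end :: "segment \<Rightarrow> real" where
  "right_end g = knot g (dim g + deg g + 1)"

text \<open>The condition \<open>deg g < dim g\<close> says that the two end blocks of \<open>deg g + 1\<close> equal knots
  do not overlap.\<close>

definition open_knot_vector :: "segment \<Rightarrow> bool" where
  "open_knot_vector g \<longleftrightarrow>
     2 \<le> deg g \<and> deg g < dim g \<and>
     mono_on {1..dim g + deg g + 1} (knot g) \<and>
     (\<forall>j\<in>{1..deg g + 1}. knot g j = left_end g) \<and> left_end g < knot g (deg g + 2) \<and>
     knot g (dim g) < right_end g \<and> (\<forall>j\<in>{dim g + 1..dim g + deg g + 1}. knot g j = right_end g) \<and>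
     (\<forall>j\<in>{deg g + 2..dim g}.
        card {i\<in>{1..dim g + deg g + 1}. knot g i = knot g j} \<le> deg g - 1)"

definition valid_segment :: "segment \<Rightarrow> bool" where
  "valid_segment g \<longleftrightarrow> open_knot_vector g \<and> (\<forall>j\<in>{1..dim g}. 0 < wt g j)"

text \<open>Cox--de Boor recursion for the knots \<open>\<xi>\<close>. Terms with a vanishing denominator are zero because
  \<open>x / 0 = 0\<close>. The second disjunct in degree 0 closes the last non-empty knot span at the right end
  \<open>e\<close>, so that the values at \<open>e\<close> are the limits from the left.\<close>

fun bspline :: "(nat \<Rightarrow> real) \<Rightarrow> real \<Rightarrow> nat \<Rightarrow> nat \<Rightarrow> real \<Rightarrow> real" where
  "bspline \<xi> e 0 j x =
     (if \<xi> j \<le> x \<and> x < \<xi> (j + 1) \<or> x = e \<and> \<xi> j < e \<and> \<xi> (j + 1) = e then 1 else 0)"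
| "bspline \<xi> e (Suc p) j x =
     (x - \<xi> j) / (\<xi> (j + Suc p) - \<xi> j) * bspline \<xi> e p j x +
     (\<xi> (j + Suc p + 1) - x) / (\<xi> (j + Suc p + 1) - \<xi> (j + 1)) * bspline \<xi> e p (j + 1) x"

definition nurbs :: "segment \<Rightarrow> nat \<Rightarrow> real \<Rightarrow> real" where
  "nurbs g j x =
     wt g j * bspline (knot g) (right_end g) (deg g) j x /
     (\<Sum>i=1..dim g. wt g i * bspline (knot g) (right_end g) (deg g) i x)"

type_synonym segments = "segment list"

definition seg :: "segments \<Rightarrow> nat \<Rightarrow> segment" where
  "seg S i = S ! (i - 1)"

definition valid_segments :: "segments \<Rightarrow> bool" where
  "valid_segments S \<longleftrightarrow> S \<noteq> [] \<and> (\<forall>i\<in>{1..length S}. valid_segment (seg S i))"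

definition mu :: "segments \<Rightarrow> nat \<Rightarrow> nat" where
  "mu S i = (\<Sum>l=1..i. dim (seg S l))"

definition eta :: "segments \<Rightarrow> nat \<Rightarrow> nat" where
  "eta S i = mu S i - 2 * i"

text \<open>After translation the \<open>i\<close>-th segment occupies the interval from \<open>breakpoint S (i - 1)\<close> to
  \<open>breakpoint S i\<close>.\<close>

definition breakpoint :: "segments \<Rightarrow> nat \<Rightarrow> real" where
  "breakpoint S i = (\<Sum>l=1..i. right_end (seg S l) - left_end (seg S l))"

definition interval :: "segments \<Rightarrow> real set" where
  "interval S = {0..breakpoint S (length S)}"

definition piece :: "segments \<Rightarrow> nat \<Rightarrow> real set" where
  "piece S i = (if i = length S then {breakpoint S (i - 1)..breakpoint S i}
                else {breakpoint S (i - 1)..<breakpoint S i})"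

definition to_local :: "segments \<Rightarrow> nat \<Rightarrow> real \<Rightarrow> real" where
  "to_local S i x = x - breakpoint S (i - 1) + left_end (seg S i)"

text \<open>The position \<open>r = mu S (i - 1) + j\<close> with \<open>1 \<le> j \<le> dim (seg S i)\<close> in the concatenated vector
  belongs to segment \<open>i = seg_of S r\<close> and local index \<open>j = loc_of S r\<close>.\<close>

definition seg_of :: "segments \<Rightarrow> nat \<Rightarrow> nat" where
  "seg_of S r = (LEAST i. r \<le> mu S i)"

definition loc_of :: "segments \<Rightarrow> nat \<Rightarrow> nat" where
  "loc_of S r = r - mu S (seg_of S r - 1)"

definition bvec :: "segments \<Rightarrow> nat \<Rightarrow> real \<Rightarrow> real" where
  "bvec S r x =
     (if x \<in> piece S (seg_of S r)
      then nurbs (seg S (seg_of S r)) (loc_of S r) (to_local S (seg_of S r) x) else 0)"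

definition alpha :: "segments \<Rightarrow> nat \<Rightarrow> real" where
  "alpha S i = (let g = seg S i in
     real (deg g) / (right_end g - knot g (dim g)) * (wt g (dim g - 1) / wt g (dim g)))"

definition beta :: "segments \<Rightarrow> nat \<Rightarrow> real" where
  "beta S i = (let g = seg S (if i = length S then 1 else i + 1) in
     real (deg g) / (knot g (deg g + 2) - left_end g) * (wt g 2 / wt g 1))"

text \<open>The matrix with entry \<open>v\<close> at \<open>(r0, c0)\<close> and zeros elsewhere. The positions used below for
  \<open>Hc\<close> are pairwise distinct.\<close>

definition unit_entry :: "nat \<Rightarrow> nat \<Rightarrow> real \<Rightarrow> nat \<Rightarrow> nat \<Rightarrow> real" where
  "unit_entry r0 c0 v r c = (if r = r0 \<and> c = c0 then v else 0)"

definition Hc :: "segments \<Rightarrow> nat \<Rightarrow> nat \<Rightarrow> real" where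
  "Hc S r c =
     (\<Sum>i=1..length S. \<Sum>j=1..dim (seg S i) - 2.
        unit_entry (eta S (i - 1) + j) (mu S (i - 1) + j) 1 r c) +
     (\<Sum>i=1..length S - 1. let a = alpha S i; b = beta S i in
        unit_entry (eta S i) (mu S i - 1) (a / (a + b)) r c +
        unit_entry (eta S i) (mu S i) (a / (a + b)) r c +
        unit_entry (eta S i + 1) (mu S i - 1) (b / (a + b)) r c +
        unit_entry (eta S i + 1) (mu S i) (b / (a + b)) r c)"

definition hcol :: "segments \<Rightarrow> nat \<Rightarrow> real" where
  "hcol S r = (let m = length S; a = alpha S m; b = beta S m in
     (if r = 1 then b / (a + b) else 0) + (if r = eta S m then a / (a + b) else 0))"

definition dim_per :: "segments \<Rightarrow> nat" where
  "dim_per S = eta S (length S)"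

definition H_per :: "segments \<Rightarrow> nat \<Rightarrow> nat \<Rightarrow> real" where
  "H_per S r c = (if c = 1 \<or> c = mu S (length S) then hcol S r else Hc S r (c - 1))"

definition basis_per :: "segments \<Rightarrow> nat \<Rightarrow> real \<Rightarrow> real" where
  "basis_per S r x = (\<Sum>c=1..mu S (length S). H_per S r c * bvec S c x)"

definition dim_nonper :: "segments \<Rightarrow> nat" where
  "dim_nonper S = eta S (length S) + 2"

definition H_nonper :: "segments \<Rightarrow> nat \<Rightarrow> nat \<Rightarrow> real" where
  "H_nonper S r c =
     (if r = 1 \<or> c = 1 then (if r = 1 \<and> c = 1 then 1 else 0)
      else if r = dim_nonper S \<or> c = mu S (length S)
      then (if r = dim_nonper S \<and> c = mu S (length S) then 1 else 0)
      else Hc S (r - 1) (c - 1))"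

definition basis_nonper :: "segments \<Rightarrow> nat \<Rightarrow> real \<Rightarrow> real" where
  "basis_nonper S r x = (\<Sum>c=1..mu S (length S). H_nonper S r c * bvec S c x)"


section \<open>Tensor product and polar map\<close>

text \<open>In the following \<open>S\<close> is the collection for the periodic direction \<open>s\<close>, and \<open>T\<close> the one for
  the direction \<open>t\<close>.\<close>

definition Omega :: "segments \<Rightarrow> segments \<Rightarrow> (real \<times> real) set" where
  "Omega S T = interval S \<times> interval T"

definition B_tensor :: "segments \<Rightarrow> segments \<Rightarrow> nat \<Rightarrow> nat \<Rightarrow> real \<times> real \<Rightarrow> real" where
  "B_tensor S T i j = (\<lambda>(s, t). basis_per S i s * basis_nonper T j t)"

definition rho :: "segments \<Rightarrow> nat \<Rightarrow> real" where
  "rho T j = (real j - 1) / (real (dim_nonper T) - 1)"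

definition theta :: "segments \<Rightarrow> nat \<Rightarrow> real" where
  "theta S i = 2 * pi + (1 - 2 * real i) * pi / real (dim_per S)"

definition F_coeff :: "segments \<Rightarrow> segments \<Rightarrow> nat \<Rightarrow> nat \<Rightarrow> real \<times> real" where
  "F_coeff S T i j = (rho T j * cos (theta S i), rho T j * sin (theta S i))"

definition polar_map :: "segments \<Rightarrow> segments \<Rightarrow> real \<times> real \<Rightarrow> real \<times> real" where
  "polar_map S T st =
     (\<Sum>i=1..dim_per S. \<Sum>j=1..dim_nonper T. B_tensor S T i j st *\<^sub>R F_coeff S T i j)"

definition Omega_pol :: "segments \<Rightarrow> segments \<Rightarrow> (real \<times> real) set" where
  "Omega_pol S T = polar_map S T ` Omega S T"

text \<open>\<open>Bpol\<close> is the image of the tensor-product functions under the polar map. The images are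
  multivalued at the polar point, onto which the edge \<open>t = 0\<close> is collapsed; there \<open>Bpol\<close> takes the
  values of an arbitrary branch, the same one for all \<open>i\<close> and \<open>j\<close>. The first condition includes
  the requirement that the images are single-valued away from that edge.\<close>

definition polar_image ::
  "segments \<Rightarrow> segments \<Rightarrow> (nat \<Rightarrow> nat \<Rightarrow> real \<times> real \<Rightarrow> real) \<Rightarrow> bool" where
  "polar_image S T Bpol \<longleftrightarrow>
     (\<forall>(s, t)\<in>Omega S T. 0 < t \<longrightarrow>
        (\<forall>i\<in>{1..dim_per S}. \<forall>j\<in>{1..dim_nonper T}.
           Bpol i j (polar_map S T (s, t)) = B_tensor S T i j (s, t))) \<and>
     (\<exists>s\<in>interval S.
        \<forall>i\<in>{1..dim_per S}. \<forall>j\<in>{1..dim_nonper T}. Bpol i j (0, 0) = B_tensor S T i j (s, 0))"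


section \<open>Polar splines\<close>

definition pos :: "segments \<Rightarrow> nat \<Rightarrow> nat \<Rightarrow> nat" where
  "pos S i j = i + (j - 1) * dim_per S"

definition dim_pol :: "segments \<Rightarrow> segments \<Rightarrow> nat" where
  "dim_pol S T = dim_per S * (dim_nonper T - 2) + 3"

definition E_bar :: "segments \<Rightarrow> nat \<Rightarrow> nat \<Rightarrow> real" where
  "E_bar S l q =
     (if q \<le> dim_per S then 1 / 3
      else let th = theta S (q - dim_per S) in
        if l = 1 then 1 / 3 * cos th + 1 / 3
        else if l = 2 then - (1 / 6) * cos th + sqrt 3 / 6 * sin th + 1 / 3
        else - (1 / 6) * cos th - sqrt 3 / 6 * sin th + 1 / 3)"

definition E_mat :: "segments \<Rightarrow> nat \<Rightarrow> nat \<Rightarrow> real" where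
  "E_mat S l q =
     (if l \<le> 3 \<and> q \<le> 2 * dim_per S then E_bar S l q
      else if 3 < l \<and> 2 * dim_per S < q \<and> l - 3 = q - 2 * dim_per S then 1
      else 0)"

definition N_pol ::
  "segments \<Rightarrow> segments \<Rightarrow> (nat \<Rightarrow> nat \<Rightarrow> real \<times> real \<Rightarrow> real) \<Rightarrow> nat \<Rightarrow> real \<times> real \<Rightarrow> real" where
  "N_pol S T Bpol l x =
     (\<Sum>j=1..dim_nonper T. \<Sum>i=1..dim_per S. E_mat S l (pos S i j) * Bpol i j x)"


section \<open>Properties\<close>

text \<open>\<open>gu\<close> and \<open>gv\<close> are the partial derivatives of \<open>g\<close>; only their values near the polar point
  matter.\<close>

definition C1_smooth_at_polar_point :: "(real \<times> real) set \<Rightarrow> (real \<times> real \<Rightarrow> real) \<Rightarrow> bool" where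
  "C1_smooth_at_polar_point D g \<longleftrightarrow>
     (\<exists>gu gv a b c.
        (\<forall>\<^sub>F (u, v) in at (0, 0) within D.
           ((\<lambda>u'. g (u', v)) has_real_derivative gu (u, v)) (at u) \<and>
           ((\<lambda>v'. g (u, v')) has_real_derivative gv (u, v)) (at v)) \<and>
        ((\<lambda>x. (g x, gu x, gv x)) \<longlongrightarrow> (a, b, c)) (at (0, 0) within D))"

definition linearly_independent_on :: "'a set \<Rightarrow> nat \<Rightarrow> (nat \<Rightarrow> 'a \<Rightarrow> real) \<Rightarrow> bool" where
  "linearly_independent_on D n f \<longleftrightarrow>
     (\<forall>a. (\<forall>x\<in>D. (\<Sum>l=1..n. a l * f l x) = 0) \<longrightarrow> (\<forall>l\<in>{1..n}. a l = 0))"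

definition convex_partition_of_unity_on :: "'a set \<Rightarrow> nat \<Rightarrow> (nat \<Rightarrow> 'a \<Rightarrow> real) \<Rightarrow> bool" where
  "convex_partition_of_unity_on D n f \<longleftrightarrow>
     (\<forall>l\<in>{1..n}. \<forall>x\<in>D. 0 \<le> f l x) \<and> (\<forall>x\<in>D. (\<Sum>l=1..n. f l x) = 1)"

text \<open>The translated interval spanned by the knots \<open>j, \<dots>, j + p + 1\<close> of the \<open>r\<close>-th entry of the
  concatenated vector of NURBS.\<close>

definition knot_support :: "segments \<Rightarrow> nat \<Rightarrow> real set" where
  "knot_support S r = (let i = seg_of S r; j = loc_of S r; g = seg S i in
     {x. to_local S i x \<in> {knot g j..knot g (j + deg g + 1)}})"

definition supp_per :: "segments \<Rightarrow> nat \<Rightarrow> real set" where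
  "supp_per S i = (\<Union>r\<in>{r\<in>{1..mu S (length S)}. H_per S i r \<noteq> 0}. knot_support S r)"

definition supp_nonper :: "segments \<Rightarrow> nat \<Rightarrow> real set" where
  "supp_nonper S i = (\<Union>r\<in>{r\<in>{1..mu S (length S)}. H_nonper S i r \<noteq> 0}. knot_support S r)"

text \<open>Each \<open>Bpol i j\<close> lives on the image of the box \<open>supp_per S i \<times> supp_nonper T j\<close>; the \<open>l\<close>-th
  function \<open>N l\<close> must live on the union of the images of those boxes for which the \<open>l\<close>-th row of
  the sparse matrix \<open>E_mat S\<close> has a non-zero entry.\<close>

definition locally_supported ::
  "segments \<Rightarrow> segments \<Rightarrow> (nat \<Rightarrow> real \<times> real \<Rightarrow> real) \<Rightarrow> bool" where
  "locally_supported S T N \<longleftrightarrow>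
     (\<forall>l\<in>{1..dim_pol S T}. support_on (Omega_pol S T) (N l) \<subseteq>
        (\<Union>(i, j)\<in>{(i, j)\<in>{1..dim_per S} \<times> {1..dim_nonper T}. E_mat S l (pos S i j) \<noteq> 0}.
           polar_map S T ` (Omega S T \<inter> supp_per S i \<times> supp_nonper T j)))"

end

theory Submission
  imports Defs
begin

text \<open>
  The control points of the polar map are products of a radius and a point of the unit circle, so
  that \<open>F(s, t) = r(t) \<gamma>(s)\<close>, where \<open>r = \<Sum>\<^sub>j \<rho>\<^sub>j B\<^sup>t\<^sub>j\<close> and \<open>\<gamma> = \<Sum>\<^sub>i B\<^sup>s\<^sub>i (cos \<theta>\<^sub>i, sin \<theta>\<^sub>i)\<close> is
  a closed curve: \<open>F\<close> is a system of polar coordinates along \<open>\<gamma>\<close>. Each of the first three rows of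
  the extraction matrix is constant, say \<open>c\<close>, on the functions with \<open>j = 1\<close> and equal to an affine
  function \<open>c + \<lambda> \<bullet> (cos \<theta>\<^sub>i, sin \<theta>\<^sub>i)\<close> on those with \<open>j = 2\<close>. The other rows vanish there. Since the
  \<open>B\<^sup>t\<^sub>j\<close> sum to 1, every polar spline \<open>N\<close> satisfies
  \<open>N(F(s, t)) = c + \<lambda> \<bullet> F(s, t) / \<rho>\<^sub>2 + \<Sum>\<^sub>j Q\<^sub>j(s) B\<^sup>t\<^sub>j(t)\<close>, where \<open>j\<close> runs from 3 and the \<open>Q\<^sub>j\<close> are
  periodic splines. For these \<open>j\<close> both \<open>B\<^sup>t\<^sub>j\<close> and its derivative vanish at \<open>t = 0\<close>, whereas
  \<open>r'(0) > 0\<close>. Hence the gradient of the remainder tends to 0 and that of \<open>N\<close> to \<open>\<lambda> / \<rho>\<^sub>2\<close>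
  (\<open>C1_at_pole\<close>, \<open>N_pol_C1\<close>).

  This argument needs that \<open>\<gamma>\<close> is continuously differentiable and that \<open>\<gamma> \<times> \<gamma>'\<close> has no zero, so
  that \<open>F\<close> is locally invertible off the pole. The first property holds because a B-spline of
  degree \<open>p\<close> is differentiable at a knot of multiplicity at most \<open>p - 1\<close>
  (\<open>deboor_across_knot\<close>) and because the ratios \<open>\<alpha> : \<beta>\<close> balance the end derivatives of adjacent
  segments (\<open>junction_C1\<close>).

  The second property (\<open>curve_jacobian\<close>) is not a consequence of positive weights alone: for extreme
  weights \<open>\<gamma>\<close> does not even wind around the origin. What is used is that the images of the tensor
  functions are single-valued, which forces \<open>\<gamma>\<close> to meet every ray in at most one point, and that
  \<open>\<gamma>\<close> is convex. Suppose that \<open>\<gamma>'(s) = c \<gamma>(s)\<close>. The homogeneous curve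
  \<open>\<Gamma> = W (\<gamma>, 1)\<close> satisfies \<open>det (\<Gamma>, \<Gamma>', \<Gamma>'') > 0\<close> on every span, because the de Boor algorithm
  cuts corners of a convex polygon and cutting corners preserves the sign of \<open>3 \<times> 3\<close> determinants
  of control points (\<open>deboor_wronskian_pos\<close>). So \<open>c \<noteq> 0\<close>, and near \<open>s\<close> the curve lies strictly on
  one side of its radial tangent (\<open>radial_tangent\<close>). Then some ray meets \<open>\<gamma>\<close> on both sides of \<open>s\<close>,
  in one point, although the component of \<open>\<gamma>\<close> along \<open>\<gamma>(s)\<close> is strictly monotone near \<open>s\<close>.

  The remaining claims are algebraic. The entries of the extraction matrices are non-negative, and
  their columns sum to 1. Each basis function of either direction owns a NURBS that no other one
  contains, and B-splines are independent on a knot span, so that the tensor functions are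
  independent. The matrix of the polar splines has independent rows because three of the points
  \<open>(cos \<theta>\<^sub>i, sin \<theta>\<^sub>i)\<close> are not collinear.
\<close>

section \<open>The de Boor algorithm on one knot span\<close>

text \<open>One step of the de Boor algorithm at the parameter \<open>x\<close>, from degree \<open>q\<close> to \<open>q - 1\<close>. On a span
  \<open>\<mu> \<ge> q\<close> it is applied to indices \<open>j > \<mu> - q\<close>, for which \<open>j - 1\<close> is a true predecessor.\<close>

definition blend :: "(nat \<Rightarrow> real) \<Rightarrow> nat \<Rightarrow> real \<Rightarrow> (nat \<Rightarrow> real) \<Rightarrow> nat \<Rightarrow> real" where
  "blend \<xi> q x c j = ((x - \<xi> j) * c j + (\<xi> (j + q) - x) * c (j - 1)) / (\<xi> (j + q) - \<xi> j)"

text \<open>Up to the factor \<open>q\<close>, the B-spline coefficients of the derivative of a spline of degree \<open>q\<close>.\<close>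

definition ddiff :: "(nat \<Rightarrow> real) \<Rightarrow> nat \<Rightarrow> (nat \<Rightarrow> real) \<Rightarrow> nat \<Rightarrow> real" where
  "ddiff \<xi> q c j = (c j - c (j - 1)) / (\<xi> (j + q) - \<xi> j)"

text \<open>The steps for the degrees \<open>q + n, \<dots>, q + 1\<close>, the highest degree first. At level \<open>q\<close> the entries
  with indices from \<open>\<mu> - q\<close> to \<open>\<mu>\<close> determine the polynomial on the span \<open>\<mu>\<close>. At level 0 the entry
  \<open>\<mu>\<close> is its value.\<close>

fun level :: "(nat \<Rightarrow> real) \<Rightarrow> nat \<Rightarrow> nat \<Rightarrow> real \<Rightarrow> (nat \<Rightarrow> real) \<Rightarrow> nat \<Rightarrow> real" where
  "level \<xi> q 0 x c = c"
| "level \<xi> q (Suc n) x c = level \<xi> q n x (blend \<xi> (q + Suc n) x c)"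

abbreviation deboor :: "(nat \<Rightarrow> real) \<Rightarrow> nat \<Rightarrow> real \<Rightarrow> (nat \<Rightarrow> real) \<Rightarrow> nat \<Rightarrow> real" where
  "deboor \<xi> p x c \<mu> \<equiv> level \<xi> 0 p x c \<mu>"

text \<open>What the algorithm of degree \<open>p\<close> needs about the knots: it reads those with indices from
  \<open>\<mu> + 1 - p\<close> to \<open>\<mu> + p\<close>, and the knot intervals in its denominators all contain the one between the knots
  \<open>\<mu>\<close> and \<open>\<mu> + 1\<close>.\<close>

definition is_span :: "(nat \<Rightarrow> real) \<Rightarrow> nat \<Rightarrow> nat \<Rightarrow> bool" where
  "is_span \<xi> p \<mu> \<longleftrightarrow> p \<le> \<mu> \<and> \<xi> \<mu> < \<xi> (\<mu> + 1) \<and>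
     (\<forall>i\<in>{\<mu> + 1 - p..\<mu>}. \<xi> i \<le> \<xi> \<mu>) \<and> (\<forall>i\<in>{\<mu> + 1..\<mu> + p}. \<xi> (\<mu> + 1) \<le> \<xi> i)"

lemma is_span_mono: "is_span \<xi> p \<mu> \<Longrightarrow> q \<le> p \<Longrightarrow> is_span \<xi> q \<mu>"
  by (auto simp: is_span_def)

lemma is_span_knots:
  assumes "is_span \<xi> p \<mu>" "q \<le> p" "j \<le> \<mu>" "\<mu> < j + q"
  shows "\<xi> j \<le> \<xi> \<mu>" "\<xi> \<mu> < \<xi> (\<mu> + 1)" "\<xi> (\<mu> + 1) \<le> \<xi> (j + q)"
  using assms by (auto simp: is_span_def)

lemma level_add: "level \<xi> 0 (q + n) x c = level \<xi> 0 q x (level \<xi> q n x c)"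
  by (induction n arbitrary: c) auto

lemma blend_cong:
  assumes "c j = c' j" "c (j - 1) = c' (j - 1)"
  shows "blend \<xi> q x c j = blend \<xi> q x c' j"
  using assms by (simp add: blend_def)

lemma level_cong:
  assumes "q + n \<le> \<mu>" "\<And>j. \<mu> - (q + n) \<le> j \<Longrightarrow> j \<le> \<mu> \<Longrightarrow> c j = c' j" "\<mu> - q \<le> j" "j \<le> \<mu>"
  shows "level \<xi> q n x c j = level \<xi> q n x c' j"
  using assms
proof (induction n arbitrary: c c')
  case (Suc n)
  show ?case unfolding level.simps
    by (rule Suc.IH) (use Suc.prems in \<open>auto intro!: blend_cong\<close>)
qed simp

lemma blend_add: "blend \<xi> q x (\<lambda>j. c j + d j) = (\<lambda>j. blend \<xi> q x c j + blend \<xi> q x d j)"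
  by (rule ext) (simp add: blend_def add_divide_distrib[symmetric] algebra_simps)

lemma blend_scale: "blend \<xi> q x (\<lambda>j. a * c j) = (\<lambda>j. a * blend \<xi> q x c j)"
  by (rule ext) (simp add: blend_def algebra_simps)

lemma level_add_coeff: "level \<xi> q n x (\<lambda>j. c j + d j) = (\<lambda>j. level \<xi> q n x c j + level \<xi> q n x d j)"
  by (induction n arbitrary: c d) (simp_all add: blend_add)

lemma level_scale: "level \<xi> q n x (\<lambda>j. a * c j) = (\<lambda>j. a * level \<xi> q n x c j)"
  by (induction n arbitrary: c) (simp_all add: blend_scale)

lemma ddiff_add: "ddiff \<xi> q (\<lambda>j. c j + d j) j = ddiff \<xi> q c j + ddiff \<xi> q d j"
  by (simp add: ddiff_def add_divide_distrib[symmetric] algebra_simps)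

lemma ddiff_scale: "ddiff \<xi> q (\<lambda>j. a * c j) j = a * ddiff \<xi> q c j"
  by (simp add: ddiff_def algebra_simps)

lemma level_lincomb:
  "level \<xi> q n x (\<lambda>j. a * c j + b * d j) i = a * level \<xi> q n x c i + b * level \<xi> q n x d i"
  by (simp add: level_add_coeff level_scale)

lemma blend_affine: "blend \<xi> q x c j = blend \<xi> q 0 c j + x * ddiff \<xi> q c j"
  by (simp add: blend_def ddiff_def add_divide_distrib[symmetric] algebra_simps)

lemma blend_eqs:
  assumes "\<xi> j \<noteq> \<xi> (j + q)"
  shows "blend \<xi> q x c j = c (j - 1) + (x - \<xi> j) * ddiff \<xi> q c j"
    and "blend \<xi> q x c j = c j - (\<xi> (j + q) - x) * ddiff \<xi> q c j"
  using assms by (simp_all add: blend_def ddiff_def field_simps)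

text \<open>Differences and blending steps commute. Both neighbouring values of the blend can be written
  with the same coefficient \<open>c (j - 1)\<close>, which cancels. All statements about derivatives rest on
  this rule.\<close>

lemma ddiff_blend:
  assumes "is_span \<xi> p \<mu>" "Suc q \<le> p" "0 < q" "j \<le> \<mu>" "\<mu> < j + q"
  shows "ddiff \<xi> q (blend \<xi> (Suc q) x c) j = blend \<xi> q x (ddiff \<xi> (Suc q) c) j"
proof -
  have q: "q \<le> p" using assms(2) by simp
  have j1: "j \<ge> 1" using assms by (auto simp: is_span_def)
  have 1: "\<xi> j \<noteq> \<xi> (j + q)" using is_span_knots[OF assms(1) q assms(4,5)] by linarith
  have 2: "\<xi> j \<noteq> \<xi> (j + Suc q)" using is_span_knots[OF assms(1) assms(2), of j] assms by fastforce
  have 3: "\<xi> (j - 1) \<noteq> \<xi> (j - 1 + Suc q)"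
    using is_span_knots[OF assms(1) assms(2), of "j - 1"] assms j1 by fastforce
  have "blend \<xi> (Suc q) x c j - blend \<xi> (Suc q) x c (j - 1)
      = (x - \<xi> j) * ddiff \<xi> (Suc q) c j + (\<xi> (j + q) - x) * ddiff \<xi> (Suc q) c (j - 1)"
  proof -
    have "j - 1 + Suc q = j + q" using j1 by simp
    then have "blend \<xi> (Suc q) x c (j - 1) = c (j - 1) - (\<xi> (j + q) - x) * ddiff \<xi> (Suc q) c (j - 1)"
      using blend_eqs(2)[OF 3, of x c] by simp
    then show ?thesis by (simp add: blend_eqs(1)[OF 2])
  qed
  then show ?thesis unfolding ddiff_def[of \<xi> q] blend_def[of \<xi> q] by simp
qed

lemma ddiff_level:
  assumes "is_span \<xi> (Suc q + n) \<mu>" "\<mu> - q \<le> j" "j \<le> \<mu>"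
  shows "ddiff \<xi> (Suc q) (level \<xi> (Suc q) n x c) j = level \<xi> q n x (ddiff \<xi> (Suc q + n) c) j"
  using assms
proof (induction n arbitrary: c)
  case (Suc n)
  have s: "is_span \<xi> (Suc q + n) \<mu>" using Suc.prems(1) by (rule is_span_mono) simp
  have le: "Suc q + Suc n \<le> \<mu>" using Suc.prems(1) by (simp add: is_span_def)
  have "ddiff \<xi> (Suc q) (level \<xi> (Suc q) (Suc n) x c) j
      = level \<xi> q n x (ddiff \<xi> (Suc q + n) (blend \<xi> (Suc q + Suc n) x c)) j"
    using Suc.IH[OF s Suc.prems(2,3)] by simp
  also have "\<dots> = level \<xi> q n x (blend \<xi> (Suc q + n) x (ddiff \<xi> (Suc q + Suc n) c)) j"
  proof (rule level_cong[where \<mu> = \<mu>])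
    fix i assume i: "\<mu> - (q + n) \<le> i" "i \<le> \<mu>"
    show "ddiff \<xi> (Suc q + n) (blend \<xi> (Suc q + Suc n) x c) i =
          blend \<xi> (Suc q + n) x (ddiff \<xi> (Suc q + Suc n) c) i"
      using ddiff_blend[OF Suc.prems(1), of "Suc q + n" i x c] i le by simp
  qed (use le Suc.prems in auto)
  finally show ?case by simp
qed simp

text \<open>A step is affine in \<open>x\<close> with slope \<open>ddiff\<close>, so the product rule replaces one of the \<open>p\<close>
  steps by a difference. By commutation the \<open>p\<close> resulting terms are equal.\<close>

lemma deboor_has_derivative:
  assumes "is_span \<xi> p \<mu>"
  shows "((\<lambda>x. deboor \<xi> p x c \<mu>) has_real_derivative
           real p * deboor \<xi> (p - 1) x (ddiff \<xi> p c) \<mu>) (at x within A)"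
  using assms
proof (induction p arbitrary: c)
  case (Suc p)
  have s: "is_span \<xi> p \<mu>" using Suc.prems by (rule is_span_mono) simp
  have le: "Suc p \<le> \<mu>" using Suc.prems by (simp add: is_span_def)
  have eq: "deboor \<xi> (Suc p) x c \<mu> =
      deboor \<xi> p x (blend \<xi> (Suc p) 0 c) \<mu> + x * deboor \<xi> p x (ddiff \<xi> (Suc p) c) \<mu>" for x
  proof -
    have "blend \<xi> (Suc p) x c = (\<lambda>j. blend \<xi> (Suc p) 0 c j + x * ddiff \<xi> (Suc p) c j)"
      by (rule ext) (rule blend_affine)
    then show ?thesis by (simp add: level_add_coeff level_scale)
  qed
  have D: "((\<lambda>x. deboor \<xi> (Suc p) x c \<mu>) has_real_derivative
       (real p * deboor \<xi> (p - 1) x (ddiff \<xi> p (blend \<xi> (Suc p) 0 c)) \<mu>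
        + (1 * deboor \<xi> p x (ddiff \<xi> (Suc p) c) \<mu>
        + (real p * deboor \<xi> (p - 1) x (ddiff \<xi> p (ddiff \<xi> (Suc p) c)) \<mu>) * x))) (at x within A)"
    unfolding eq by (intro DERIV_add DERIV_mult DERIV_ident Suc.IH s)
  have "real p * deboor \<xi> (p - 1) x (ddiff \<xi> p (blend \<xi> (Suc p) 0 c)) \<mu>
        + (real p * deboor \<xi> (p - 1) x (ddiff \<xi> p (ddiff \<xi> (Suc p) c)) \<mu>) * x
      = real p * deboor \<xi> p x (ddiff \<xi> (Suc p) c) \<mu>"
  proof (cases p)
    case (Suc r)
    have "deboor \<xi> r x (ddiff \<xi> p (blend \<xi> (Suc p) 0 c)) \<mu>
        + x * deboor \<xi> r x (ddiff \<xi> p (ddiff \<xi> (Suc p) c)) \<mu>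
        = deboor \<xi> r x (ddiff \<xi> p (blend \<xi> (Suc p) x c)) \<mu>"
    proof -
      have b: "blend \<xi> (Suc p) x c = (\<lambda>j. blend \<xi> (Suc p) 0 c j + x * ddiff \<xi> (Suc p) c j)"
        by (rule ext) (rule blend_affine)
      have "ddiff \<xi> p (blend \<xi> (Suc p) x c)
          = (\<lambda>j. ddiff \<xi> p (blend \<xi> (Suc p) 0 c) j + x * ddiff \<xi> p (ddiff \<xi> (Suc p) c) j)"
        unfolding b by (rule ext) (simp add: ddiff_add ddiff_scale)
      then show ?thesis by (simp add: level_add_coeff level_scale)
    qed
    also have "\<dots> = deboor \<xi> r x (blend \<xi> p x (ddiff \<xi> (Suc p) c)) \<mu>"
    proof (rule level_cong[where \<mu> = \<mu>])
      fix i assume "\<mu> - (0 + r) \<le> i" "i \<le> \<mu>"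
      then show "ddiff \<xi> p (blend \<xi> (Suc p) x c) i = blend \<xi> p x (ddiff \<xi> (Suc p) c) i"
        using ddiff_blend[OF Suc.prems, of p i x c] Suc le by simp
    qed (use Suc le in auto)
    also have "\<dots> = deboor \<xi> p x (ddiff \<xi> (Suc p) c) \<mu>" using Suc by simp
    finally have E: "deboor \<xi> (p - 1) x (ddiff \<xi> p (blend \<xi> (Suc p) 0 c)) \<mu>
        + x * deboor \<xi> (p - 1) x (ddiff \<xi> p (ddiff \<xi> (Suc p) c)) \<mu>
        = deboor \<xi> p x (ddiff \<xi> (Suc p) c) \<mu>" using Suc by simp
    show ?thesis unfolding E[symmetric] by (simp add: algebra_simps)
  qed simp
  with D show ?case by (simp add: algebra_simps)
qed simp

lemma blend_convex:
  assumes "is_span \<xi> p \<mu>" "q \<le> p" "j \<le> \<mu>" "\<mu> < j + q" "\<xi> \<mu> \<le> x" "x \<le> \<xi> (\<mu> + 1)"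
  defines "t \<equiv> (x - \<xi> j) / (\<xi> (j + q) - \<xi> j)"
  shows "blend \<xi> q x c j = (1 - t) * c (j - 1) + t * c j" "0 \<le> t" "t \<le> 1"
    "\<xi> \<mu> < x \<Longrightarrow> 0 < t" "x < \<xi> (\<mu> + 1) \<Longrightarrow> t < 1"
proof -
  note k = is_span_knots[OF assms(1-4)]
  have d: "\<xi> (j + q) - \<xi> j > 0" using k by linarith
  show "blend \<xi> q x c j = (1 - t) * c (j - 1) + t * c j"
  proof -
    have "blend \<xi> q x c j = c (j - 1) + t * (c j - c (j - 1))"
      using blend_eqs(1)[of \<xi> j q x c] d unfolding t_def ddiff_def by simp
    then show ?thesis by (simp add: algebra_simps)
  qed
  show "0 \<le> t" "t \<le> 1" "\<xi> \<mu> < x \<Longrightarrow> 0 < t" "x < \<xi> (\<mu> + 1) \<Longrightarrow> t < 1"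
    unfolding t_def using d k assms(5,6) by (auto simp: field_simps)
qed

text \<open>For a parameter in the closed span every step forms convex combinations, so that each property
  that defines a convex set of reals passes from the coefficients to the result.\<close>

lemma level_invariant:
  assumes "is_span \<xi> (q + n) \<mu>" "\<xi> \<mu> \<le> x" "x \<le> \<xi> (\<mu> + 1)"
    "\<And>j. \<mu> - (q + n) \<le> j \<Longrightarrow> j \<le> \<mu> \<Longrightarrow> P (c j)" "\<mu> - q \<le> j" "j \<le> \<mu>"
    and convex: "\<And>a b t. 0 \<le> t \<Longrightarrow> t \<le> 1 \<Longrightarrow> P a \<Longrightarrow> P b \<Longrightarrow> P ((1 - t) * a + t * b)"
  shows "P (level \<xi> q n x c j)"
  using assms(1-6)
proof (induction n arbitrary: c)
  case (Suc n)
  have le: "q + Suc n \<le> \<mu>" using Suc.prems(1) by (simp add: is_span_def)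
  show ?case unfolding level.simps
  proof (rule Suc.IH)
    fix i assume i: "\<mu> - (q + n) \<le> i" "i \<le> \<mu>"
    have i2: "\<mu> < i + (q + Suc n)" using i le by auto
    have c: "P (c i)" "P (c (i - 1))" using i le by (auto intro!: Suc.prems(4))
    show "P (blend \<xi> (q + Suc n) x c i)"
      unfolding blend_convex(1)[OF Suc.prems(1) order.refl i(2) i2 Suc.prems(2,3)]
      by (rule convex[OF blend_convex(2,3)[OF Suc.prems(1) order.refl i(2) i2 Suc.prems(2,3)] c(2,1)])
  qed (use Suc.prems le in \<open>auto intro: is_span_mono\<close>)
qed auto

lemma level_nonneg:
  assumes "is_span \<xi> (q + n) \<mu>" "\<xi> \<mu> \<le> x" "x \<le> \<xi> (\<mu> + 1)"
    "\<And>j. \<mu> - (q + n) \<le> j \<Longrightarrow> j \<le> \<mu> \<Longrightarrow> 0 \<le> c j" "\<mu> - q \<le> j" "j \<le> \<mu>"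
  shows "0 \<le> level \<xi> q n x c j"
  by (rule level_invariant[where P = "\<lambda>y. 0 \<le> y", OF assms]) auto

lemma level_pos:
  assumes "is_span \<xi> (q + n) \<mu>" "\<xi> \<mu> \<le> x" "x \<le> \<xi> (\<mu> + 1)"
    "\<And>j. \<mu> - (q + n) \<le> j \<Longrightarrow> j \<le> \<mu> \<Longrightarrow> 0 < c j" "\<mu> - q \<le> j" "j \<le> \<mu>"
  shows "0 < level \<xi> q n x c j"
proof (rule level_invariant[where P = "\<lambda>y. 0 < y", OF assms])
  fix a b t :: real assume "0 \<le> t" "t \<le> 1" "0 < a" "0 < b"
  then show "0 < (1 - t) * a + t * b"
    by (cases "t = 0") (auto intro: add_nonneg_pos)
qed

lemma deboor_at_right_knots:
  assumes "\<xi> \<mu> < x" "\<And>i. \<mu> < i \<Longrightarrow> i \<le> \<mu> + q \<Longrightarrow> \<xi> i = x"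
  shows "deboor \<xi> q x c \<mu> = c \<mu>"
  using assms
proof (induction q arbitrary: c)
  case (Suc q)
  have "\<xi> (\<mu> + Suc q) = x" by (rule Suc.prems(2)) auto
  then have "blend \<xi> (Suc q) x c \<mu> = c \<mu>" using Suc.prems(1) by (simp add: blend_def)
  moreover have "deboor \<xi> q x (blend \<xi> (Suc q) x c) \<mu> = blend \<xi> (Suc q) x c \<mu>"
    by (rule Suc.IH) (use Suc.prems in auto)
  ultimately show ?case by simp
qed simp

lemma deboor_at_left_knots:
  assumes "is_span \<xi> q \<mu>" "\<And>i. \<mu> - q < i \<Longrightarrow> i \<le> \<mu> \<Longrightarrow> \<xi> i = x"
  shows "deboor \<xi> q x c \<mu> = c (\<mu> - q)"
  using assms
proof (induction q arbitrary: c)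
  case (Suc q)
  have le: "Suc q \<le> \<mu>" using Suc.prems(1) by (simp add: is_span_def)
  have "\<xi> (\<mu> - q) = x" by (rule Suc.prems(2)) (use le in auto)
  moreover have "\<xi> (\<mu> - q) < \<xi> (\<mu> - q + Suc q)"
    using is_span_knots[OF Suc.prems(1) order.refl, of "\<mu> - q"] le by auto
  ultimately have "blend \<xi> (Suc q) x c (\<mu> - q) = c (\<mu> - q - 1)" by (simp add: blend_def)
  moreover have "deboor \<xi> q x (blend \<xi> (Suc q) x c) \<mu> = blend \<xi> (Suc q) x c (\<mu> - q)"
    by (rule Suc.IH) (use Suc.prems le in \<open>auto intro: is_span_mono\<close>)
  ultimately show ?case by simp
qed simp

text \<open>Smoothness across a knot \<open>x\<close> of multiplicity \<open>r\<close>. The last \<open>r\<close> steps do not change the result: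
  both sides pick the same entry \<open>\<mu>\<close> of level \<open>r\<close>, because at \<open>x\<close> one of the two weights vanishes.
  The steps before them are common to both sides. For \<open>q = p\<close> this compares values, and for
  \<open>q = p - 1\<close>, applied to differences, first derivatives.\<close>

lemma deboor_across_knot:
  assumes "is_span \<xi> r (\<mu> + r)" "\<xi> \<mu> < x" "\<And>i. \<mu> < i \<Longrightarrow> i \<le> \<mu> + r \<Longrightarrow> \<xi> i = x" "r \<le> q"
  shows "deboor \<xi> q x c \<mu> = deboor \<xi> q x c (\<mu> + r)"
  using assms(4)
proof (induction q arbitrary: c rule: dec_induct)
  case base
  show ?case
    using deboor_at_right_knots[of \<xi> \<mu> x r c] deboor_at_left_knots[OF assms(1), of x c] assms(2,3)
    by simp
qed simp

lemma bspline_eq_0: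
  assumes "\<And>i. j \<le> i \<Longrightarrow> i \<le> j + p \<Longrightarrow> bspline \<xi> e 0 i x = 0"
  shows "bspline \<xi> e p j x = 0"
  using assms
proof (induction p arbitrary: j)
  case (Suc p)
  have "bspline \<xi> e p j x = 0" "bspline \<xi> e p (j + 1) x = 0"
    by (rule Suc.IH, rule Suc.prems, simp, simp)+
  then show ?case by simp
qed simp

text \<open>Summation by parts moves the Cox--de Boor recursion from the basis functions to the
  coefficients.\<close>

lemma bspline_sum_window:
  assumes "is_span \<xi> p \<mu>"
    "\<And>i. \<mu> - p \<le> i \<Longrightarrow> i \<le> \<mu> + p \<Longrightarrow> bspline \<xi> e 0 i x = (if i = \<mu> then 1 else 0)"
  shows "(\<Sum>j=\<mu>-p..\<mu>. c j * bspline \<xi> e p j x) = deboor \<xi> p x c \<mu>"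
  using assms
proof (induction p arbitrary: c)
  case 0
  show ?case using 0(2)[of \<mu>] by (simp del: bspline.simps)
next
  case (Suc p)
  have le: "Suc p \<le> \<mu>" using Suc.prems(1) by (simp add: is_span_def)
  let ?b = "\<lambda>j. bspline \<xi> e p j x"
  let ?l = "\<mu> - Suc p"
  define d where "d j = \<xi> (j + Suc p) - \<xi> j" for j
  have z0: "?b ?l = 0" by (rule bspline_eq_0) (use Suc.prems(2) le in \<open>simp del: bspline.simps\<close>)
  have z1: "?b (Suc \<mu>) = 0" by (rule bspline_eq_0) (use Suc.prems(2) le in \<open>simp del: bspline.simps\<close>)
  have l1: "Suc ?l = \<mu> - p" using le by simp
  have "(\<Sum>j=?l..\<mu>. c j * bspline \<xi> e (Suc p) j x)
      = (\<Sum>j=?l..\<mu>. c j * ((x - \<xi> j) / d j * ?b j))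
      + (\<Sum>j=?l..\<mu>. c j * ((\<xi> (j + Suc p + 1) - x) / d (j + 1) * ?b (j + 1)))"
    by (simp add: sum.distrib[symmetric] d_def algebra_simps)
  also have "(\<Sum>j=?l..\<mu>. c j * ((x - \<xi> j) / d j * ?b j))
     = (\<Sum>j=\<mu>-p..\<mu>. c j * ((x - \<xi> j) / d j * ?b j))"
    using l1 z0 by (subst sum.atLeast_Suc_atMost) auto
  also have "(\<Sum>j=?l..\<mu>. c j * ((\<xi> (j + Suc p + 1) - x) / d (j + 1) * ?b (j + 1)))
     = (\<Sum>j=Suc ?l..Suc \<mu>. c (j - 1) * ((\<xi> (j + Suc p) - x) / d j * ?b j))"
    by (subst sum.shift_bounds_cl_Suc_ivl) simp
  also have "\<dots> = (\<Sum>j=\<mu>-p..\<mu>. c (j - 1) * ((\<xi> (j + Suc p) - x) / d j * ?b j))"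
    using l1 z1 by (simp del: sum.cl_ivl_Suc add: sum.cl_ivl_Suc[of _ "\<mu>-p" \<mu>])
  also have "(\<Sum>j=\<mu>-p..\<mu>. c j * ((x - \<xi> j) / d j * ?b j)) + \<dots>
     = (\<Sum>j=\<mu>-p..\<mu>. blend \<xi> (Suc p) x c j * ?b j)"
    by (simp add: sum.distrib[symmetric] d_def blend_def field_simps add_divide_distrib[symmetric])
  also have "\<dots> = deboor \<xi> p x (blend \<xi> (Suc p) x c) \<mu>"
    by (rule Suc.IH) (use Suc.prems in \<open>auto intro: is_span_mono simp del: bspline.simps\<close>)
  finally show ?case by simp
qed

text \<open>If the polynomial vanishes, so does its derivative, and by induction all differences of
  coefficients are 0. Equal coefficients are the value of the polynomial, hence 0.\<close>

lemma deboor_eq_0_imp_coeff_eq_0: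
  assumes "is_span \<xi> p \<mu>" "\<And>x. \<xi> \<mu> < x \<Longrightarrow> x < \<xi> (\<mu> + 1) \<Longrightarrow> deboor \<xi> p x c \<mu> = 0"
    "\<mu> - p \<le> j" "j \<le> \<mu>"
  shows "c j = 0"
  using assms
proof (induction p arbitrary: c j)
  case 0
  have "\<exists>x. \<xi> \<mu> < x \<and> x < \<xi> (\<mu> + 1)" using 0(1) by (auto simp: is_span_def intro: dense)
  then show ?case using 0 by auto
next
  case (Suc p)
  have le: "Suc p \<le> \<mu>" using Suc.prems(1) by (simp add: is_span_def)
  let ?x = "(\<xi> \<mu> + \<xi> (\<mu> + 1)) / 2"
  have x: "\<xi> \<mu> < ?x" "?x < \<xi> (\<mu> + 1)" using Suc.prems(1) by (auto simp: is_span_def)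
  have dd: "ddiff \<xi> (Suc p) c i = 0" if "\<mu> - p \<le> i" "i \<le> \<mu>" for i
  proof (rule Suc.IH[of "ddiff \<xi> (Suc p) c"])
    fix x assume x: "\<xi> \<mu> < x" "x < \<xi> (\<mu> + 1)"
    have 1: "((\<lambda>x. deboor \<xi> (Suc p) x c \<mu>) has_real_derivative
        real (Suc p) * deboor \<xi> p x (ddiff \<xi> (Suc p) c) \<mu>) (at x)"
      using deboor_has_derivative[OF Suc.prems(1)] by simp
    have "eventually (\<lambda>y. y \<in> {\<xi> \<mu><..<\<xi> (\<mu> + 1)}) (nhds x)"
      by (rule eventually_nhds_in_open) (use x in auto)
    then have "eventually (\<lambda>y. deboor \<xi> (Suc p) y c \<mu> = 0) (nhds x)"
      by eventually_elim (use Suc.prems(2) in auto)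
    then have "((\<lambda>x. deboor \<xi> (Suc p) x c \<mu>) has_real_derivative 0) (at x)"
      by (subst DERIV_cong_ev[OF refl _ refl]) auto
    from DERIV_unique[OF 1 this] show "deboor \<xi> p x (ddiff \<xi> (Suc p) c) \<mu> = 0" by simp
  qed (use Suc.prems that in \<open>auto intro: is_span_mono\<close>)
  have step: "c i = c (i - 1)" if "\<mu> - p \<le> i" "i \<le> \<mu>" for i
  proof -
    have "\<mu> < i + Suc p" using that le by linarith
    then have "\<xi> i \<noteq> \<xi> (i + Suc p)"
      using is_span_knots[OF Suc.prems(1) order.refl, of i] that by linarith
    then show ?thesis using dd[OF that] by (simp add: ddiff_def)
  qed
  have const: "c (\<mu> - i) = c \<mu>" if "i \<le> Suc p" for i
    using that
  proof (induction i)
    case (Suc i)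
    have "c (\<mu> - i) = c (\<mu> - i - 1)" by (rule step) (use Suc.prems le in auto)
    then show ?case using Suc by simp
  qed simp
  have "deboor \<xi> (Suc p) ?x c \<mu> = c \<mu>"
  proof (rule level_invariant[where P = "\<lambda>y. y = c \<mu>" and \<mu> = \<mu>])
    show "c i = c \<mu>" if "\<mu> - (0 + Suc p) \<le> i" "i \<le> \<mu>" for i using const[of "\<mu> - i"] that by simp
  qed (use Suc.prems(1) x in \<open>auto simp: algebra_simps\<close>)
  then have "c \<mu> = 0" using Suc.prems(2)[OF x] by simp
  then show ?case using const[of "\<mu> - j"] Suc.prems by simp
qed

section \<open>Convex control polygons and the Wronskian of a planar curve\<close>

definition det3 :: "real \<Rightarrow> real \<Rightarrow> real \<Rightarrow> real \<Rightarrow> real \<Rightarrow> real \<Rightarrow> real \<Rightarrow> real \<Rightarrow> real \<Rightarrow> real" where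
  "det3 a1 a2 a3 b1 b2 b3 c1 c2 c3 =
     a1 * (b2 * c3 - b3 * c2) - a2 * (b1 * c3 - b3 * c1) + a3 * (b1 * c2 - b2 * c1)"

definition tri :: "(nat \<Rightarrow> real) \<Rightarrow> (nat \<Rightarrow> real) \<Rightarrow> (nat \<Rightarrow> real) \<Rightarrow> nat \<Rightarrow> nat \<Rightarrow> nat \<Rightarrow> real" where
  "tri X Y Z i j k = det3 (X i) (Y i) (Z i) (X j) (Y j) (Z j) (X k) (Y k) (Z k)"

text \<open>The triples \<open>(X i, Y i, Z i)\<close> are homogeneous coordinates of points of a plane polygon with
  weights \<open>Z i\<close>, and a non-negative determinant means a positively oriented triangle. The weak
  inequality is required for all triples and not only for consecutive ones, since only then is it
  stable under cutting corners.\<close>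

definition convex_chain :: "(nat \<Rightarrow> real) \<Rightarrow> (nat \<Rightarrow> real) \<Rightarrow> (nat \<Rightarrow> real) \<Rightarrow> nat \<Rightarrow> nat \<Rightarrow> bool" where
  "convex_chain X Y Z l h \<longleftrightarrow>
     (\<forall>i j k. l \<le> i \<longrightarrow> i < j \<longrightarrow> j < k \<longrightarrow> k \<le> h \<longrightarrow> 0 \<le> tri X Y Z i j k) \<and>
     (\<forall>i. l \<le> i \<longrightarrow> i + 2 \<le> h \<longrightarrow> 0 < tri X Y Z i (i + 1) (i + 2))"

lemma det3_mix:
  "det3 ((1 - t) * a1 + t * d1) ((1 - t) * a2 + t * d2) ((1 - t) * a3 + t * d3) b1 b2 b3 c1 c2 c3
   = (1 - t) * det3 a1 a2 a3 b1 b2 b3 c1 c2 c3 + t * det3 d1 d2 d3 b1 b2 b3 c1 c2 c3"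
  "det3 a1 a2 a3 ((1 - t) * b1 + t * d1) ((1 - t) * b2 + t * d2) ((1 - t) * b3 + t * d3) c1 c2 c3
   = (1 - t) * det3 a1 a2 a3 b1 b2 b3 c1 c2 c3 + t * det3 a1 a2 a3 d1 d2 d3 c1 c2 c3"
  "det3 a1 a2 a3 b1 b2 b3 ((1 - t) * c1 + t * d1) ((1 - t) * c2 + t * d2) ((1 - t) * c3 + t * d3)
   = (1 - t) * det3 a1 a2 a3 b1 b2 b3 c1 c2 c3 + t * det3 a1 a2 a3 b1 b2 b3 d1 d2 d3"
  unfolding det3_def by (simp_all add: algebra_simps)

lemma det3_repeated [simp]:
  "det3 a1 a2 a3 a1 a2 a3 c1 c2 c3 = 0" "det3 a1 a2 a3 b1 b2 b3 b1 b2 b3 = 0"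
  "det3 a1 a2 a3 b1 b2 b3 a1 a2 a3 = 0"
  unfolding det3_def by (simp_all add: algebra_simps)

lemma convex_chainD:
  assumes "convex_chain X Y Z l h" "l \<le> i" "i \<le> j" "j \<le> k" "k \<le> h"
  shows "0 \<le> tri X Y Z i j k"
proof (cases "i = j \<or> j = k")
  case True
  then show ?thesis by (auto simp: tri_def)
next
  case False
  then show ?thesis using assms by (auto simp: convex_chain_def)
qed

lemma mix_nonneg:
  fixes a b t :: real
  assumes "0 \<le> t" "t \<le> 1" "0 \<le> a" "0 \<le> b"
  shows "0 \<le> (1 - t) * a + t * b"
  using assms by (intro add_nonneg_nonneg mult_nonneg_nonneg) auto

lemma tri_mix:
  assumes "\<And>c. c \<in> {X, Y, Z} \<Longrightarrow> f c i = (1 - r) * c (i - 1) + r * c i"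
    "\<And>c. c \<in> {X, Y, Z} \<Longrightarrow> f c j = (1 - s) * c (j - 1) + s * c j"
    "\<And>c. c \<in> {X, Y, Z} \<Longrightarrow> f c k = (1 - t) * c (k - 1) + t * c k"
  shows "tri (f X) (f Y) (f Z) i j k =
     (1 - r) * ((1 - s) * ((1 - t) * tri X Y Z (i - 1) (j - 1) (k - 1) + t * tri X Y Z (i - 1) (j - 1) k)
              + s * ((1 - t) * tri X Y Z (i - 1) j (k - 1) + t * tri X Y Z (i - 1) j k))
     + r * ((1 - s) * ((1 - t) * tri X Y Z i (j - 1) (k - 1) + t * tri X Y Z i (j - 1) k)
              + s * ((1 - t) * tri X Y Z i j (k - 1) + t * tri X Y Z i j k))"
proof -
  have a: "f X i = (1 - r) * X (i - 1) + r * X i" "f Y i = (1 - r) * Y (i - 1) + r * Y i"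
     "f Z i = (1 - r) * Z (i - 1) + r * Z i" using assms(1) by auto
  have b: "f X j = (1 - s) * X (j - 1) + s * X j" "f Y j = (1 - s) * Y (j - 1) + s * Y j"
     "f Z j = (1 - s) * Z (j - 1) + s * Z j" using assms(2) by auto
  have c: "f X k = (1 - t) * X (k - 1) + t * X k" "f Y k = (1 - t) * Y (k - 1) + t * Y k"
     "f Z k = (1 - t) * Z (k - 1) + t * Z k" using assms(3) by auto
  show ?thesis unfolding tri_def a b c unfolding det3_mix(1) unfolding det3_mix(2) unfolding det3_mix(3) ..
qed

text \<open>Cutting corners. By multilinearity a determinant of new points is a non-negative combination of
  eight determinants of old points whose indices are still weakly increasing. For consecutive
  points one of the two extreme terms has a positive factor, provided that all weights avoid the
  same one of the values 0 and 1.\<close>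

lemma convex_chain_mix:
  assumes cc: "convex_chain X Y Z (l - 1) h" and l: "1 \<le> l"
    and f: "\<And>c i. c \<in> {X, Y, Z} \<Longrightarrow> l \<le> i \<Longrightarrow> i \<le> h \<Longrightarrow> f c i = (1 - t i) * c (i - 1) + t i * c i"
    and t: "\<And>i. l \<le> i \<Longrightarrow> i \<le> h \<Longrightarrow> 0 \<le> t i \<and> t i \<le> 1"
    and st: "(\<forall>i. l \<le> i \<longrightarrow> i \<le> h \<longrightarrow> 0 < t i) \<or> (\<forall>i. l \<le> i \<longrightarrow> i \<le> h \<longrightarrow> t i < 1)"
  shows "convex_chain (f X) (f Y) (f Z) l h"
  unfolding convex_chain_def
proof (intro conjI allI impI)
  fix i j k assume ijk: "l \<le> i" "i < j" "j < k" "k \<le> h"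
  note ex = tri_mix[of X Y Z f i "t i" j "t j" k "t k", OF f f f]
  show "0 \<le> tri (f X) (f Y) (f Z) i j k"
    using ijk l t[of i] t[of j] t[of k]
    by (subst ex) (auto intro!: mix_nonneg convex_chainD[OF cc])
next
  fix i assume i: "l \<le> i" "i + 2 \<le> h"
  let ?j = "i + 1" let ?k = "i + 2"
  note ex = tri_mix[of X Y Z f i "t i" ?j "t ?j" ?k "t ?k", OF f f f]
  have nn: "0 \<le> tri X Y Z a b c" if "i - 1 \<le> a" "a \<le> b" "b \<le> c" "c \<le> i + 2" for a b c
    by (rule convex_chainD[OF cc]) (use that i l in auto)
  have t3: "0 \<le> t i" "t i \<le> 1" "0 \<le> t ?j" "t ?j \<le> 1" "0 \<le> t ?k" "t ?k \<le> 1"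
    using t i by auto
  have p1: "0 < tri X Y Z i ?j ?k" using cc i by (auto simp: convex_chain_def)
  have "0 < tri X Y Z (i - 1) (i - 1 + 1) (i - 1 + 2)"
    using cc i l unfolding convex_chain_def by (meson diff_le_mono le_diff_conv le_trans add_le_mono1 diff_le_self)
  then have p2: "0 < tri X Y Z (i - 1) (?j - 1) (?k - 1)" using i l by simp
  have "0 < t i \<and> 0 < t ?j \<and> 0 < t ?k \<or> t i < 1 \<and> t ?j < 1 \<and> t ?k < 1" using st i by auto
  then show "0 < tri (f X) (f Y) (f Z) i ?j ?k"
  proof (elim disjE conjE)
    assume "0 < t i" "0 < t ?j" "0 < t ?k"
    then show ?thesis using i t3 l
      by (subst ex) (auto intro!: add_nonneg_pos mult_pos_pos mult_nonneg_nonneg add_nonneg_nonneg nn p1[simplified])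
  next
    assume "t i < 1" "t ?j < 1" "t ?k < 1"
    then show ?thesis using i t3 l p2
      by (subst ex) (auto intro!: add_pos_nonneg mult_pos_pos mult_nonneg_nonneg add_nonneg_nonneg nn)
  qed
qed

lemma convex_chain_subset:
  "convex_chain X Y Z l h \<Longrightarrow> l \<le> l' \<Longrightarrow> h' \<le> h \<Longrightarrow> convex_chain X Y Z l' h'"
  by (auto simp: convex_chain_def)

lemma convex_chain_level:
  assumes "is_span \<xi> (q + n) \<mu>" "\<xi> \<mu> \<le> x" "x \<le> \<xi> (\<mu> + 1)" "convex_chain X Y Z (\<mu> - (q + n)) \<mu>"
  shows "convex_chain (level \<xi> q n x X) (level \<xi> q n x Y) (level \<xi> q n x Z) (\<mu> - q) \<mu>"
  using assms
proof (induction n arbitrary: X Y Z)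
  case (Suc n)
  have le: "q + Suc n \<le> \<mu>" using Suc.prems(1) by (simp add: is_span_def)
  define t where "t j = (x - \<xi> j) / (\<xi> (j + (q + Suc n)) - \<xi> j)" for j
  show ?case unfolding level.simps
  proof (rule Suc.IH)
    show "is_span \<xi> (q + n) \<mu>" using Suc.prems(1) by (rule is_span_mono) simp
    have k: "i \<le> \<mu>" "\<mu> < i + (q + Suc n)" if "\<mu> - (q + n) \<le> i" "i \<le> \<mu>" for i using that le by auto
    note b = blend_convex[OF Suc.prems(1) order.refl k Suc.prems(2,3), folded t_def]
    have st: "\<xi> \<mu> < x \<or> x < \<xi> (\<mu> + 1)" using Suc.prems(1) by (auto simp: is_span_def)
    show "convex_chain (blend \<xi> (q + Suc n) x X) (blend \<xi> (q + Suc n) x Y) (blend \<xi> (q + Suc n) x Z) (\<mu> - (q + n)) \<mu>"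
    proof (rule convex_chain_mix[where t = t and f = "blend \<xi> (q + Suc n) x" and X = X and Y = Y and Z = Z])
      show "convex_chain X Y Z (\<mu> - (q + n) - 1) \<mu>" using Suc.prems(4) by simp
      show "(\<forall>i. \<mu> - (q + n) \<le> i \<longrightarrow> i \<le> \<mu> \<longrightarrow> 0 < t i) \<or> (\<forall>i. \<mu> - (q + n) \<le> i \<longrightarrow> i \<le> \<mu> \<longrightarrow> t i < 1)"
        using st
      proof
        assume "\<xi> \<mu> < x" then show ?thesis using b(4) by blast
      next
        assume "x < \<xi> (\<mu> + 1)" then show ?thesis using b(5) by blast
      qed
    qed (use le b in auto)
  qed (use Suc.prems in auto)
qed simp

lemma det3_rows:
  "det3 (v1 + a * \<alpha>1 + b * \<beta>1) (v2 + a * \<alpha>2 + b * \<beta>2) (v3 + a * \<alpha>3 + b * \<beta>3)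
        (c * \<alpha>1 + d * \<beta>1) (c * \<alpha>2 + d * \<beta>2) (c * \<alpha>3 + d * \<beta>3)
        (f * \<alpha>1 + g * \<beta>1) (f * \<alpha>2 + g * \<beta>2) (f * \<alpha>3 + g * \<beta>3)
   = (c * g - d * f) * det3 v1 v2 v3 \<alpha>1 \<alpha>2 \<alpha>3 \<beta>1 \<beta>2 \<beta>3"
  unfolding det3_def by algebra

lemma det3_differences:
  "det3 v1 v2 v3 ((v1 - u1) * r) ((v2 - u2) * r) ((v3 - u3) * r) ((w1 - v1) * s) ((w2 - v2) * s) ((w3 - v3) * s)
   = r * s * det3 u1 u2 u3 v1 v2 v3 w1 w2 w3"
  unfolding det3_def by algebra

abbreviation deboor' where
  "deboor' \<xi> p x c \<mu> \<equiv> real p * deboor \<xi> (p - 1) x (ddiff \<xi> p c) \<mu>"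

abbreviation deboor'' where
  "deboor'' \<xi> p x c \<mu> \<equiv> real p * (real (p - 1) * deboor \<xi> (p - 2) x (ddiff \<xi> (p - 1) (ddiff \<xi> p c)) \<mu>)"

lemma deboor'_has_derivative:
  assumes "is_span \<xi> p \<mu>"
  shows "((\<lambda>x. deboor' \<xi> p x c \<mu>) has_real_derivative deboor'' \<xi> p x c \<mu>) (at x within A)"
proof -
  have "is_span \<xi> (p - 1) \<mu>" using assms by (rule is_span_mono) simp
  from deboor_has_derivative[OF this, of "ddiff \<xi> p c" x A] show ?thesis
    by (intro DERIV_cmult) (simp add: numeral_2_eq_2)
qed

text \<open>After \<open>p - 2\<close> steps three points \<open>u, v, w\<close> are left. With \<open>\<alpha> = (v - u) / h1\<close> and
  \<open>\<beta> = (w - v) / h2\<close> the curve and its first two derivatives are a point of \<open>v + span {\<alpha>, \<beta>}\<close> and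
  two vectors of \<open>span {\<alpha>, \<beta>}\<close>, so that their determinant is a positive multiple of that of
  \<open>u, v, w\<close>, which is positive because corner cutting preserves convexity.\<close>

lemma deboor_wronskian_pos:
  assumes sp: "is_span \<xi> p \<mu>" and p: "2 \<le> p" and x: "\<xi> \<mu> \<le> x" "x \<le> \<xi> (\<mu> + 1)"
    and cc: "convex_chain X Y Z (\<mu> - p) \<mu>"
  shows "0 < det3 (deboor \<xi> p x X \<mu>) (deboor \<xi> p x Y \<mu>) (deboor \<xi> p x Z \<mu>)
    (deboor' \<xi> p x X \<mu>) (deboor' \<xi> p x Y \<mu>) (deboor' \<xi> p x Z \<mu>)
    (deboor'' \<xi> p x X \<mu>) (deboor'' \<xi> p x Y \<mu>) (deboor'' \<xi> p x Z \<mu>)"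
proof -
  obtain n where n: "p = 2 + n" using p le_Suc_ex by blast
  have le: "p \<le> \<mu>" using sp by (simp add: is_span_def)
  \<comment> \<open>The curve is \<open>v + (B\<^sup>2 \<beta> - A\<^sup>2 \<alpha>) / h\<close>, and \<open>A + B = h\<close>.\<close>
  define A where "A = \<xi> (\<mu> + 1) - x"
  define B where "B = x - \<xi> \<mu>"
  define h where "h = \<xi> (\<mu> + 1) - \<xi> \<mu>"
  define h1 where "h1 = \<xi> (\<mu> - 1 + 2) - \<xi> (\<mu> - 1)"
  define h2 where "h2 = \<xi> (\<mu> + 2) - \<xi> \<mu>"
  have h: "0 < h" "h = A + B" using sp by (auto simp: h_def A_def B_def is_span_def)
  have h1: "0 < h1" using is_span_knots[OF sp p, of "\<mu> - 1"] le p by (auto simp: h1_def)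
  have h2: "0 < h2" using is_span_knots[OF sp p, of "\<mu>"] le p by (auto simp: h2_def)
  define e where "e = level \<xi> 2 n x"
  define \<alpha> where "\<alpha> c = (e c (\<mu> - 1) - e c (\<mu> - 2)) * (1 / h1)" for c
  define \<beta> where "\<beta> c = (e c \<mu> - e c (\<mu> - 1)) * (1 / h2)" for c
  have dd2: "ddiff \<xi> 2 (e c) (\<mu> - 1) = \<alpha> c" "ddiff \<xi> 2 (e c) \<mu> = \<beta> c" for c
    by (simp_all add: ddiff_def \<alpha>_def \<beta>_def h1_def h2_def numeral_2_eq_2)
  have d2: "level \<xi> 1 n x (ddiff \<xi> p c) j = ddiff \<xi> 2 (e c) j" if "\<mu> - 1 \<le> j" "j \<le> \<mu>" for c j
    using ddiff_level[of \<xi> 1 n \<mu> j x c] sp that by (simp add: e_def n numeral_2_eq_2)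
  have d1: "deboor \<xi> n x (ddiff \<xi> (p - 1) (ddiff \<xi> p c)) \<mu> = ddiff \<xi> 1 (level \<xi> 1 n x (ddiff \<xi> p c)) \<mu>" for c
    using ddiff_level[of \<xi> 0 n \<mu> \<mu> x "ddiff \<xi> p c"] is_span_mono[OF sp, of "Suc n"] by (simp add: n)
  have kn: "\<xi> \<mu> \<noteq> \<xi> (\<mu> + 1)" "\<xi> \<mu> \<noteq> \<xi> (\<mu> + 2)" "\<xi> (\<mu> - 1) \<noteq> \<xi> (\<mu> - 1 + 2)"
    using h h1 h2 by (auto simp: h_def h1_def h2_def)
  have mu1: "\<mu> - 1 + 2 = \<mu> + 1" "\<mu> \<ge> 2" using le p by auto
  have e0: "deboor \<xi> p x c \<mu> = e c (\<mu> - 1) + (- (A * A) / h) * \<alpha> c + ((B * B) / h) * \<beta> c" for c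
  proof -
    have i1: "\<mu> - Suc 0 + 2 = Suc \<mu>" using mu1 by simp
    have b2: "blend \<xi> 2 x (e c) \<mu> = e c (\<mu> - 1) + B * \<beta> c"
      "blend \<xi> 2 x (e c) (\<mu> - 1) = e c (\<mu> - 1) - A * \<alpha> c"
      using blend_eqs(1)[OF kn(2), of x "e c"] blend_eqs(2)[OF kn(3), of x "e c"]
      using dd2[of c] i1 by (simp_all add: A_def B_def del: add_2_eq_Suc')
    have "deboor \<xi> p x c \<mu> = blend \<xi> 1 x (blend \<xi> 2 x (e c)) \<mu>"
      unfolding n level_add e_def by (simp add: numeral_2_eq_2)
    also have "\<dots> = (B * blend \<xi> 2 x (e c) \<mu> + A * blend \<xi> 2 x (e c) (\<mu> - 1)) / h"
      unfolding blend_def[of \<xi> 1] by (simp add: A_def B_def h_def)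
    also have "\<dots> = (h * e c (\<mu> - 1) - A * A * \<alpha> c + B * B * \<beta> c) / h"
      unfolding b2 h(2) by (simp add: algebra_simps)
    also have "\<dots> = e c (\<mu> - 1) + (- (A * A) / h) * \<alpha> c + ((B * B) / h) * \<beta> c"
      using h(1) by (simp add: add_divide_distrib diff_divide_distrib)
    finally show ?thesis .
  qed
  have e1: "deboor' \<xi> p x c \<mu> = (p * A / h) * \<alpha> c + (p * B / h) * \<beta> c" for c
  proof -
    have "deboor \<xi> (p - 1) x (ddiff \<xi> p c) \<mu> = deboor \<xi> 1 x (level \<xi> 1 n x (ddiff \<xi> p c)) \<mu>"
      using level_add[of \<xi> 1 n x "ddiff \<xi> p c"] by (simp add: n)
    also have "\<dots> = (B * \<beta> c + A * \<alpha> c) / h"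
      using dd2[of c] d2[of \<mu> c] d2[of "\<mu> - 1" c] by (simp add: blend_def A_def B_def h_def)
    finally show ?thesis by (simp add: add_divide_distrib algebra_simps)
  qed
  have e2: "deboor'' \<xi> p x c \<mu> = (- (real p * real (p - 1) / h)) * \<alpha> c + (real p * real (p - 1) / h) * \<beta> c" for c
  proof -
    have "deboor \<xi> (p - 2) x (ddiff \<xi> (p - 1) (ddiff \<xi> p c)) \<mu> = (\<beta> c - \<alpha> c) / h"
      using d1[of c] dd2[of c] d2[of \<mu> c] d2[of "\<mu> - 1" c]
      by (simp add: n ddiff_def[of \<xi> "Suc 0"] h_def)
    then show ?thesis by (simp only:) (simp add: diff_divide_distrib algebra_simps)
  qed
  have T: "0 < tri (e X) (e Y) (e Z) (\<mu> - 2) (\<mu> - 2 + 1) (\<mu> - 2 + 2)"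
    using convex_chain_level[of \<xi> 2 n \<mu> x X Y Z] sp x cc le p
    unfolding e_def convex_chain_def n by auto
  have i: "\<mu> - 2 + 1 = \<mu> - 1" "\<mu> - 2 + 2 = \<mu>" using mu1 by auto
  have D: "det3 (e X (\<mu> - 1)) (e Y (\<mu> - 1)) (e Z (\<mu> - 1)) (\<alpha> X) (\<alpha> Y) (\<alpha> Z) (\<beta> X) (\<beta> Y) (\<beta> Z) > 0"
    unfolding \<alpha>_def \<beta>_def det3_differences using T[unfolded i tri_def] h1 h2 by simp
  define N where "N = real p * real (p - 1) / h"
  have c: "p * A / h * (real p * real (p - 1) / h) - p * B / h * - (real p * real (p - 1) / h) = p * N"
  proof -
    have "p * A / h * (real p * real (p - 1) / h) - p * B / h * - (real p * real (p - 1) / h) = p * N * ((A + B) / h)"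
      unfolding N_def by (simp add: add_divide_distrib algebra_simps del: of_nat_diff)
    also have "(A + B) / h = 1" using h by simp
    finally show ?thesis by simp
  qed
  have "0 < N" using h p by (simp add: N_def)
  show ?thesis unfolding e0 e1 e2 det3_rows c using D \<open>0 < N\<close> p by simp
qed

lemma second_derivative_pos_imp_local_min:
  fixes f f1 :: "real \<Rightarrow> real"
  assumes "\<And>z. (f has_real_derivative f1 z) (at z)" "(f1 has_real_derivative d) (at x)"
    "f x = 0" "f1 x = 0" "0 < d"
  shows "eventually (\<lambda>z. 0 < f z) (at x)"
proof -
  obtain e1 where e1: "e1 > 0" "\<And>h. 0 < h \<Longrightarrow> h < e1 \<Longrightarrow> f1 x < f1 (x + h)"
    using DERIV_pos_inc_right[OF assms(2,5)] by auto
  obtain e2 where e2: "e2 > 0" "\<And>h. 0 < h \<Longrightarrow> h < e2 \<Longrightarrow> f1 (x - h) < f1 x"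
    using DERIV_pos_inc_left[OF assms(2,5)] by auto
  show ?thesis
  proof (rule eventually_at[THEN iffD2], intro exI[of _ "min e1 e2"] conjI ballI impI)
    fix z assume z: "z \<noteq> x \<and> dist z x < min e1 e2"
    show "0 < f z"
    proof (cases "x < z")
      case True
      obtain y where y: "x < y" "y < z" "f z - f x = (z - x) * f1 y"
        using MVT2[OF True, of f f1] assms(1) by blast
      have "0 < f1 y" using e1(2)[of "y - x"] y z assms(4) by (auto simp: dist_real_def)
      then show ?thesis using y True assms(3) by simp
    next
      case False
      then have F: "z < x" using z by auto
      obtain y where y: "z < y" "y < x" "f x - f z = (x - z) * f1 y"
        using MVT2[OF F, of f f1] assms(1) by blast
      have "f1 y < 0" using e2(2)[of "x - y"] y z assms(4) by (auto simp: dist_real_def)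
      then have "(x - z) * f1 y < 0" using F by (simp add: mult_pos_neg)
      then show ?thesis using y assms(3) by linarith
    qed
  qed (use e1 e2 in auto)
qed

text \<open>Here \<open>\<Gamma> = (P, Q, W)\<close> are homogeneous coordinates of the plane curve \<open>\<gamma> = (P, Q) / W\<close>, and \<open>rad\<close>
  says \<open>\<gamma>' = c \<gamma>\<close> at \<open>x\<close>. Then \<open>\<Gamma>' = k \<Gamma> - (0, 0, c W)\<close>, so that the determinant is \<open>W(x)\<close> times the
  second derivative at \<open>x\<close> of the function in the conclusion. The value and the first derivative of
  that function vanish at \<open>x\<close>.\<close>

lemma curve_on_one_side_of_radial_tangent:
  fixes P Q W P1 Q1 W1 :: "real \<Rightarrow> real"
  assumes "\<And>z. (P has_real_derivative P1 z) (at z)" "\<And>z. (Q has_real_derivative Q1 z) (at z)"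
    "(P1 has_real_derivative p2) (at x)" "(Q1 has_real_derivative q2) (at x)"
    and W: "0 < W x"
    and det: "0 < det3 (P x) (Q x) (W x) (P1 x) (Q1 x) (W1 x) p2 q2 w2"
    and rad: "P1 x * W x - P x * W1 x = c * P x * W x" "Q1 x * W x - Q x * W1 x = c * Q x * W x"
  shows "eventually (\<lambda>z. 0 < c * (P x * Q z - Q x * P z)) (at x)"
proof (rule second_derivative_pos_imp_local_min)
  define k where "k = c + W1 x / W x"
  have k: "P1 x = k * P x" "Q1 x = k * Q x" "W1 x = (k - c) * W x"
    using rad W by (auto simp: k_def field_simps)
  show "((\<lambda>z. c * (P x * Q z - Q x * P z)) has_real_derivative c * (P x * Q1 z - Q x * P1 z)) (at z)" for z
    by (intro DERIV_cmult DERIV_diff assms)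
  show "((\<lambda>z. c * (P x * Q1 z - Q x * P1 z)) has_real_derivative c * (P x * q2 - Q x * p2)) (at x)"
    by (intro DERIV_cmult DERIV_diff assms)
  show "c * (P x * Q1 x - Q x * P1 x) = 0" by (simp add: k)
  have "det3 (P x) (Q x) (W x) (P1 x) (Q1 x) (W1 x) p2 q2 w2 = W x * (c * (P x * q2 - Q x * p2))"
    unfolding det3_def k by algebra
  with det W show "0 < c * (P x * q2 - Q x * p2)" by (simp add: zero_less_mult_iff)
qed simp

section \<open>Rational splines on one segment\<close>

definition numer :: "segment \<Rightarrow> nat \<Rightarrow> (nat \<Rightarrow> real) \<Rightarrow> real \<Rightarrow> real" where
  "numer g \<mu> C y = deboor (knot g) (deg g) y (\<lambda>j. wt g j * C j) \<mu>"

definition numer' :: "segment \<Rightarrow> nat \<Rightarrow> (nat \<Rightarrow> real) \<Rightarrow> real \<Rightarrow> real" where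
  "numer' g \<mu> C y = deboor' (knot g) (deg g) y (\<lambda>j. wt g j * C j) \<mu>"

abbreviation denom :: "segment \<Rightarrow> nat \<Rightarrow> real \<Rightarrow> real" where
  "denom g \<mu> \<equiv> numer g \<mu> (\<lambda>_. 1)"

abbreviation denom' :: "segment \<Rightarrow> nat \<Rightarrow> real \<Rightarrow> real" where
  "denom' g \<mu> \<equiv> numer' g \<mu> (\<lambda>_. 1)"

text \<open>The rational function that the spline with coefficients \<open>C\<close> equals on the span \<open>\<mu>\<close>, defined for
  every \<open>y\<close>, so that it can be differentiated at the knots.\<close>

definition rat :: "segment \<Rightarrow> nat \<Rightarrow> (nat \<Rightarrow> real) \<Rightarrow> real \<Rightarrow> real" where
  "rat g \<mu> C y = numer g \<mu> C y / denom g \<mu> y"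

definition rat' :: "segment \<Rightarrow> nat \<Rightarrow> (nat \<Rightarrow> real) \<Rightarrow> real \<Rightarrow> real" where
  "rat' g \<mu> C y = (numer' g \<mu> C y * denom g \<mu> y - numer g \<mu> C y * denom' g \<mu> y)
     / (denom g \<mu> y * denom g \<mu> y)"

definition seg_fun :: "segment \<Rightarrow> (nat \<Rightarrow> real) \<Rightarrow> real \<Rightarrow> real" where
  "seg_fun g C y = (\<Sum>j=1..dim g. C j * nurbs g j y)"

lemma threshold:
  fixes N :: nat
  assumes "P 1" "\<not> P N" "\<And>i j. 1 \<le> i \<Longrightarrow> i \<le> j \<Longrightarrow> j \<le> N \<Longrightarrow> P j \<Longrightarrow> P i" "1 \<le> N"
  obtains m where "1 \<le> m" "m < N" "\<And>i. 1 \<le> i \<Longrightarrow> i \<le> N \<Longrightarrow> P i \<longleftrightarrow> i \<le> m"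
proof -
  define A where "A = {i\<in>{1..N}. P i}"
  have A: "finite A" "A \<noteq> {}" using assms by (auto simp: A_def)
  define m where "m = Max A"
  have mA: "m \<in> A" and mx: "\<And>i. i \<in> A \<Longrightarrow> i \<le> m" using A by (auto simp: m_def)
  show ?thesis
  proof (rule that[of m])
    show "1 \<le> m" using mA by (simp add: A_def)
    show "m < N" using mA assms(2) by (auto simp: A_def intro: le_neq_implies_less)
    show "P i \<longleftrightarrow> i \<le> m" if "1 \<le> i" "i \<le> N" for i
      using mA mx[of i] that assms(3)[of i m] by (auto simp: A_def)
  qed
qed

context
  fixes g :: segment
  assumes g: "valid_segment g"
begin

lemma seg_basic:
  "2 \<le> deg g" "deg g < dim g" "3 \<le> dim g"
  "\<And>i j. 1 \<le> i \<Longrightarrow> i \<le> j \<Longrightarrow> j \<le> dim g + deg g + 1 \<Longrightarrow> knot g i \<le> knot g j"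
  "\<And>j. 1 \<le> j \<Longrightarrow> j \<le> deg g + 1 \<Longrightarrow> knot g j = left_end g"
  "\<And>j. dim g + 1 \<le> j \<Longrightarrow> j \<le> dim g + deg g + 1 \<Longrightarrow> knot g j = right_end g"
  "left_end g < knot g (deg g + 2)" "knot g (dim g) < right_end g"
  "\<And>j. 1 \<le> j \<Longrightarrow> j \<le> dim g \<Longrightarrow> 0 < wt g j"
  using g unfolding valid_segment_def open_knot_vector_def mono_on_def by auto

lemma left_less_right: "left_end g < right_end g"
  using seg_basic(7) seg_basic(4)[of "deg g + 2" "dim g + deg g + 1"] seg_basic(1,2)
  by (simp add: right_end_def)

lemma multiplicity_bound:
  assumes "deg g + 2 \<le> j" "j \<le> dim g"
  shows "card {i\<in>{1..dim g + deg g + 1}. knot g i = knot g j} \<le> deg g - 1"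
  using g assms unfolding valid_segment_def open_knot_vector_def by auto

lemma seg_is_span:
  assumes "deg g + 1 \<le> \<mu>" "\<mu> \<le> dim g" "knot g \<mu> < knot g (\<mu> + 1)"
  shows "is_span (knot g) (deg g) \<mu>"
  unfolding is_span_def using assms seg_basic by auto

lemma right_span:
  assumes "left_end g \<le> y" "y < right_end g"
  obtains \<mu> where "deg g + 1 \<le> \<mu>" "\<mu> \<le> dim g" "knot g \<mu> \<le> y" "y < knot g (\<mu> + 1)"
    "\<And>i. 1 \<le> i \<Longrightarrow> i \<le> dim g + deg g + 1 \<Longrightarrow> knot g i \<le> y \<longleftrightarrow> i \<le> \<mu>"
proof -
  let ?N = "dim g + deg g + 1"
  obtain m where m: "1 \<le> m" "m < ?N" "\<And>i. 1 \<le> i \<Longrightarrow> i \<le> ?N \<Longrightarrow> knot g i \<le> y \<longleftrightarrow> i \<le> m"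
    by (rule threshold[of "\<lambda>i. knot g i \<le> y" ?N])
      (use assms in \<open>auto simp: left_end_def right_end_def intro: order.trans[OF seg_basic(4)]\<close>)
  have "deg g + 1 \<le> m" using m(3)[of "deg g + 1"] seg_basic(5)[of "deg g + 1"] assms by auto
  moreover have "m \<le> dim g" using m(3)[of "dim g + 1"] seg_basic(6)[of "dim g + 1"] assms by force
  moreover have "knot g m \<le> y" "y < knot g (m + 1)" using m(3)[of m] m(3)[of "m + 1"] m(1,2) by auto
  ultimately show ?thesis using m(3) that by blast
qed

lemma left_span:
  assumes "left_end g < y" "y \<le> right_end g"
  obtains \<mu> where "deg g + 1 \<le> \<mu>" "\<mu> \<le> dim g" "knot g \<mu> < y" "y \<le> knot g (\<mu> + 1)"
    "\<And>i. 1 \<le> i \<Longrightarrow> i \<le> dim g + deg g + 1 \<Longrightarrow> knot g i < y \<longleftrightarrow> i \<le> \<mu>"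
proof -
  let ?N = "dim g + deg g + 1"
  obtain m where m: "1 \<le> m" "m < ?N" "\<And>i. 1 \<le> i \<Longrightarrow> i \<le> ?N \<Longrightarrow> knot g i < y \<longleftrightarrow> i \<le> m"
    by (rule threshold[of "\<lambda>i. knot g i < y" ?N])
      (use assms in \<open>auto simp: left_end_def right_end_def intro: order.strict_trans1[OF seg_basic(4)]\<close>)
  have "deg g + 1 \<le> m" using m(3)[of "deg g + 1"] seg_basic(5)[of "deg g + 1"] assms by auto
  moreover have "m \<le> dim g" using m(3)[of "dim g + 1"] seg_basic(6)[of "dim g + 1"] assms by force
  moreover have "knot g m < y" "y \<le> knot g (m + 1)" using m(3)[of m] m(3)[of "m + 1"] m(1,2) by auto
  ultimately show ?thesis using m(3) that by blast
qed

text \<open>The span whose polynomials give the B-splines at \<open>y\<close>. The right end belongs to the last span,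
  in agreement with the definition of the B-splines.\<close>

definition in_span :: "nat \<Rightarrow> real \<Rightarrow> bool" where
  "in_span \<mu> y \<longleftrightarrow> deg g + 1 \<le> \<mu> \<and> \<mu> \<le> dim g \<and> knot g \<mu> < knot g (\<mu> + 1) \<and>
     knot g \<mu> \<le> y \<and> (y < knot g (\<mu> + 1) \<or> y = right_end g \<and> \<mu> = dim g)"

lemma in_span_exists:
  assumes "left_end g \<le> y" "y \<le> right_end g"
  obtains \<mu> where "in_span \<mu> y"
proof (cases "y < right_end g")
  case True
  from right_span[OF assms(1) True] obtain \<mu> where
    "deg g + 1 \<le> \<mu>" "\<mu> \<le> dim g" "knot g \<mu> \<le> y" "y < knot g (\<mu> + 1)" by blast
  then show ?thesis by (intro that[of \<mu>]) (auto simp: in_span_def)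
next
  case False
  then show ?thesis using assms seg_basic(1,2,6,8)
    by (intro that[of "dim g"]) (auto simp: in_span_def)
qed

lemma bspline_0_in_span:
  assumes "in_span \<mu> y" "1 \<le> i" "i \<le> dim g + deg g"
  shows "bspline (knot g) (right_end g) 0 i y = (if i = \<mu> then 1 else 0)"
proof (cases "y < knot g (\<mu> + 1)")
  case True
  have s: "deg g + 1 \<le> \<mu>" "\<mu> \<le> dim g" "knot g \<mu> \<le> y" using assms(1) by (auto simp: in_span_def)
  have "knot g (\<mu> + 1) \<le> right_end g"
    using seg_basic(4)[of "\<mu> + 1" "dim g + deg g + 1"] s seg_basic(1) by (simp add: right_end_def)
  then have "y \<noteq> right_end g" using True by auto
  moreover consider "i < \<mu>" | "i = \<mu>" | "\<mu> < i" by linarith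
  then have "(knot g i \<le> y \<and> y < knot g (i + 1)) = (i = \<mu>)"
  proof cases
    case 1
    then have "knot g (i + 1) \<le> knot g \<mu>" by (intro seg_basic(4)) (use s assms in auto)
    then show ?thesis using 1 s by auto
  next
    case 2
    then show ?thesis using s True by simp
  next
    case 3
    then have "knot g (\<mu> + 1) \<le> knot g i" by (intro seg_basic(4)) (use s assms in auto)
    then show ?thesis using 3 True by auto
  qed
  ultimately show ?thesis by simp
next
  case False
  then have s: "y = right_end g" "\<mu> = dim g" using assms(1) by (auto simp: in_span_def)
  have le: "knot g (i + 1) \<le> right_end g"
    using seg_basic(4)[of "i + 1" "dim g + deg g + 1"] assms by (simp add: right_end_def)
  consider "i < dim g" | "i = dim g" | "dim g < i" by linarith
  then have "(knot g i < right_end g \<and> knot g (i + 1) = right_end g) = (i = dim g)"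
  proof cases
    case 1
    then have "knot g (i + 1) \<le> knot g (dim g)" by (intro seg_basic(4)) (use assms in auto)
    then show ?thesis using 1 seg_basic(8) by auto
  next
    case 2
    then show ?thesis using seg_basic(6,8) by simp
  next
    case 3
    then have "knot g i = right_end g" by (intro seg_basic(6)) (use assms in auto)
    then show ?thesis using 3 by simp
  qed
  then show ?thesis using s le by simp
qed

lemma bspline_sum:
  assumes "in_span \<mu> y"
  shows "(\<Sum>j=1..dim g. c j * bspline (knot g) (right_end g) (deg g) j y) = deboor (knot g) (deg g) y c \<mu>"
proof -
  have s: "deg g + 1 \<le> \<mu>" "\<mu> \<le> dim g" "knot g \<mu> < knot g (\<mu> + 1)" using assms by (auto simp: in_span_def)
  have "(\<Sum>j=\<mu>-deg g..\<mu>. c j * bspline (knot g) (right_end g) (deg g) j y)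
      = (\<Sum>j=1..dim g. c j * bspline (knot g) (right_end g) (deg g) j y)"
  proof (rule sum.mono_neutral_left)
    show "\<forall>j\<in>{1..dim g} - {\<mu> - deg g..\<mu>}. c j * bspline (knot g) (right_end g) (deg g) j y = 0"
    proof
      fix j assume j: "j \<in> {1..dim g} - {\<mu> - deg g..\<mu>}"
      have "bspline (knot g) (right_end g) (deg g) j y = 0"
      proof (rule bspline_eq_0)
        fix i assume "j \<le> i" "i \<le> j + deg g"
        then show "bspline (knot g) (right_end g) 0 i y = 0"
          using bspline_0_in_span[OF assms, of i] j by (auto simp del: bspline.simps)
      qed
      then show "c j * bspline (knot g) (right_end g) (deg g) j y = 0" by simp
    qed
  qed (use s in auto)
  moreover have "(\<Sum>j=\<mu>-deg g..\<mu>. c j * bspline (knot g) (right_end g) (deg g) j y) = deboor (knot g) (deg g) y c \<mu>"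
  proof (rule bspline_sum_window)
    show "is_span (knot g) (deg g) \<mu>" using seg_is_span s by blast
    show "bspline (knot g) (right_end g) 0 i y = (if i = \<mu> then 1 else 0)"
      if "\<mu> - deg g \<le> i" "i \<le> \<mu> + deg g" for i
      by (rule bspline_0_in_span[OF assms]) (use that s in auto)
  qed
  ultimately show ?thesis by simp
qed

lemma in_span_is_span: "in_span \<mu> y \<Longrightarrow> is_span (knot g) (deg g) \<mu>"
  using seg_is_span by (auto simp: in_span_def)

lemma in_span_bounds:
  assumes "in_span \<mu> y" shows "knot g \<mu> \<le> y" "y \<le> knot g (\<mu> + 1)"
  using assms seg_basic(6)[of "dim g + 1"] by (auto simp: in_span_def)

lemma denom_pos:
  assumes "deg g + 1 \<le> \<mu>" "\<mu> \<le> dim g" "knot g \<mu> < knot g (\<mu> + 1)" "knot g \<mu> \<le> y" "y \<le> knot g (\<mu> + 1)"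
  shows "0 < denom g \<mu> y"
  unfolding numer_def by (rule level_pos[where \<mu> = \<mu>]) (use assms seg_is_span seg_basic(9) in auto)

lemma denom_pos_in_span: "in_span \<mu> y \<Longrightarrow> 0 < denom g \<mu> y"
  using denom_pos in_span_bounds by (auto simp: in_span_def)

lemma denom_eq: "in_span \<mu> y \<Longrightarrow> (\<Sum>i=1..dim g. wt g i * bspline (knot g) (right_end g) (deg g) i y) = denom g \<mu> y"
  using bspline_sum[of \<mu> y "wt g"] by (simp add: numer_def)

lemma seg_fun_eq_rat:
  assumes "in_span \<mu> y"
  shows "seg_fun g C y = rat g \<mu> C y"
proof -
  have "seg_fun g C y = (\<Sum>j=1..dim g. (wt g j * C j) * bspline (knot g) (right_end g) (deg g) j y) / denom g \<mu> y"
    unfolding seg_fun_def nurbs_def denom_eq[OF assms] sum_divide_distrib by (simp add: algebra_simps)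
  then show ?thesis unfolding bspline_sum[OF assms] rat_def numer_def .
qed

lemma bspline_nonneg:
  assumes "in_span \<mu> y" "1 \<le> j" "j \<le> dim g"
  shows "0 \<le> bspline (knot g) (right_end g) (deg g) j y"
proof -
  have "bspline (knot g) (right_end g) (deg g) j y
     = (\<Sum>i=1..dim g. (if i = j then 1 else 0) * bspline (knot g) (right_end g) (deg g) i y)"
    using assms by (simp add: if_distrib[of "\<lambda>x. x * _"] cong: if_cong)
  also have "\<dots> = deboor (knot g) (deg g) y (\<lambda>i. if i = j then 1 else 0) \<mu>"
    by (rule bspline_sum[OF assms(1)])
  also have "0 \<le> \<dots>"
    by (rule level_nonneg[where \<mu> = \<mu>]) (use in_span_is_span[OF assms(1)] in_span_bounds[OF assms(1)] in auto)
  finally show ?thesis .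
qed

lemma nurbs_nonneg:
  assumes "left_end g \<le> y" "y \<le> right_end g" "1 \<le> j" "j \<le> dim g"
  shows "0 \<le> nurbs g j y"
proof -
  obtain \<mu> where m: "in_span \<mu> y" using in_span_exists assms by blast
  show ?thesis unfolding nurbs_def denom_eq[OF m]
    using bspline_nonneg[OF m assms(3,4)] denom_pos_in_span[OF m] seg_basic(9)[OF assms(3,4)] by simp
qed

lemma nurbs_sum:
  assumes "left_end g \<le> y" "y \<le> right_end g"
  shows "(\<Sum>j=1..dim g. nurbs g j y) = 1"
proof -
  obtain \<mu> where m: "in_span \<mu> y" using in_span_exists assms by blast
  have "(\<Sum>j=1..dim g. nurbs g j y) = seg_fun g (\<lambda>_. 1) y" by (simp add: seg_fun_def)
  also have "\<dots> = 1" using seg_fun_eq_rat[OF m] denom_pos_in_span[OF m] by (simp add: rat_def)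
  finally show ?thesis .
qed

lemma nurbs_support:
  assumes "nurbs g j y \<noteq> 0" "1 \<le> j" "j \<le> dim g"
  shows "knot g j \<le> y" "y \<le> knot g (j + deg g + 1)"
proof -
  have "bspline (knot g) (right_end g) (deg g) j y \<noteq> 0" using assms(1) by (auto simp: nurbs_def)
  then obtain i where i: "j \<le> i" "i \<le> j + deg g" "bspline (knot g) (right_end g) 0 i y \<noteq> 0"
    using bspline_eq_0 by blast
  have "knot g i \<le> y \<and> y \<le> knot g (i + 1)" using i(3) by (auto split: if_splits)
  moreover have "knot g j \<le> knot g i" "knot g (i + 1) \<le> knot g (j + deg g + 1)"
    by (rule seg_basic(4); use i assms in auto)+
  ultimately show "knot g j \<le> y" "y \<le> knot g (j + deg g + 1)" by auto
qed

text \<open>The multiplicity bounds exclude \<open>deg g + 2\<close> equal consecutive knots.\<close>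

lemma knot_increase:
  assumes "1 \<le> j" "j \<le> dim g"
  shows "knot g j < knot g (j + deg g + 1)"
proof (rule ccontr)
  assume "\<not> ?thesis"
  moreover have "knot g j \<le> knot g (j + deg g + 1)" by (rule seg_basic(4)) (use assms in auto)
  ultimately have eq: "knot g j = knot g (j + deg g + 1)" by simp
  have all: "knot g i = knot g j" if "j \<le> i" "i \<le> j + deg g + 1" for i
    using seg_basic(4)[of j i] seg_basic(4)[of i "j + deg g + 1"] that assms eq by fastforce
  have "knot g j \<le> knot g (dim g)" by (rule seg_basic(4)) (use assms in auto)
  then have r: "knot g j < right_end g" using seg_basic(8) by simp
  have l: "left_end g < knot g j"
    using seg_basic(7) seg_basic(4)[of "deg g + 2" "j + deg g + 1"] eq assms by simp
  have "deg g + 2 \<le> j" using seg_basic(5)[of j] l assms by (cases "j \<le> deg g + 1") auto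
  then have "card {i\<in>{1..dim g + deg g + 1}. knot g i = knot g j} \<le> deg g - 1"
    using multiplicity_bound assms by blast
  moreover have "card {j..j + deg g + 1} \<le> card {i\<in>{1..dim g + deg g + 1}. knot g i = knot g j}"
  proof (rule card_mono)
    show "{j..j + deg g + 1} \<subseteq> {i\<in>{1..dim g + deg g + 1}. knot g i = knot g j}"
    proof
      fix i assume "i \<in> {j..j + deg g + 1}"
      then show "i \<in> {i\<in>{1..dim g + deg g + 1}. knot g i = knot g j}"
        using all[of i] assms by auto
    qed
  qed simp
  ultimately show False by simp
qed

lemma span_in_support:
  assumes "1 \<le> j" "j \<le> dim g"
  obtains \<mu> where "deg g + 1 \<le> \<mu>" "\<mu> \<le> dim g" "knot g \<mu> < knot g (\<mu> + 1)" "\<mu> - deg g \<le> j" "j \<le> \<mu>"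
proof -
  have y: "left_end g \<le> knot g j" "knot g j < right_end g"
    using seg_basic(4)[of 1 j] seg_basic(4)[of j "dim g"] seg_basic(8) assms by (auto simp: left_end_def)
  from right_span[OF y] obtain \<mu> where \<mu>: "deg g + 1 \<le> \<mu>" "\<mu> \<le> dim g" "knot g \<mu> \<le> knot g j" "knot g j < knot g (\<mu> + 1)"
    "\<And>i. 1 \<le> i \<Longrightarrow> i \<le> dim g + deg g + 1 \<Longrightarrow> knot g i \<le> knot g j \<longleftrightarrow> i \<le> \<mu>" by blast
  have "j \<le> \<mu>" using \<mu>(5)[of j] assms by auto
  moreover have "\<mu> < j + deg g + 1" using \<mu>(5)[of "j + deg g + 1"] knot_increase[OF assms] assms by auto
  ultimately show ?thesis using \<mu>(1-4) by (intro that[of \<mu>]) linarith+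
qed

lemma seg_fun_eq_0_imp:
  assumes "\<And>y. left_end g < y \<Longrightarrow> y < right_end g \<Longrightarrow> seg_fun g C y = 0" "1 \<le> j" "j \<le> dim g"
  shows "C j = 0"
proof -
  obtain \<mu> where \<mu>: "deg g + 1 \<le> \<mu>" "\<mu> \<le> dim g" "knot g \<mu> < knot g (\<mu> + 1)" "\<mu> - deg g \<le> j" "j \<le> \<mu>"
    using span_in_support assms(2,3) by blast
  have "wt g j * C j = 0"
  proof (rule deboor_eq_0_imp_coeff_eq_0[OF seg_is_span[OF \<mu>(1-3)] _ \<mu>(4,5), of "\<lambda>j. wt g j * C j"])
    fix y assume y: "knot g \<mu> < y" "y < knot g (\<mu> + 1)"
    have s: "in_span \<mu> y" using \<mu> y by (auto simp: in_span_def)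
    have "left_end g \<le> knot g \<mu>" "knot g (\<mu> + 1) \<le> right_end g"
      using seg_basic(4)[of 1 \<mu>] seg_basic(4)[of "\<mu> + 1" "dim g + deg g + 1"] \<mu> seg_basic(1)
      by (auto simp: left_end_def right_end_def)
    then have "rat g \<mu> C y = 0" using assms(1)[of y] seg_fun_eq_rat[OF s, of C] y by simp
    then show "deboor (knot g) (deg g) y (\<lambda>j. wt g j * C j) \<mu> = 0"
      using denom_pos_in_span[OF s] by (simp add: rat_def numer_def)
  qed
  then show ?thesis using seg_basic(9)[OF assms(2,3)] by simp
qed

lemma numer_has_derivative:
  assumes "is_span (knot g) (deg g) \<mu>"
  shows "(numer g \<mu> C has_real_derivative numer' g \<mu> C y) (at y within A)"
  using deboor_has_derivative[OF assms] unfolding numer_def[abs_def] numer'_def .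

lemma numer'_isCont:
  assumes "is_span (knot g) (deg g) \<mu>"
  shows "isCont (numer' g \<mu> C) y"
  using deboor'_has_derivative[OF assms] unfolding numer'_def[abs_def] by (rule DERIV_isCont)

lemma rat_has_derivative:
  assumes "is_span (knot g) (deg g) \<mu>" "denom g \<mu> y \<noteq> 0"
  shows "(rat g \<mu> C has_real_derivative rat' g \<mu> C y) (at y within A)"
  unfolding rat_def[abs_def] rat'_def
  by (rule DERIV_divide) (use numer_has_derivative assms in auto)

lemma rat'_isCont:
  assumes "is_span (knot g) (deg g) \<mu>" "denom g \<mu> y \<noteq> 0"
  shows "isCont (rat' g \<mu> C) y"
proof -
  have c: "isCont (numer g \<mu> C) y" for C by (rule DERIV_isCont[OF numer_has_derivative[OF assms(1)]])
  show ?thesis unfolding rat'_def[abs_def]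
    by (intro continuous_intros c numer'_isCont assms) (use assms in auto)
qed

text \<open>The spans \<open>\<mu>\<close> and \<open>\<nu>\<close> to the left and to the right of \<open>y\<close> differ by the multiplicity of \<open>y\<close> as a
  knot, which is at most \<open>deg g - 1\<close>. So values and first derivatives match.\<close>

lemma spans_at_interior_point:
  assumes "left_end g < y" "y < right_end g"
  obtains \<mu> \<nu> where "deg g + 1 \<le> \<mu>" "\<mu> \<le> dim g" "knot g \<mu> < y" "y \<le> knot g (\<mu> + 1)"
    "deg g + 1 \<le> \<nu>" "\<nu> \<le> dim g" "knot g \<nu> \<le> y" "y < knot g (\<nu> + 1)"
    "\<And>C. rat g \<mu> C y = rat g \<nu> C y" "\<And>C. rat' g \<mu> C y = rat' g \<nu> C y"
proof -
  have yy: "left_end g \<le> y" "y \<le> right_end g" using assms by auto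
  obtain \<mu> where \<mu>: "deg g + 1 \<le> \<mu>" "\<mu> \<le> dim g" "knot g \<mu> < y" "y \<le> knot g (\<mu> + 1)"
    "\<And>i. 1 \<le> i \<Longrightarrow> i \<le> dim g + deg g + 1 \<Longrightarrow> knot g i < y \<longleftrightarrow> i \<le> \<mu>"
    using left_span[OF assms(1) yy(2)] by blast
  obtain \<nu> where \<nu>: "deg g + 1 \<le> \<nu>" "\<nu> \<le> dim g" "knot g \<nu> \<le> y" "y < knot g (\<nu> + 1)"
    "\<And>i. 1 \<le> i \<Longrightarrow> i \<le> dim g + deg g + 1 \<Longrightarrow> knot g i \<le> y \<longleftrightarrow> i \<le> \<nu>"
    using right_span[OF yy(1) assms(2)] by blast
  have le: "\<mu> \<le> \<nu>" using \<nu>(5)[of \<mu>] \<mu> by auto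
  define r where "r = \<nu> - \<mu>"
  have nu: "\<nu> = \<mu> + r" using le by (simp add: r_def)
  have eqy: "knot g i = y" if "\<mu> < i" "i \<le> \<mu> + r" for i
    using \<mu>(5)[of i] \<nu>(5)[of i] that \<nu>(2) nu by fastforce
  have r: "r \<le> deg g - 1"
  proof (cases "r = 0")
    case False
    have k1: "knot g (\<mu> + 1) = y" by (rule eqy) (use False in auto)
    have "\<mu> + 1 \<le> dim g" using \<nu>(2) nu False by simp
    then have "card {i\<in>{1..dim g + deg g + 1}. knot g i = knot g (\<mu> + 1)} \<le> deg g - 1"
      using multiplicity_bound[of "\<mu> + 1"] \<mu>(1) by simp
    moreover have "card {\<mu> + 1..\<mu> + r} \<le> card {i\<in>{1..dim g + deg g + 1}. knot g i = knot g (\<mu> + 1)}"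
    proof (rule card_mono)
      show "{\<mu> + 1..\<mu> + r} \<subseteq> {i\<in>{1..dim g + deg g + 1}. knot g i = knot g (\<mu> + 1)}"
      proof
        fix i assume "i \<in> {\<mu> + 1..\<mu> + r}"
        then show "i \<in> {i\<in>{1..dim g + deg g + 1}. knot g i = knot g (\<mu> + 1)}"
          using eqy[of i] k1 \<nu>(2) nu by auto
      qed
    qed simp
    ultimately show ?thesis by simp
  qed simp
  have sp: "is_span (knot g) r (\<mu> + r)"
    using seg_is_span[OF \<nu>(1,2)] \<nu>(3,4) r nu by (auto intro: is_span_mono)
  have n: "numer g \<mu> C y = numer g \<nu> C y" for C
    unfolding numer_def nu by (rule deboor_across_knot[OF sp \<mu>(3) eqy]) (use r in auto)
  have n': "numer' g \<mu> C y = numer' g \<nu> C y" for C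
    unfolding numer'_def nu using deboor_across_knot[OF sp \<mu>(3) eqy, of "deg g - 1"] r by auto
  show ?thesis
    by (rule that[OF \<mu>(1-4) \<nu>(1-4)]) (simp_all add: rat_def rat'_def n n')
qed

lemma last_span: "deg g + 1 \<le> dim g" "knot g (dim g) < knot g (dim g + 1)" "knot g (dim g + 1) = right_end g"
  using seg_basic by auto

lemma first_span: "knot g (deg g + 1) < knot g (deg g + 1 + 1)" "knot g (deg g + 1) = left_end g"
  using seg_basic by auto

lemma rat_right_end:
  shows "rat g (dim g) C (right_end g) = C (dim g)"
    and "rat' g (dim g) C (right_end g) =
      real (deg g) / (right_end g - knot g (dim g)) * (wt g (dim g - 1) / wt g (dim g)) * (C (dim g) - C (dim g - 1))"
proof -
  have n: "numer g (dim g) C (right_end g) = wt g (dim g) * C (dim g)" for C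
    unfolding numer_def by (rule deboor_at_right_knots) (use seg_basic in auto)
  have n': "numer' g (dim g) C (right_end g) =
     real (deg g) * ((wt g (dim g) * C (dim g) - wt g (dim g - 1) * C (dim g - 1)) / (right_end g - knot g (dim g)))" for C
  proof -
    have "deboor (knot g) (deg g - 1) (right_end g) (ddiff (knot g) (deg g) (\<lambda>j. wt g j * C j)) (dim g)
        = ddiff (knot g) (deg g) (\<lambda>j. wt g j * C j) (dim g)"
      by (rule deboor_at_right_knots) (use seg_basic in auto)
    moreover have "knot g (dim g + deg g) = right_end g" using seg_basic by auto
    ultimately show ?thesis unfolding numer'_def by (simp add: ddiff_def)
  qed
  have w: "0 < wt g (dim g)" using seg_basic by auto
  have k: "right_end g - knot g (dim g) \<noteq> 0" using seg_basic(8) by simp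
  show "rat g (dim g) C (right_end g) = C (dim g)" unfolding rat_def n using w by simp
  show "rat' g (dim g) C (right_end g) =
      real (deg g) / (right_end g - knot g (dim g)) * (wt g (dim g - 1) / wt g (dim g)) * (C (dim g) - C (dim g - 1))"
    unfolding rat'_def n n' using w k by (simp add: divide_simps) (simp add: algebra_simps)
qed

lemma deboor_left_end:
  assumes "q \<le> deg g"
  shows "deboor (knot g) q (left_end g) c (deg g + 1) = c (deg g + 1 - q)"
proof (rule deboor_at_left_knots)
  show "is_span (knot g) q (deg g + 1)"
    using seg_is_span[of "deg g + 1"] first_span last_span(1) assms by (auto intro: is_span_mono)
qed (use assms seg_basic in auto)

lemma numer_left_end:
  "numer g (deg g + 1) C (left_end g) = wt g 1 * C 1"
  "numer' g (deg g + 1) C (left_end g) =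
     real (deg g) * ((wt g 2 * C 2 - wt g 1 * C 1) / (knot g (deg g + 2) - left_end g))"
proof -
  show "numer g (deg g + 1) C (left_end g) = wt g 1 * C 1"
    unfolding numer_def deboor_left_end[OF order.refl] by simp
  have e: "deg g + 1 - (deg g - 1) = 2" "knot g 2 = left_end g" "2 + deg g = deg g + 2"
    using seg_basic(1) by (auto intro: seg_basic(5))
  show "numer' g (deg g + 1) C (left_end g) =
     real (deg g) * ((wt g 2 * C 2 - wt g 1 * C 1) / (knot g (deg g + 2) - left_end g))"
    unfolding numer'_def deboor_left_end[OF diff_le_self] e ddiff_def by simp
qed

lemma rat_left_end:
  shows "rat g (deg g + 1) C (left_end g) = C 1"
    and "rat' g (deg g + 1) C (left_end g) =
      real (deg g) / (knot g (deg g + 2) - left_end g) * (wt g 2 / wt g 1) * (C 2 - C 1)"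
proof -
  have w: "0 < wt g 1" using seg_basic by auto
  have k: "knot g (deg g + 2) - left_end g \<noteq> 0" using seg_basic(7) by simp
  show "rat g (deg g + 1) C (left_end g) = C 1" unfolding rat_def numer_left_end using w by simp
  show "rat' g (deg g + 1) C (left_end g) =
      real (deg g) / (knot g (deg g + 2) - left_end g) * (wt g 2 / wt g 1) * (C 2 - C 1)"
    unfolding rat'_def numer_left_end using w k by (simp add: divide_simps) (simp add: algebra_simps)
qed

text \<open>The difference between 1 and the first NURBS has the coefficients \<open>0, 1, \<dots>, 1\<close>, and right of the
  left end point a single step of the algorithm makes all of them positive.\<close>

lemma rat_first_less_1:
  assumes "knot g (deg g + 1) < y" "y \<le> knot g (deg g + 1 + 1)"
  shows "rat g (deg g + 1) (\<lambda>j. if j = 1 then 1 else 0) y < 1"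
proof -
  let ?\<mu> = "deg g + 1" let ?\<xi> = "knot g"
  have sp: "is_span ?\<xi> (deg g) ?\<mu>" using seg_is_span first_span(1) last_span(1) by simp
  obtain q where q: "deg g = Suc q" using seg_basic(1) by (cases "deg g") auto
  let ?d = "\<lambda>j. wt g j * (if j = 1 then 0 else 1)"
  have "0 < deboor ?\<xi> (deg g) y ?d ?\<mu>"
    unfolding q level.simps
  proof (rule level_pos[where \<mu> = "Suc q + 1"])
    show "is_span ?\<xi> (0 + q) (Suc q + 1)" using sp q by (auto intro: is_span_mono)
    fix j assume j: "Suc q + 1 - (0 + q) \<le> j" "j \<le> Suc q + 1"
    have k: "Suc q \<le> deg g" "j \<le> ?\<mu>" "?\<mu> < j + Suc q" using j q by auto
    note b = blend_convex[OF sp k less_imp_le[OF assms(1)] assms(2)]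
    have "0 < wt g j" "0 < wt g (j - 1)" by (rule seg_basic(9); use j last_span(1) q in linarith)+
    then have w: "0 < wt g j" "0 \<le> ?d (j - 1)" by auto
    show "0 < blend ?\<xi> (0 + Suc q) y ?d j"
      unfolding add_0 b(1)
    proof (rule add_nonneg_pos)
      let ?t = "(y - ?\<xi> j) / (?\<xi> (j + Suc q) - ?\<xi> j)"
      have "0 < wt g j * (if j = 1 then 0 else 1)" using w j by simp
      with b(4)[OF assms(1)] show "0 < ?t * (wt g j * (if j = 1 then 0 else 1))" by (rule mult_pos_pos)
      show "0 \<le> (1 - ?t) * ?d (j - 1)" using b(3) by (intro mult_nonneg_nonneg[OF _ w(2)]) simp
    qed
  qed (use assms q in auto)
  moreover have "denom g ?\<mu> y = deboor ?\<xi> (deg g) y (\<lambda>j. 1 * ?d j + 1 * (wt g j * (if j = 1 then 1 else 0))) ?\<mu>"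
    unfolding numer_def by (intro arg_cong[where f = "\<lambda>c. deboor ?\<xi> (deg g) y c ?\<mu>"]) auto
  then have "denom g ?\<mu> y = deboor ?\<xi> (deg g) y ?d ?\<mu> + numer g ?\<mu> (\<lambda>j. if j = 1 then 1 else 0) y"
    unfolding level_lincomb by (simp add: numer_def)
  ultimately have "numer g ?\<mu> (\<lambda>j. if j = 1 then 1 else 0) y < denom g ?\<mu> y" by simp
  moreover have "0 < denom g ?\<mu> y" by (rule denom_pos) (use assms first_span last_span in auto)
  ultimately show ?thesis by (simp add: rat_def)
qed

end

section \<open>Concatenated segments and their extraction matrices\<close>

lemma mu_0 [simp]: "mu S 0 = 0" by (simp add: mu_def)

lemma mu_Suc: "mu S (Suc i) = mu S i + dim (seg S (Suc i))" by (simp add: mu_def)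

lemma mu_pred: "1 \<le> i \<Longrightarrow> mu S i = mu S (i - 1) + dim (seg S i)"
  using mu_Suc[of S "i - 1"] by simp

lemma mu_mono: "i \<le> j \<Longrightarrow> mu S i \<le> mu S j"
  by (rule lift_Suc_mono_le[of "mu S"]) (simp_all add: mu_Suc)

lemma eta_0 [simp]: "eta S 0 = 0" by (simp add: eta_def)

lemma breakpoint_0 [simp]: "breakpoint S 0 = 0" by (simp add: breakpoint_def)

lemma breakpoint_pred:
  "1 \<le> i \<Longrightarrow> breakpoint S i = breakpoint S (i - 1) + (right_end (seg S i) - left_end (seg S i))"
  by (cases i) (simp_all add: breakpoint_def)

lemma sum_concat:
  "(\<Sum>c=1..mu S n. f c) = (\<Sum>l=1..n. \<Sum>j=1..dim (seg S l). f (mu S (l - 1) + j) :: real)"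
proof (induction n)
  case (Suc n)
  have "{1..mu S (Suc n)} = {1..mu S n} \<union> {mu S n + 1..mu S n + dim (seg S (Suc n))}"
    by (auto simp: mu_Suc)
  then have "(\<Sum>c=1..mu S (Suc n). f c) = (\<Sum>c=1..mu S n. f c) + (\<Sum>c=mu S n + 1..mu S n + dim (seg S (Suc n)). f c)"
    by (simp add: sum.union_disjoint)
  also have "(\<Sum>c=mu S n + 1..mu S n + dim (seg S (Suc n)). f c) = (\<Sum>j=1..dim (seg S (Suc n)). f (mu S n + j))"
    using sum.shift_bounds_cl_nat_ivl[of f 1 "mu S n" "dim (seg S (Suc n))"] by (simp add: add.commute)
  finally show ?case using Suc by simp
qed simp

text \<open>The value shared by the last NURBS of segment \<open>i\<close> and the first one of the next segment. The
  last junction is the periodic one and continues with the coefficient 1.\<close>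

definition junction :: "segments \<Rightarrow> (nat \<Rightarrow> real) \<Rightarrow> nat \<Rightarrow> real" where
  "junction S a i = (alpha S i * a (eta S i) + beta S i * a (if i = length S then 1 else eta S i + 1))
     / (alpha S i + beta S i)"

text \<open>The coefficients of \<open>\<Sum> a\<^sub>i B\<^sub>i\<close> with respect to the NURBS of segment \<open>l\<close>: an inner NURBS carries
  a coefficient \<open>a\<^sub>i\<close> unchanged, and the two outer ones carry the values at the junctions.\<close>

definition coeff_per :: "segments \<Rightarrow> (nat \<Rightarrow> real) \<Rightarrow> nat \<Rightarrow> nat \<Rightarrow> real" where
  "coeff_per S a l j =
     (if j = 1 then junction S a (if l = 1 then length S else l - 1)
      else if j = dim (seg S l) then junction S a l
      else a (eta S (l - 1) + (j - 1)))"

text \<open>The first row and column of the non-periodic matrix shift all indices by 1, which accounts for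
  the argument \<open>r + 1\<close>.\<close>

definition coeff_nonper :: "segments \<Rightarrow> (nat \<Rightarrow> real) \<Rightarrow> nat \<Rightarrow> nat \<Rightarrow> real" where
  "coeff_nonper S a l j =
     (if j = 1 then (if l = 1 then a 1 else junction S (\<lambda>r. a (r + 1)) (l - 1))
      else if j = dim (seg S l) then
        (if l = length S then a (dim_nonper S) else junction S (\<lambda>r. a (r + 1)) l)
      else a (eta S (l - 1) + j))"

definition spl_per :: "segments \<Rightarrow> (nat \<Rightarrow> real) \<Rightarrow> real \<Rightarrow> real" where
  "spl_per S a x = (\<Sum>i=1..dim_per S. a i * basis_per S i x)"

definition spl_nonper :: "segments \<Rightarrow> (nat \<Rightarrow> real) \<Rightarrow> real \<Rightarrow> real" where
  "spl_nonper S a x = (\<Sum>i=1..dim_nonper S. a i * basis_nonper S i x)"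

lemma unit_entry_sum:
  assumes "1 \<le> r0" "r0 \<le> n"
  shows "(\<Sum>r=1..n. a r * unit_entry r0 c0 v r c) = (if c = c0 then v * a r0 else 0)"
proof -
  have "(\<Sum>r=1..n. a r * unit_entry r0 c0 v r c) = (\<Sum>r=1..n. if r = r0 then (if c = c0 then v * a r0 else 0) else 0)"
    by (rule sum.cong) (auto simp: unit_entry_def)
  then show ?thesis using assms by simp
qed

context
  fixes S :: segments
  assumes S: "valid_segments S"
begin

lemma length_pos: "1 \<le> length S"
  using S by (cases S) (auto simp: valid_segments_def)

lemma seg_valid: "1 \<le> l \<Longrightarrow> l \<le> length S \<Longrightarrow> valid_segment (seg S l)"
  using S by (auto simp: valid_segments_def)

lemma dim_ge_3: "1 \<le> l \<Longrightarrow> l \<le> length S \<Longrightarrow> 3 \<le> dim (seg S l)"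
  using seg_basic(3) seg_valid by blast

lemma mu_lower: "i \<le> length S \<Longrightarrow> 3 * i \<le> mu S i"
proof (induction i)
  case (Suc i)
  then show ?case using dim_ge_3[of "Suc i"] by (simp add: mu_Suc)
qed simp

lemma eta_pred:
  assumes "1 \<le> l" "l \<le> length S"
  shows "eta S l = eta S (l - 1) + (dim (seg S l) - 2)"
proof -
  obtain k where k: "l = Suc k" using assms(1) by (cases l) auto
  show ?thesis using mu_lower[of k] dim_ge_3[OF assms] assms by (simp add: k eta_def mu_Suc)
qed

lemma eta_lower: "i \<le> length S \<Longrightarrow> i \<le> eta S i"
  using mu_lower[of i] by (simp add: eta_def)

lemma eta_mono: "i \<le> j \<Longrightarrow> j \<le> length S \<Longrightarrow> eta S i + (j - i) \<le> eta S j"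
proof (induction j rule: dec_induct)
  case (step j)
  then show ?case using eta_pred[of "Suc j"] dim_ge_3[of "Suc j"] by simp
qed simp

lemma seg_of_concat:
  assumes "1 \<le> l" "l \<le> length S" "1 \<le> j" "j \<le> dim (seg S l)"
  shows "seg_of S (mu S (l - 1) + j) = l"
  unfolding seg_of_def
proof (rule Least_equality)
  show "mu S (l - 1) + j \<le> mu S l" using mu_pred[OF assms(1)] assms by simp
  fix i assume i: "mu S (l - 1) + j \<le> mu S i"
  show "l \<le> i"
  proof (rule ccontr)
    assume "\<not> l \<le> i"
    then have "mu S i \<le> mu S (l - 1)" by (intro mu_mono) simp
    then show False using i assms by simp
  qed
qed

lemma loc_of_concat:
  assumes "1 \<le> l" "l \<le> length S" "1 \<le> j" "j \<le> dim (seg S l)"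
  shows "loc_of S (mu S (l - 1) + j) = j"
  unfolding loc_of_def seg_of_concat[OF assms] by simp

lemma concat_inj:
  assumes "1 \<le> l" "l \<le> length S" "1 \<le> j" "j \<le> dim (seg S l)"
    "1 \<le> l'" "l' \<le> length S" "1 \<le> j'" "j' \<le> dim (seg S l')"
  shows "mu S (l - 1) + j = mu S (l' - 1) + j' \<longleftrightarrow> l = l' \<and> j = j'"
  using seg_of_concat[OF assms(1-4)] seg_of_concat[OF assms(5-8)]
    loc_of_concat[OF assms(1-4)] loc_of_concat[OF assms(5-8)] by metis

lemma concat_exists:
  assumes "1 \<le> r" "r \<le> mu S n" "n \<le> length S"
  obtains l j where "1 \<le> l" "l \<le> n" "1 \<le> j" "j \<le> dim (seg S l)" "r = mu S (l - 1) + j"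
  using assms(2,3)
proof (induction n arbitrary: thesis)
  case 0
  then show ?case using assms(1) by simp
next
  case (Suc n)
  show ?case
  proof (cases "r \<le> mu S n")
    case True
    with Suc(1)[OF _ True] Suc.prems show ?thesis by (metis Suc_leD le_Suc_eq)
  next
    case False
    then show ?thesis using Suc.prems
      by (intro Suc.prems(1)[of "Suc n" "r - mu S n"]) (auto simp: mu_Suc)
  qed
qed

lemma eta_concat_exists:
  assumes "1 \<le> r" "r \<le> eta S n" "n \<le> length S"
  obtains l j where "1 \<le> l" "l \<le> n" "1 \<le> j" "j \<le> dim (seg S l) - 2" "r = eta S (l - 1) + j"
  using assms(2,3)
proof (induction n arbitrary: thesis)
  case 0
  then show ?case using assms(1) by simp
next
  case (Suc n)
  show ?case
  proof (cases "r \<le> eta S n")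
    case True
    with Suc(1)[OF _ True] Suc.prems show ?thesis by (metis Suc_leD le_Suc_eq)
  next
    case False
    then show ?thesis using Suc.prems(2,3) eta_pred[of "Suc n"]
      by (intro Suc.prems(1)[of "Suc n" "r - eta S n"]) auto
  qed
qed

lemma alpha_pos: "1 \<le> i \<Longrightarrow> i \<le> length S \<Longrightarrow> 0 < alpha S i"
proof -
  assume i: "1 \<le> i" "i \<le> length S"
  have "0 < wt (seg S i) (dim (seg S i))" "0 < wt (seg S i) (dim (seg S i) - 1)"
    by (rule seg_basic(9)[OF seg_valid[OF i]]; use dim_ge_3[OF i] in linarith)+
  then show ?thesis using seg_basic(1,8)[OF seg_valid[OF i]] unfolding alpha_def Let_def by auto
qed

lemma beta_pos: "1 \<le> i \<Longrightarrow> i \<le> length S \<Longrightarrow> 0 < beta S i"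
proof -
  assume i: "1 \<le> i" "i \<le> length S"
  define l where "l = (if i = length S then 1 else i + 1)"
  have l: "1 \<le> l" "l \<le> length S" using i by (auto simp: l_def)
  have "0 < wt (seg S l) 1" "0 < wt (seg S l) 2"
    by (rule seg_basic(9)[OF seg_valid[OF l]]; use dim_ge_3[OF l] in linarith)+
  then show ?thesis using seg_basic(1,7)[OF seg_valid[OF l]] unfolding beta_def Let_def l_def[symmetric] by auto
qed

text \<open>A position in the concatenated vector determines segment and local index, so that at most one
  summand of each of the two sums that define \<open>Hc\<close> contributes to a given column.\<close>

lemma Hc_sum:
  assumes l: "1 \<le> l" "l \<le> length S" "1 \<le> j" "j \<le> dim (seg S l)"
  shows "(\<Sum>r=1..dim_per S. a r * Hc S r (mu S (l - 1) + j)) =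
     (if j \<le> dim (seg S l) - 2 then a (eta S (l - 1) + j) else if l < length S then junction S a l else 0)"
proof -
  let ?n = "dim_per S" and ?m = "length S" and ?c = "mu S (l - 1) + j"
  let ?J = "\<lambda>i r. a r * unit_entry (eta S i) (mu S i - 1) (alpha S i / (alpha S i + beta S i)) r ?c +
         a r * unit_entry (eta S i) (mu S i) (alpha S i / (alpha S i + beta S i)) r ?c +
         a r * unit_entry (eta S i + 1) (mu S i - 1) (beta S i / (alpha S i + beta S i)) r ?c +
         a r * unit_entry (eta S i + 1) (mu S i) (beta S i / (alpha S i + beta S i)) r ?c"
  have rr: "1 \<le> eta S (i - 1) + j'" "eta S (i - 1) + j' \<le> ?n"
    if "i \<in> {1..?m}" "j' \<in> {1..dim (seg S i) - 2}" for i j'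
    using that eta_pred[of i] eta_mono[of i ?m] by (auto simp: dim_per_def)
  have e: "1 \<le> eta S i" "eta S i + 1 \<le> ?n" if "i \<in> {1..?m - 1}" for i
  proof -
    have i: "1 \<le> i" "i < ?m" using that by auto
    then show "1 \<le> eta S i" "eta S i + 1 \<le> ?n"
      using eta_lower[of i] eta_mono[of i ?m] unfolding dim_per_def by linarith+
  qed
  have cs: "?c = mu S (i - 1) + j' \<longleftrightarrow> l = i \<and> j = j'" if "i \<in> {1..?m}" "j' \<in> {1..dim (seg S i)}" for i j'
    by (rule concat_inj) (use l that in auto)
  have cm: "(?c = mu S i - 1) = (l = i \<and> j = dim (seg S i) - 1)" "(?c = mu S i) = (l = i \<and> j = dim (seg S i))"
    if "i \<in> {1..?m - 1}" for i
  proof -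
    have i: "1 \<le> i" "i \<le> ?m" using that by auto
    have d: "3 \<le> dim (seg S i)" by (rule dim_ge_3[OF i])
    have m: "mu S i - 1 = mu S (i - 1) + (dim (seg S i) - 1)" "mu S i = mu S (i - 1) + dim (seg S i)"
      using mu_pred[OF i(1), of S] d by auto
    show "(?c = mu S i - 1) = (l = i \<and> j = dim (seg S i) - 1)"
      unfolding m(1) by (rule cs) (use i d in auto)
    show "(?c = mu S i) = (l = i \<and> j = dim (seg S i))"
      unfolding m(2) by (rule cs) (use i d in auto)
  qed
  have "(\<Sum>r=1..?n. a r * Hc S r ?c) =
      (\<Sum>i=1..?m. \<Sum>j'=1..dim (seg S i) - 2. \<Sum>r=1..?n. a r * unit_entry (eta S (i - 1) + j') (mu S (i - 1) + j') 1 r ?c)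
    + (\<Sum>i=1..?m - 1. \<Sum>r=1..?n. ?J i r)"
    unfolding Hc_def Let_def distrib_left sum.distrib sum_distrib_left
    by (subst (2 3 4 5 6) sum.swap, subst sum.swap) simp
  also have "(\<Sum>i=1..?m. \<Sum>j'=1..dim (seg S i) - 2. \<Sum>r=1..?n. a r * unit_entry (eta S (i - 1) + j') (mu S (i - 1) + j') 1 r ?c)
     = (\<Sum>i=1..?m. \<Sum>j'=1..dim (seg S i) - 2. if i = l then (if j' = j then a (eta S (l - 1) + j) else 0) else 0)"
  proof (intro sum.cong refl)
    fix i j' assume ij: "i \<in> {1..?m}" "j' \<in> {1..dim (seg S i) - 2}"
    show "(\<Sum>r=1..?n. a r * unit_entry (eta S (i - 1) + j') (mu S (i - 1) + j') 1 r ?c) =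
      (if i = l then (if j' = j then a (eta S (l - 1) + j) else 0) else 0)"
    proof -
      have "j' \<in> {1..dim (seg S i)}" using ij(2) by auto
      from cs[OF ij(1) this] show ?thesis unfolding unit_entry_sum[OF rr[OF ij]] by auto
    qed
  qed
  also have "\<dots> = (\<Sum>i=1..?m. if i = l then (\<Sum>j'=1..dim (seg S i) - 2. (if j' = j then a (eta S (l - 1) + j) else 0)) else 0)"
    by (intro sum.cong refl) auto
  also have "\<dots> = (if j \<le> dim (seg S l) - 2 then a (eta S (l - 1) + j) else 0)"
    using l by (auto simp: sum.delta)
  also have "(\<Sum>i=1..?m - 1. \<Sum>r=1..?n. ?J i r)
    = (\<Sum>i=1..?m - 1. if i = l then (if j \<le> dim (seg S l) - 2 then 0 else junction S a l) else 0)"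
  proof (intro sum.cong refl)
    fix i assume i: "i \<in> {1..?m - 1}"
    have ne: "i \<noteq> ?m" using i by auto
    have un: "1 \<le> eta S i" "eta S i \<le> ?n" "1 \<le> eta S i + 1" "eta S i + 1 \<le> ?n" using e[OF i] by auto
    have d: "dim (seg S i) \<ge> 3" using dim_ge_3[of i] i by auto
    show "(\<Sum>r=1..?n. ?J i r) =
      (if i = l then (if j \<le> dim (seg S l) - 2 then 0 else junction S a l) else 0)"
      unfolding sum.distrib unit_entry_sum[OF un(1,2)] unit_entry_sum[OF un(3,4)] cm[OF i]
      using ne d l by (auto simp: junction_def add_divide_distrib)
  qed
  also have "\<dots> = (if l < ?m \<and> \<not> j \<le> dim (seg S l) - 2 then junction S a l else 0)"
    using l by (auto simp: sum.delta)
  finally show ?thesis by auto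
qed

lemma hcol_sum: "(\<Sum>r=1..dim_per S. a r * hcol S r) = junction S a (length S)"
proof -
  have n: "1 \<le> dim_per S" using eta_lower[of "length S"] length_pos by (simp add: dim_per_def)
  have "(\<Sum>r=1..dim_per S. a r * hcol S r) =
     (\<Sum>r=1..dim_per S. (if r = 1 then a 1 * (beta S (length S) / (alpha S (length S) + beta S (length S))) else 0)
       + (if r = dim_per S then a (dim_per S) * (alpha S (length S) / (alpha S (length S) + beta S (length S))) else 0))"
    by (intro sum.cong refl) (auto simp: hcol_def Let_def dim_per_def algebra_simps)
  also have "\<dots> = junction S a (length S)"
    using n by (simp add: sum.distrib junction_def dim_per_def add_divide_distrib mult.commute)
  finally show ?thesis .
qed

lemma mu_total: "mu S (length S) \<ge> 3"
  using mu_lower[of "length S"] length_pos by simp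

lemma concat_ends:
  assumes l: "1 \<le> l" "l \<le> length S" "1 \<le> j" "j \<le> dim (seg S l)"
  shows "mu S (l - 1) + j = 1 \<longleftrightarrow> l = 1 \<and> j = 1"
    "mu S (l - 1) + j = mu S (length S) \<longleftrightarrow> l = length S \<and> j = dim (seg S l)"
  using concat_inj[OF l, of 1 1] concat_inj[OF l, of "length S" "dim (seg S (length S))"]
    dim_ge_3[of 1] dim_ge_3[of "length S"] length_pos mu_pred[OF length_pos] by auto

lemma Hc_sum_shifted:
  assumes l: "1 \<le> l" "l \<le> length S" "1 \<le> j" "j \<le> dim (seg S l)"
    and ends: "\<not> (l = 1 \<and> j = 1)" "\<not> (l = length S \<and> j = dim (seg S l))"
  shows "(\<Sum>r=1..dim_per S. a r * Hc S r (mu S (l - 1) + j - 1)) =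
     (if j = 1 then junction S a (l - 1) else if j = dim (seg S l) then junction S a l
      else a (eta S (l - 1) + (j - 1)))"
proof (cases "j = 1")
  case True
  then have l2: "2 \<le> l" using ends l by auto
  then have "mu S (l - 1) = mu S (l - 1 - 1) + dim (seg S (l - 1))" using mu_pred[of "l - 1"] by simp
  moreover have k: "1 \<le> l - 1" "l - 1 \<le> length S" "l - 1 < length S" using l l2 by auto
  moreover have "\<not> dim (seg S (l - 1)) \<le> dim (seg S (l - 1)) - 2" "1 \<le> dim (seg S (l - 1))"
    using dim_ge_3[OF k(1,2)] by linarith+
  ultimately show ?thesis
    using Hc_sum[OF k(1,2), of "dim (seg S (l - 1))" a] k True by simp
next
  case False
  then have "mu S (l - 1) + j - 1 = mu S (l - 1) + (j - 1)" using l by simp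
  moreover have "1 \<le> j - 1" "j - 1 \<le> dim (seg S l)" using False l by auto
  ultimately show ?thesis using Hc_sum[OF l(1,2), of "j - 1" a] dim_ge_3[OF l(1,2)] l False ends by auto
qed

lemma H_per_sum:
  assumes l: "1 \<le> l" "l \<le> length S" "1 \<le> j" "j \<le> dim (seg S l)"
  shows "(\<Sum>r=1..dim_per S. a r * H_per S r (mu S (l - 1) + j)) = coeff_per S a l j"
proof (cases "l = 1 \<and> j = 1 \<or> l = length S \<and> j = dim (seg S l)")
  case True
  then show ?thesis unfolding H_per_def concat_ends[OF l] using hcol_sum[of a] dim_ge_3[OF l(1,2)]
    by (auto simp: coeff_per_def)
next
  case False
  then have F: "\<not> (l = 1 \<and> j = 1)" "\<not> (l = length S \<and> j = dim (seg S l))" by auto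
  have "H_per S r (mu S (l - 1) + j) = Hc S r (mu S (l - 1) + j - 1)" for r
    unfolding H_per_def concat_ends[OF l] using F by auto
  then show ?thesis using Hc_sum_shifted[OF l F, of a] F by (auto simp: coeff_per_def)
qed

lemma H_nonper_sum:
  assumes l: "1 \<le> l" "l \<le> length S" "1 \<le> j" "j \<le> dim (seg S l)"
  shows "(\<Sum>r=1..dim_nonper S. a r * H_nonper S r (mu S (l - 1) + j)) = coeff_nonper S a l j"
proof -
  let ?c = "mu S (l - 1) + j" and ?N = "dim_nonper S"
  have N: "?N = dim_per S + 2" by (simp add: dim_nonper_def dim_per_def)
  consider "l = 1 \<and> j = 1" | "l = length S \<and> j = dim (seg S l)"
    | "\<not> (l = 1 \<and> j = 1)" "\<not> (l = length S \<and> j = dim (seg S l))" by blast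
  then show ?thesis
  proof cases
    case 1
    then have "?c = 1" by simp
    then have "(\<Sum>r=1..?N. a r * H_nonper S r ?c) = (\<Sum>r=1..?N. if r = 1 then a 1 else 0)"
      by (intro sum.cong refl) (auto simp: H_nonper_def)
    then show ?thesis using 1 N by (simp add: coeff_nonper_def)
  next
    case 2
    have c: "?c = mu S (length S)" using concat_ends(2)[OF l] 2 by simp
    have "(\<Sum>r=1..?N. a r * H_nonper S r ?c) = (\<Sum>r=1..?N. if r = ?N then a ?N else 0)"
      unfolding c using mu_total N by (intro sum.cong refl) (auto simp: H_nonper_def)
    then show ?thesis using 2 N dim_ge_3[OF l(1,2)] by (simp add: coeff_nonper_def)
  next
    case 3
    have c: "?c \<noteq> 1" "?c \<noteq> mu S (length S)" using concat_ends[OF l] 3 by auto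
    have "(\<Sum>r=1..?N. a r * H_nonper S r ?c) = (\<Sum>r=Suc 1..Suc (dim_per S). a r * H_nonper S r ?c)"
    proof (rule sum.mono_neutral_right)
      show "\<forall>i\<in>{1..?N} - {Suc 1..Suc (dim_per S)}. a i * H_nonper S i ?c = 0"
      proof
        fix i assume "i \<in> {1..?N} - {Suc 1..Suc (dim_per S)}"
        then have "i = 1 \<or> i = ?N" using N by auto
        then show "a i * H_nonper S i ?c = 0" using c by (auto simp: H_nonper_def)
      qed
    qed (auto simp: N)
    also have "\<dots> = (\<Sum>r=1..dim_per S. a (r + 1) * H_nonper S (r + 1) ?c)"
      by (subst sum.shift_bounds_cl_Suc_ivl) simp
    also have "\<dots> = (\<Sum>r=1..dim_per S. a (r + 1) * Hc S r (?c - 1))"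
      using c N by (intro sum.cong refl) (auto simp: H_nonper_def)
    also have "\<dots> = coeff_nonper S a l j"
      unfolding Hc_sum_shifted[OF l 3, of "\<lambda>r. a (r + 1)"] using 3 l by (auto simp: coeff_nonper_def)
    finally show ?thesis .
  qed
qed

lemma breakpoint_less: "1 \<le> l \<Longrightarrow> l \<le> length S \<Longrightarrow> breakpoint S (l - 1) < breakpoint S l"
  using breakpoint_pred[of l S] left_less_right[OF seg_valid, of l] by simp

lemma breakpoint_mono: "i \<le> j \<Longrightarrow> j \<le> length S \<Longrightarrow> breakpoint S i \<le> breakpoint S j"
proof (induction j rule: dec_induct)
  case (step j)
  then show ?case using breakpoint_less[of "Suc j"] by simp
qed simp

lemma piece_bounds:
  assumes "x \<in> piece S l"
  shows "breakpoint S (l - 1) \<le> x" "x \<le> breakpoint S l" "l \<noteq> length S \<Longrightarrow> x < breakpoint S l"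
  using assms by (auto simp: piece_def split: if_splits)

lemma piece_exists:
  assumes "x \<in> interval S"
  obtains l where "1 \<le> l" "l \<le> length S" "x \<in> piece S l"
proof -
  have x: "0 \<le> x" "x \<le> breakpoint S (length S)" using assms by (auto simp: interval_def)
  show ?thesis
  proof (cases "x = breakpoint S (length S)")
    case True
    then show ?thesis using that[of "length S"] length_pos breakpoint_less[of "length S"] by (auto simp: piece_def)
  next
    case False
    define l where "l = (LEAST i. x < breakpoint S i)"
    have ex: "x < breakpoint S (length S)" using x False by simp
    have l1: "x < breakpoint S l" unfolding l_def by (rule LeastI[of _ "length S"]) (rule ex)
    have l2: "l \<le> length S" unfolding l_def by (rule Least_le) (rule ex)
    have l3: "1 \<le> l" using l1 x(1) by (cases l) auto
    have "\<not> x < breakpoint S (l - 1)" using not_less_Least[of "l - 1" "\<lambda>i. x < breakpoint S i"] l3 unfolding l_def by auto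
    then have "x \<in> piece S l" using l1 by (auto simp: piece_def)
    then show ?thesis using that l2 l3 by blast
  qed
qed

lemma piece_unique:
  assumes "x \<in> piece S l" "x \<in> piece S l'" "1 \<le> l" "l \<le> length S" "1 \<le> l'" "l' \<le> length S"
  shows "l = l'"
proof -
  have *: False if "x \<in> piece S i" "x \<in> piece S k" "1 \<le> i" "i < k" "k \<le> length S" for i k
  proof -
    have "i \<le> k - 1" "k - 1 \<le> length S" "i \<noteq> length S" using that by auto
    then show False
      using piece_bounds(3)[OF that(1)] piece_bounds(1)[OF that(2)] breakpoint_mono[of i "k - 1"] by linarith
  qed
  show ?thesis using *[of l l'] *[of l' l] assms by (metis linorder_neqE_nat)
qed

lemma to_local_bounds:
  assumes "1 \<le> l" "x \<in> piece S l"
  shows "left_end (seg S l) \<le> to_local S l x" "to_local S l x \<le> right_end (seg S l)"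
  using piece_bounds(1,2)[OF assms(2)] breakpoint_pred[OF assms(1), of S] unfolding to_local_def by linarith+

lemma bvec_sum:
  assumes l: "1 \<le> l" "l \<le> length S" and x: "x \<in> piece S l"
  shows "(\<Sum>c=1..mu S (length S). C c * bvec S c x) = seg_fun (seg S l) (\<lambda>j. C (mu S (l - 1) + j)) (to_local S l x)"
proof -
  have "(\<Sum>c=1..mu S (length S). C c * bvec S c x) =
     (\<Sum>i=1..length S. if i = l then seg_fun (seg S l) (\<lambda>j. C (mu S (l - 1) + j)) (to_local S l x) else 0)"
    unfolding sum_concat
  proof (intro sum.cong refl)
    fix i assume i: "i \<in> {1..length S}"
    have b: "bvec S (mu S (i - 1) + j) x = (if i = l then nurbs (seg S l) j (to_local S l x) else 0)"
      if "j \<in> {1..dim (seg S i)}" for j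
    proof -
      have ij: "1 \<le> i" "i \<le> length S" "1 \<le> j" "j \<le> dim (seg S i)" using i that by auto
      have "x \<in> piece S i \<longleftrightarrow> i = l" using piece_unique[OF x _ l ij(1,2)] x by metis
      then show ?thesis unfolding bvec_def seg_of_concat[OF ij] loc_of_concat[OF ij] by simp
    qed
    show "(\<Sum>j=1..dim (seg S i). C (mu S (i - 1) + j) * bvec S (mu S (i - 1) + j) x) =
       (if i = l then seg_fun (seg S l) (\<lambda>j. C (mu S (l - 1) + j)) (to_local S l x) else 0)"
      using b by (auto simp: seg_fun_def)
  qed
  then show ?thesis using l by simp
qed

lemma seg_fun_cong: "(\<And>j. 1 \<le> j \<Longrightarrow> j \<le> dim g \<Longrightarrow> C j = C' j) \<Longrightarrow> seg_fun g C y = seg_fun g C' y"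
  by (simp add: seg_fun_def)

lemma spl_per_eq:
  assumes l: "1 \<le> l" "l \<le> length S" and x: "x \<in> piece S l"
  shows "spl_per S a x = seg_fun (seg S l) (coeff_per S a l) (to_local S l x)"
proof -
  have "spl_per S a x = (\<Sum>c=1..mu S (length S). (\<Sum>r=1..dim_per S. a r * H_per S r c) * bvec S c x)"
    unfolding spl_per_def basis_per_def sum_distrib_left sum_distrib_right
    by (subst sum.swap) (simp add: mult.assoc)
  also have "\<dots> = seg_fun (seg S l) (coeff_per S a l) (to_local S l x)"
    unfolding bvec_sum[OF assms] by (rule seg_fun_cong) (use H_per_sum l in auto)
  finally show ?thesis .
qed

lemma spl_nonper_eq:
  assumes l: "1 \<le> l" "l \<le> length S" and x: "x \<in> piece S l"
  shows "spl_nonper S a x = seg_fun (seg S l) (coeff_nonper S a l) (to_local S l x)"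
proof -
  have "spl_nonper S a x = (\<Sum>c=1..mu S (length S). (\<Sum>r=1..dim_nonper S. a r * H_nonper S r c) * bvec S c x)"
    unfolding spl_nonper_def basis_nonper_def sum_distrib_left sum_distrib_right
    by (subst sum.swap) (simp add: mult.assoc)
  also have "\<dots> = seg_fun (seg S l) (coeff_nonper S a l) (to_local S l x)"
    unfolding bvec_sum[OF assms] by (rule seg_fun_cong) (use H_nonper_sum l in auto)
  finally show ?thesis .
qed

lemma basis_per_eq_spl: "i \<in> {1..dim_per S} \<Longrightarrow> basis_per S i x = spl_per S (\<lambda>r. if r = i then 1 else 0) x"
  by (simp add: spl_per_def if_distrib[of "\<lambda>x. x * _"] cong: if_cong)

lemma basis_nonper_eq_spl: "i \<in> {1..dim_nonper S} \<Longrightarrow> basis_nonper S i x = spl_nonper S (\<lambda>r. if r = i then 1 else 0) x"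
  by (simp add: spl_nonper_def if_distrib[of "\<lambda>x. x * _"] cong: if_cong)

lemma junction_nonneg:
  assumes "1 \<le> i" "i \<le> length S" "\<And>r. 0 \<le> a r"
  shows "0 \<le> junction S a i"
  using assms(3) alpha_pos[OF assms(1,2)] beta_pos[OF assms(1,2)] by (simp add: junction_def)

lemma junction_const:
  assumes "1 \<le> i" "i \<le> length S"
  shows "junction S (\<lambda>_. c) i = c"
  using alpha_pos[OF assms] beta_pos[OF assms] by (simp add: junction_def field_simps)

lemma coeff_per_nonneg:
  assumes "1 \<le> l" "l \<le> length S" "\<And>r. 0 \<le> a r"
  shows "0 \<le> coeff_per S a l j"
  using assms length_pos by (auto simp: coeff_per_def intro!: junction_nonneg)

lemma coeff_nonper_nonneg:
  assumes "1 \<le> l" "l \<le> length S" "\<And>r. 0 \<le> a r"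
  shows "0 \<le> coeff_nonper S a l j"
  using assms length_pos by (auto simp: coeff_nonper_def intro!: junction_nonneg)

lemma coeff_per_const: "1 \<le> l \<Longrightarrow> l \<le> length S \<Longrightarrow> coeff_per S (\<lambda>_. c) l j = c"
  using length_pos by (auto simp: coeff_per_def intro!: junction_const)

lemma coeff_nonper_const: "1 \<le> l \<Longrightarrow> l \<le> length S \<Longrightarrow> coeff_nonper S (\<lambda>_. c) l j = c"
  using length_pos by (auto simp: coeff_nonper_def intro!: junction_const)

lemma seg_fun_nonneg:
  assumes "1 \<le> l" "l \<le> length S" "x \<in> piece S l" "\<And>j. 0 \<le> C j"
  shows "0 \<le> seg_fun (seg S l) C (to_local S l x)"
  unfolding seg_fun_def
  using nurbs_nonneg[OF seg_valid[OF assms(1,2)] to_local_bounds[OF assms(1,3)]] assms(4)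
  by (intro sum_nonneg mult_nonneg_nonneg) auto

lemma seg_fun_const:
  assumes "1 \<le> l" "l \<le> length S" "x \<in> piece S l"
  shows "seg_fun (seg S l) (\<lambda>_. c) (to_local S l x) = c"
  unfolding seg_fun_def sum_distrib_left[symmetric]
  using nurbs_sum[OF seg_valid[OF assms(1,2)] to_local_bounds[OF assms(1,3)]] by simp

lemma basis_per_nonneg:
  assumes "x \<in> interval S" "i \<in> {1..dim_per S}"
  shows "0 \<le> basis_per S i x"
proof -
  obtain l where l: "1 \<le> l" "l \<le> length S" "x \<in> piece S l" using piece_exists assms(1) by blast
  show ?thesis unfolding basis_per_eq_spl[OF assms(2)] spl_per_eq[OF l]
    by (rule seg_fun_nonneg[OF l]) (auto intro!: coeff_per_nonneg l)
qed

lemma basis_nonper_nonneg: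
  assumes "x \<in> interval S" "i \<in> {1..dim_nonper S}"
  shows "0 \<le> basis_nonper S i x"
proof -
  obtain l where l: "1 \<le> l" "l \<le> length S" "x \<in> piece S l" using piece_exists assms(1) by blast
  show ?thesis unfolding basis_nonper_eq_spl[OF assms(2)] spl_nonper_eq[OF l]
    by (rule seg_fun_nonneg[OF l]) (auto intro!: coeff_nonper_nonneg l)
qed

lemma spl_per_const:
  assumes "x \<in> interval S" shows "spl_per S (\<lambda>_. c) x = c"
proof -
  obtain l where l: "1 \<le> l" "l \<le> length S" "x \<in> piece S l" using piece_exists assms(1) by blast
  have "coeff_per S (\<lambda>_. c) l = (\<lambda>_. c)" using coeff_per_const l by auto
  then show ?thesis using spl_per_eq[OF l, of "\<lambda>_. c"] seg_fun_const[OF l] by simp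
qed

lemma spl_nonper_const:
  assumes "x \<in> interval S" shows "spl_nonper S (\<lambda>_. c) x = c"
proof -
  obtain l where l: "1 \<le> l" "l \<le> length S" "x \<in> piece S l" using piece_exists assms(1) by blast
  have "coeff_nonper S (\<lambda>_. c) l = (\<lambda>_. c)" using coeff_nonper_const l by auto
  then show ?thesis using spl_nonper_eq[OF l, of "\<lambda>_. c"] seg_fun_const[OF l] by simp
qed

lemma basis_per_sum: "x \<in> interval S \<Longrightarrow> (\<Sum>i=1..dim_per S. basis_per S i x) = 1"
  using spl_per_const[of x 1] by (simp add: spl_per_def)

lemma basis_nonper_sum: "x \<in> interval S \<Longrightarrow> (\<Sum>i=1..dim_nonper S. basis_nonper S i x) = 1"
  using spl_nonper_const[of x 1] by (simp add: spl_nonper_def)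

lemma local_interior:
  assumes l: "1 \<le> l" "l \<le> length S" and y: "left_end (seg S l) < y" "y < right_end (seg S l)"
  defines "x \<equiv> y - left_end (seg S l) + breakpoint S (l - 1)"
  shows "x \<in> piece S l" "to_local S l x = y" "0 < x" "x < breakpoint S (length S)"
proof -
  have b: "0 \<le> breakpoint S (l - 1)" "breakpoint S l \<le> breakpoint S (length S)"
    using breakpoint_mono[of 0 "l - 1"] breakpoint_mono[of l "length S"] l by auto
  have e: "breakpoint S l = breakpoint S (l - 1) + (right_end (seg S l) - left_end (seg S l))"
    by (rule breakpoint_pred[OF l(1)])
  have x: "breakpoint S (l - 1) < x" "x < breakpoint S l" unfolding x_def e using y by linarith+
  show "x \<in> piece S l" using x unfolding piece_def by auto
  show "to_local S l x = y" unfolding to_local_def x_def by simp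
  show "0 < x" "x < breakpoint S (length S)" using x b by linarith+
qed

text \<open>The coefficient \<open>a r\<close> is the coefficient of an inner NURBS of some segment, and NURBS are
  linearly independent on their segment.\<close>

lemma spl_per_eq_0_imp:
  assumes z: "\<And>x. 0 < x \<Longrightarrow> x < breakpoint S (length S) \<Longrightarrow> spl_per S a x = 0"
    and r: "1 \<le> r" "r \<le> dim_per S"
  shows "a r = 0"
proof -
  obtain l j where l: "1 \<le> l" "l \<le> length S" and j: "1 \<le> j" "j \<le> dim (seg S l) - 2" "r = eta S (l - 1) + j"
    using eta_concat_exists[of r "length S"] r by (auto simp: dim_per_def)
  have "coeff_per S a l (j + 1) = 0"
  proof (rule seg_fun_eq_0_imp[OF seg_valid[OF l]])
    fix y assume y: "left_end (seg S l) < y" "y < right_end (seg S l)"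
    show "seg_fun (seg S l) (coeff_per S a l) y = 0"
      using z[OF local_interior(3,4)[OF l y]] spl_per_eq[OF l local_interior(1)[OF l y]]
        local_interior(2)[OF l y] by simp
  qed (use j in auto)
  then show ?thesis using j by (auto simp: coeff_per_def split: if_splits)
qed

lemma spl_nonper_eq_0_imp:
  assumes z: "\<And>x. 0 < x \<Longrightarrow> x < breakpoint S (length S) \<Longrightarrow> spl_nonper S a x = 0"
    and r: "1 \<le> r" "r \<le> dim_nonper S"
  shows "a r = 0"
proof -
  have c: "coeff_nonper S a l j = 0" if l: "1 \<le> l" "l \<le> length S" and j: "1 \<le> j" "j \<le> dim (seg S l)" for l j
  proof (rule seg_fun_eq_0_imp[OF seg_valid[OF l] _ j])
    fix y assume y: "left_end (seg S l) < y" "y < right_end (seg S l)"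
    show "seg_fun (seg S l) (coeff_nonper S a l) y = 0"
      using z[OF local_interior(3,4)[OF l y]] spl_nonper_eq[OF l local_interior(1)[OF l y]]
        local_interior(2)[OF l y] by simp
  qed
  consider "r = 1" | "r = dim_nonper S" | "1 \<le> r - 1" "r - 1 \<le> eta S (length S)" "r \<noteq> 1"
    using r by (force simp: dim_nonper_def)
  then show ?thesis
  proof cases
    case 1
    then show ?thesis using c[of 1 1] length_pos dim_ge_3[of 1] by (simp add: coeff_nonper_def)
  next
    case 2
    then show ?thesis using c[of "length S" "dim (seg S (length S))"] length_pos dim_ge_3[of "length S"]
      by (simp add: coeff_nonper_def)
  next
    case 3
    obtain l j where l: "1 \<le> l" "l \<le> length S" and j: "1 \<le> j" "j \<le> dim (seg S l) - 2" "r - 1 = eta S (l - 1) + j"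
      using eta_concat_exists[OF 3(1,2) order.refl] by blast
    have "r = eta S (l - 1) + (j + 1)" using j 3 r by linarith
    moreover have "j + 1 \<noteq> 1" "j + 1 \<noteq> dim (seg S l)" using j by auto
    ultimately have "coeff_nonper S a l (j + 1) = a r" by (simp add: coeff_nonper_def)
    then show ?thesis using c[OF l, of "j + 1"] j by simp
  qed
qed

lemma bvec_support:
  assumes "1 \<le> c" "c \<le> mu S (length S)" "bvec S c x \<noteq> 0"
  shows "x \<in> knot_support S c"
proof -
  obtain l j where l: "1 \<le> l" "l \<le> length S" and j: "1 \<le> j" "j \<le> dim (seg S l)" and c: "c = mu S (l - 1) + j"
    using concat_exists[OF assms(1,2) order.refl] by blast
  have "nurbs (seg S l) j (to_local S l x) \<noteq> 0"
    using assms(3) unfolding bvec_def c seg_of_concat[OF l j] loc_of_concat[OF l j] by (auto split: if_splits)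
  then show ?thesis
    using nurbs_support[OF seg_valid[OF l] _ j]
    unfolding knot_support_def c seg_of_concat[OF l j] loc_of_concat[OF l j] Let_def by auto
qed

lemma basis_per_support:
  assumes "basis_per S i x \<noteq> 0" shows "x \<in> supp_per S i"
proof -
  obtain c where "c \<in> {1..mu S (length S)}" "H_per S i c * bvec S c x \<noteq> 0"
    using assms unfolding basis_per_def by (metis (no_types, lifting) sum.neutral)
  then show ?thesis using bvec_support[of c x] unfolding supp_per_def by auto
qed

lemma basis_nonper_support:
  assumes "basis_nonper S i x \<noteq> 0" shows "x \<in> supp_nonper S i"
proof -
  obtain c where "c \<in> {1..mu S (length S)}" "H_nonper S i c * bvec S c x \<noteq> 0"
    using assms unfolding basis_nonper_def by (metis (no_types, lifting) sum.neutral)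
  then show ?thesis using bvec_support[of c x] unfolding supp_nonper_def by auto
qed

end

section \<open>Smoothness of periodic rational splines\<close>

text \<open>With the periodic extension the seam of the closed curve needs no separate treatment in local
  arguments.\<close>

definition per_ext :: "segments \<Rightarrow> (nat \<Rightarrow> real) \<Rightarrow> real \<Rightarrow> real" where
  "per_ext S a x = (let p = breakpoint S (length S) in spl_per S a (x - p * \<lfloor>x / p\<rfloor>))"

context
  fixes S :: segments
  assumes S: "valid_segments S"
begin

abbreviation (input) "period \<equiv> breakpoint S (length S)"

lemma period_pos: "0 < period"
  using breakpoint_less[OF S, of "length S"] breakpoint_mono[OF S, of 0 "length S - 1"] length_pos[OF S] by simp

lemma per_ext_shift: "per_ext S a (x + real_of_int k * period) = per_ext S a x"
proof -
  have "(x + real_of_int k * period) / period = x / period + real_of_int k" using period_pos by (simp add: field_simps)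
  then show ?thesis by (simp add: per_ext_def Let_def algebra_simps)
qed

lemma per_ext_eq: "0 \<le> x \<Longrightarrow> x < period \<Longrightarrow> per_ext S a x = spl_per S a x"
proof -
  assume "0 \<le> x" "x < period"
  then have "\<lfloor>x / period\<rfloor> = 0" using period_pos by (simp add: floor_eq_iff)
  then show ?thesis by (simp add: per_ext_def)
qed

lemma wrap_exists: obtains x0 k where "x = x0 + real_of_int k * period" "0 \<le> x0" "x0 < period"
proof -
  obtain k where k: "real_of_int k \<le> x / period" "x / period < real_of_int k + 1"
    by (metis floor_correct of_int_add of_int_1)
  have "real_of_int k * period \<le> x" using k(1) period_pos by (simp add: pos_le_divide_eq)
  moreover have "x < (real_of_int k + 1) * period" using k(2) period_pos by (simp add: pos_divide_less_eq)
  ultimately show ?thesis by (intro that[of "x - real_of_int k * period" k]) (auto simp: algebra_simps)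
qed

text \<open>On the interval from \<open>u\<close> to \<open>v\<close> the splines are given by the rational piece of the span \<open>\<mu>\<close> of segment
  \<open>l\<close>, after translation by \<open>h\<close>. The piece is the same for all coefficients \<open>a\<close>, which allows several
  splines to be compared at the same time.\<close>

definition one_sided_rep :: "nat \<Rightarrow> nat \<Rightarrow> real \<Rightarrow> real \<Rightarrow> real \<Rightarrow> bool" where
  "one_sided_rep l \<mu> h u v \<longleftrightarrow> 1 \<le> l \<and> l \<le> length S \<and> deg (seg S l) + 1 \<le> \<mu> \<and> \<mu> \<le> dim (seg S l) \<and> u < v \<and>
     knot (seg S l) \<mu> \<le> u + h \<and> v + h \<le> knot (seg S l) (\<mu> + 1) \<and>
     (\<forall>a z. u \<le> z \<longrightarrow> z \<le> v \<longrightarrow> per_ext S a z = rat (seg S l) \<mu> (coeff_per S a l) (z + h))"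

lemma one_sided_rep_shift: 
  assumes "one_sided_rep l \<mu> h u v"
  shows "one_sided_rep l \<mu> (h - real_of_int k * period) (u + real_of_int k * period) (v + real_of_int k * period)"
  unfolding one_sided_rep_def
proof (intro conjI allI impI)
  fix a z assume z: "u + real_of_int k * period \<le> z" "z \<le> v + real_of_int k * period"
  let ?w = "z - real_of_int k * period"
  have "per_ext S a ?w = rat (seg S l) \<mu> (coeff_per S a l) (?w + h)" using assms z by (simp add: one_sided_rep_def)
  moreover have "per_ext S a z = per_ext S a ?w" using per_ext_shift[of a ?w k] by simp
  ultimately show "per_ext S a z = rat (seg S l) \<mu> (coeff_per S a l) (z + (h - real_of_int k * period))"
    by (simp add: algebra_simps)
qed (use assms in \<open>auto simp: one_sided_rep_def\<close>)

lemma per_ext_in_span: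
  assumes l: "1 \<le> l" "l \<le> length S" and z: "breakpoint S (l - 1) \<le> z" "z < breakpoint S l"
    and s: "in_span (seg S l) \<mu> (to_local S l z)"
  shows "per_ext S a z = rat (seg S l) \<mu> (coeff_per S a l) (to_local S l z)"
proof -
  have p: "z \<in> piece S l" using z by (auto simp: piece_def)
  have "0 \<le> z" "z < period" using z breakpoint_mono[OF S, of 0 "l - 1", OF _ le_trans[OF diff_le_self l(2)]]
    breakpoint_mono[OF S, of l "length S"] l by auto
  then show ?thesis
    using per_ext_eq spl_per_eq[OF S l p] seg_fun_eq_rat[OF seg_valid[OF S l] s] by simp
qed

definition C1_match_at :: "real \<Rightarrow> bool" where
  "C1_match_at x \<longleftrightarrow> (\<exists>l \<mu> h u l' \<mu>' h' v. one_sided_rep l \<mu> h u x \<and> one_sided_rep l' \<mu>' h' x v \<and>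
     (\<forall>a. rat' (seg S l) \<mu> (coeff_per S a l) (x + h) = rat' (seg S l') \<mu>' (coeff_per S a l') (x + h')))"

lemma C1_match_at_shift: "C1_match_at x \<Longrightarrow> C1_match_at (x + real_of_int k * period)"
  unfolding C1_match_at_def
proof (elim exE conjE)
  fix l \<mu> h u l' \<mu>' h' v
  assume a: "one_sided_rep l \<mu> h u x" "one_sided_rep l' \<mu>' h' x v"
    "\<forall>a. rat' (seg S l) \<mu> (coeff_per S a l) (x + h) = rat' (seg S l') \<mu>' (coeff_per S a l') (x + h')"
  show "\<exists>l \<mu> h u l' \<mu>' h' v. one_sided_rep l \<mu> h u (x + real_of_int k * period) \<and> one_sided_rep l' \<mu>' h' (x + real_of_int k * period) v \<and>
     (\<forall>a. rat' (seg S l) \<mu> (coeff_per S a l) (x + real_of_int k * period + h) = rat' (seg S l') \<mu>' (coeff_per S a l') (x + real_of_int k * period + h'))"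
    by (intro exI conjI) (rule one_sided_rep_shift[OF a(1)], rule one_sided_rep_shift[OF a(2)], use a(3) in \<open>simp add: algebra_simps\<close>)
qed

lemma C1_match_at_inner:
  assumes l: "1 \<le> l" "l \<le> length S" and x: "breakpoint S (l - 1) < x" "x < breakpoint S l"
  shows "C1_match_at x"
proof -
  let ?g = "seg S l"
  note g = seg_valid[OF S l]
  define h where "h = left_end ?g - breakpoint S (l - 1)"
  have tl: "to_local S l z = z + h" for z by (simp add: to_local_def h_def)
  have bp: "breakpoint S l = breakpoint S (l - 1) + (right_end ?g - left_end ?g)" by (rule breakpoint_pred[OF l(1)])
  have y: "left_end ?g < x + h" "x + h < right_end ?g" using x bp by (auto simp: h_def)
  obtain \<mu> \<nu> where \<mu>: "deg ?g + 1 \<le> \<mu>" "\<mu> \<le> dim ?g" "knot ?g \<mu> < x + h" "x + h \<le> knot ?g (\<mu> + 1)"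
    and \<nu>: "deg ?g + 1 \<le> \<nu>" "\<nu> \<le> dim ?g" "knot ?g \<nu> \<le> x + h" "x + h < knot ?g (\<nu> + 1)"
    and m: "\<And>C. rat ?g \<mu> C (x + h) = rat ?g \<nu> C (x + h)" "\<And>C. rat' ?g \<mu> C (x + h) = rat' ?g \<nu> C (x + h)"
    using spans_at_interior_point[OF g y] by blast
  have k: "left_end ?g \<le> knot ?g \<mu>" "knot ?g (\<nu> + 1) \<le> right_end ?g"
    using seg_basic(4)[OF g, of 1 \<mu>] seg_basic(4)[OF g, of "\<nu> + 1" "dim ?g + deg ?g + 1"] \<mu> \<nu> seg_basic(1)[OF g]
    by (auto simp: left_end_def right_end_def)
  define u where "u = (x + (knot ?g \<mu> - h)) / 2"
  define v where "v = (x + (knot ?g (\<nu> + 1) - h)) / 2"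
  have u: "u < x" "knot ?g \<mu> < u + h" using \<mu> by (auto simp: u_def field_simps)
  have v: "x < v" "v + h < knot ?g (\<nu> + 1)" using \<nu> by (auto simp: v_def field_simps)
  have hb: "breakpoint S (l - 1) + h = left_end ?g" "breakpoint S l + h = right_end ?g" using bp by (auto simp: h_def)
  have R: "per_ext S a z = rat ?g \<nu> (coeff_per S a l) (z + h)" if "x \<le> z" "z \<le> v" for a z
  proof -
    have "in_span ?g \<nu> (to_local S l z)" unfolding tl using \<nu> v that by (auto simp: in_span_def[OF g])
    moreover have "breakpoint S (l - 1) \<le> z" "z < breakpoint S l" using that x v k hb by linarith+
    ultimately show ?thesis using per_ext_in_span[OF l, of z \<nu> a] unfolding tl by blast
  qed
  have Lf: "per_ext S a z = rat ?g \<mu> (coeff_per S a l) (z + h)" if "u \<le> z" "z \<le> x" for a z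
  proof (cases "z = x")
    case True
    then show ?thesis using R[of x a] v m by simp
  next
    case False
    then have "z < x" using that by simp
    then have "in_span ?g \<mu> (to_local S l z)" unfolding tl using \<mu> u that by (auto simp: in_span_def[OF g])
    moreover have "breakpoint S (l - 1) \<le> z" "z < breakpoint S l" using that x u k hb by linarith+
    ultimately show ?thesis using per_ext_in_span[OF l, of z \<mu> a] unfolding tl by blast
  qed
  have "one_sided_rep l \<mu> h u x" unfolding one_sided_rep_def using l \<mu> u Lf by auto
  moreover have "one_sided_rep l \<nu> h x v" unfolding one_sided_rep_def using l \<nu> v R by auto
  ultimately show ?thesis unfolding C1_match_at_def using m(2) by blast
qed

text \<open>The balance for which the factors \<open>\<alpha>\<close> and \<open>\<beta>\<close> are made: the one-sided derivatives at a junction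
  are \<open>\<alpha>\<close> times the last and \<open>\<beta>\<close> times the first difference of coefficients.\<close>

lemma junction_C1:
  assumes "1 \<le> i" "i \<le> length S"
  shows "alpha S i * (junction S a i - a (eta S i))
      = beta S i * (a (if i = length S then 1 else eta S i + 1) - junction S a i)"
proof -
  have "alpha S i + beta S i \<noteq> 0" using alpha_pos[OF S assms] beta_pos[OF S assms] by simp
  then show ?thesis unfolding junction_def by (simp add: field_simps)
qed

lemma C1_match_at_breakpoint:
  assumes l: "1 \<le> l" "l \<le> length S"
  shows "C1_match_at (breakpoint S (l - 1))"
proof -
  \<comment> \<open>the preceding segment, which for the first one is the last segment of the previous period\<close>
  define i where "i = (if l = 1 then length S else l - 1)"
  have i: "1 \<le> i" "i \<le> length S" using l length_pos[OF S] by (auto simp: i_def)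
  let ?x = "breakpoint S (l - 1)"
  let ?g = "seg S l" and ?g' = "seg S i"
  note g = seg_valid[OF S l] and g' = seg_valid[OF S i]
  define h where "h = left_end ?g - ?x"
  define h' where "h' = right_end ?g' - ?x"
  let ?\<nu> = "deg ?g + 1" and ?\<mu> = "dim ?g'"
  have x: "?x + h = left_end ?g" "?x + h' = right_end ?g'" by (auto simp: h_def h'_def)
  have tl: "to_local S l z = z + h" for z by (simp add: to_local_def h_def)
  have bp: "breakpoint S l = ?x + (right_end ?g - left_end ?g)" by (rule breakpoint_pred[OF l(1)])
  have bp': "breakpoint S i = breakpoint S (i - 1) + (right_end ?g' - left_end ?g')" by (rule breakpoint_pred[OF i(1)])
  define v where "v = (?x + (knot ?g (?\<nu> + 1) - h)) / 2"
  define u where "u = (?x + (knot ?g' ?\<mu> - h')) / 2"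
  have v: "?x < v" "v + h < knot ?g (?\<nu> + 1)" using first_span[OF g] x by (auto simp: v_def field_simps)
  have u: "u < ?x" "knot ?g' ?\<mu> < u + h'" using last_span[OF g'] x by (auto simp: u_def field_simps)
  have k: "left_end ?g' \<le> knot ?g' ?\<mu>" "knot ?g (?\<nu> + 1) \<le> right_end ?g"
    using seg_basic(4)[OF g', of 1 ?\<mu>] seg_basic(3)[OF g']
      seg_basic(4)[OF g, of "?\<nu> + 1" "dim ?g + deg ?g + 1"] seg_basic(2)[OF g]
    by (auto simp: left_end_def right_end_def)
  have c1: "coeff_per S a l 1 = junction S a i" for a by (simp add: coeff_per_def i_def)
  have cd: "coeff_per S a i ?\<mu> = junction S a i" for a
    using seg_basic(3)[OF g'] by (simp add: coeff_per_def)
  have c2: "coeff_per S a l 2 = a (if i = length S then 1 else eta S i + 1)" for a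
    using seg_basic(3)[OF g] l by (auto simp: coeff_per_def i_def)
  have cd1: "coeff_per S a i (?\<mu> - 1) = a (eta S i)" for a
  proof -
    have "eta S i = eta S (i - 1) + (?\<mu> - 1 - 1)" using eta_pred[OF S i] by (simp add: numeral_2_eq_2)
    moreover have "?\<mu> - 1 \<noteq> 1" "?\<mu> - 1 \<noteq> ?\<mu>" using seg_basic(3)[OF g'] by auto
    ultimately show ?thesis by (simp add: coeff_per_def)
  qed
  have R: "per_ext S a z = rat ?g ?\<nu> (coeff_per S a l) (z + h)" if "?x \<le> z" "z \<le> v" for a z
  proof -
    have "in_span ?g ?\<nu> (to_local S l z)"
      unfolding tl using first_span[OF g] last_span(1)[OF g] v x that by (auto simp: in_span_def[OF g])
    moreover have "z < breakpoint S l" using that v k bp x by linarith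
    ultimately show ?thesis using per_ext_in_span[OF l that(1), of ?\<nu> a] unfolding tl by blast
  qed
  have Lf: "per_ext S a z = rat ?g' ?\<mu> (coeff_per S a i) (z + h')" if "u \<le> z" "z \<le> ?x" for a z
  proof (cases "z = ?x")
    case True
    have "per_ext S a ?x = rat ?g ?\<nu> (coeff_per S a l) (?x + h)" by (rule R) (use v in auto)
    also have "\<dots> = junction S a i" unfolding x rat_left_end(1)[OF g] by (rule c1)
    also have "\<dots> = rat ?g' ?\<mu> (coeff_per S a i) (?x + h')" unfolding x rat_right_end(1)[OF g'] cd ..
    finally show ?thesis unfolding True .
  next
    case False
    define k where "k = (if l = 1 then 1 else 0 :: int)"
    have xk: "?x + k * period = breakpoint S i" by (auto simp: k_def i_def)
    let ?w = "z + real_of_int k * period"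
    have tw: "to_local S i ?w = z + h'"
      using xk bp' by (simp add: to_local_def h'_def)
    have w: "?w < breakpoint S i" using xk False that by simp
    have "in_span ?g' ?\<mu> (to_local S i ?w)" unfolding tw
      using last_span[OF g'] u x that False by (auto simp: in_span_def[OF g'])
    moreover have "left_end ?g' \<le> to_local S i ?w" unfolding tw using u k that by linarith
    then have "breakpoint S (i - 1) \<le> ?w" by (simp add: to_local_def)
    ultimately show ?thesis
      using per_ext_in_span[OF i _ w, of ?\<mu> a] per_ext_shift[of a z k] tw by simp
  qed
  have al: "alpha S i = real (deg ?g') / (right_end ?g' - knot ?g' ?\<mu>) * (wt ?g' (?\<mu> - 1) / wt ?g' ?\<mu>)"
    by (simp add: alpha_def Let_def)
  have "(if i = length S then 1 else i + 1) = l" using l length_pos[OF S] by (auto simp: i_def)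
  then have be: "beta S i = real (deg ?g) / (knot ?g (deg ?g + 2) - left_end ?g) * (wt ?g 2 / wt ?g 1)"
    by (simp add: beta_def Let_def)
  have M: "rat' ?g' ?\<mu> (coeff_per S a i) (?x + h') = rat' ?g ?\<nu> (coeff_per S a l) (?x + h)" for a
    unfolding x rat_right_end(2)[OF g'] rat_left_end(2)[OF g] c1 c2 cd cd1 al[symmetric] be[symmetric]
    by (rule junction_C1[OF i])
  have "one_sided_rep i ?\<mu> h' u ?x" unfolding one_sided_rep_def using i last_span[OF g'] u x Lf by auto
  moreover have "one_sided_rep l ?\<nu> h ?x v" unfolding one_sided_rep_def using l last_span(1)[OF g] first_span[OF g] v x R by auto
  ultimately show ?thesis unfolding C1_match_at_def using M by blast
qed

lemma C1_match_everywhere: "C1_match_at x"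
proof -
  obtain x0 k where x: "x = x0 + real_of_int k * period" "0 \<le> x0" "x0 < period" using wrap_exists by blast
  then have "x0 \<in> interval S" by (simp add: interval_def)
  then obtain l where l: "1 \<le> l" "l \<le> length S" "x0 \<in> piece S l" using piece_exists[OF S] by blast
  have "x0 < breakpoint S l" using piece_bounds[OF S l(3)] x by auto
  then have "C1_match_at x0"
    using C1_match_at_breakpoint[OF l(1,2)] C1_match_at_inner[OF l(1,2)] piece_bounds(1)[OF S l(3)] by (cases "x0 = breakpoint S (l - 1)") auto
  then show ?thesis using C1_match_at_shift x(1) by blast
qed

lemma one_sided_rep_denom:
  assumes "one_sided_rep l \<mu> h u v" "u \<le> z" "z \<le> v"
  shows "is_span (knot (seg S l)) (deg (seg S l)) \<mu>" "0 < denom (seg S l) \<mu> (z + h)"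
proof -
  have l: "1 \<le> l" "l \<le> length S" using assms(1) by (auto simp: one_sided_rep_def)
  note g = seg_valid[OF S l]
  show "is_span (knot (seg S l)) (deg (seg S l)) \<mu>" by (rule seg_is_span[OF g]) (use assms in \<open>auto simp: one_sided_rep_def\<close>)
  show "0 < denom (seg S l) \<mu> (z + h)" by (rule denom_pos[OF g]) (use assms in \<open>auto simp: one_sided_rep_def\<close>)
qed

lemma one_sided_rep_derivative_within:
  assumes r: "one_sided_rep l \<mu> h u v" and z: "u \<le> z" "z \<le> v"
  shows "(per_ext S a has_real_derivative rat' (seg S l) \<mu> (coeff_per S a l) (z + h)) (at z within {u..v})"
proof (rule has_field_derivative_transform_within[where d = 1 and f = "\<lambda>z. rat (seg S l) \<mu> (coeff_per S a l) (z + h)"])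
  have l: "1 \<le> l" "l \<le> length S" using r by (auto simp: one_sided_rep_def)
  have "((\<lambda>z. rat (seg S l) \<mu> (coeff_per S a l) (z + h)) has_real_derivative rat' (seg S l) \<mu> (coeff_per S a l) (z + h)) (at z)"
    by (rule DERIV_shift[THEN iffD1], rule rat_has_derivative[OF seg_valid[OF S l]])
      (use one_sided_rep_denom[OF r z] in auto)
  then show "((\<lambda>z. rat (seg S l) \<mu> (coeff_per S a l) (z + h)) has_real_derivative rat' (seg S l) \<mu> (coeff_per S a l) (z + h)) (at z within {u..v})"
    by (rule has_field_derivative_at_within)
qed (use r z in \<open>auto simp: one_sided_rep_def\<close>)

lemma one_sided_rep_isCont:
  assumes r: "one_sided_rep l \<mu> h u v" and z: "u \<le> z" "z \<le> v"
  shows "isCont (\<lambda>z. rat' (seg S l) \<mu> (coeff_per S a l) (z + h)) z"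
proof -
  have l: "1 \<le> l" "l \<le> length S" using r by (auto simp: one_sided_rep_def)
  have "isCont (rat' (seg S l) \<mu> (coeff_per S a l)) (z + h)"
    using rat'_isCont[OF seg_valid[OF S l]] one_sided_rep_denom[OF r z] by simp
  then show ?thesis by (intro isCont_o2[where g = "rat' (seg S l) \<mu> (coeff_per S a l)" and f = "\<lambda>z. z + h"]) auto
qed

lemma at_left_eq_within: "u < (x::real) \<Longrightarrow> at x within {u..x} = at_left x"
  by (rule at_within_nhd[of x "{u<..}"]) auto

lemma at_right_eq_within: "(x::real) < v \<Longrightarrow> at x within {x..v} = at_right x"
  by (rule at_within_nhd[of x "{..<v}"]) auto

lemma per_ext_has_derivative:
  "(per_ext S a has_real_derivative deriv (per_ext S a) x) (at x)"
proof -
  have "\<exists>d. (per_ext S a has_real_derivative d) (at x)"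
  proof -
    obtain l \<mu> h u l' \<mu>' h' v where r: "one_sided_rep l \<mu> h u x" "one_sided_rep l' \<mu>' h' x v"
      "\<And>a. rat' (seg S l) \<mu> (coeff_per S a l) (x + h) = rat' (seg S l') \<mu>' (coeff_per S a l') (x + h')"
      using C1_match_everywhere[of x] unfolding C1_match_at_def by blast
    have uv: "u < x" "x < v" using r by (auto simp: one_sided_rep_def)
    let ?d = "rat' (seg S l) \<mu> (coeff_per S a l) (x + h)"
    have 1: "(per_ext S a has_real_derivative ?d) (at_left x)"
      using one_sided_rep_derivative_within[OF r(1), of x a] uv at_left_eq_within[OF uv(1)] by simp
    have 2: "(per_ext S a has_real_derivative ?d) (at_right x)"
      using one_sided_rep_derivative_within[OF r(2), of x a] uv at_right_eq_within[OF uv(2)] r(3) by simp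
    have "(per_ext S a has_real_derivative ?d) (at x)"
      using filterlim_split_at[OF 1[unfolded has_field_derivative_iff] 2[unfolded has_field_derivative_iff]]
      unfolding has_field_derivative_iff .
    then show ?thesis by blast
  qed
  then show ?thesis using DERIV_imp_deriv by blast
qed

lemma one_sided_rep_deriv:
  assumes r: "one_sided_rep l \<mu> h u v" and z: "u \<le> z" "z \<le> v"
  shows "deriv (per_ext S a) z = rat' (seg S l) \<mu> (coeff_per S a l) (z + h)"
proof -
  have "u < v" using r by (auto simp: one_sided_rep_def)
  then have nb: "at z within {u..v} \<noteq> bot" using z by (simp add: trivial_limit_within islimpt_Icc)
  show ?thesis
    by (rule has_field_derivative_unique[OF has_field_derivative_at_within[OF per_ext_has_derivative] one_sided_rep_derivative_within[OF r z] nb])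
qed

lemma per_ext_deriv_isCont: "isCont (deriv (per_ext S a)) x"
proof -
  obtain l \<mu> h u l' \<mu>' h' v where r: "one_sided_rep l \<mu> h u x" "one_sided_rep l' \<mu>' h' x v"
    using C1_match_everywhere[of x] unfolding C1_match_at_def by blast
  have uv: "u < x" "x < v" using r by (auto simp: one_sided_rep_def)
  have "(deriv (per_ext S a) \<longlongrightarrow> deriv (per_ext S a) x) (at_left x)"
  proof (rule Lim_transform_eventually)
    show "((\<lambda>z. rat' (seg S l) \<mu> (coeff_per S a l) (z + h)) \<longlongrightarrow> deriv (per_ext S a) x) (at_left x)"
      using one_sided_rep_isCont[OF r(1), of x a] uv one_sided_rep_deriv[OF r(1), of x]
      by (auto simp: isCont_def intro: filterlim_mono[OF _ order.refl at_le])
    show "\<forall>\<^sub>F z in at_left x. rat' (seg S l) \<mu> (coeff_per S a l) (z + h) = deriv (per_ext S a) z"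
      unfolding eventually_at_left_field by (intro exI[of _ u]) (use uv one_sided_rep_deriv[OF r(1)] in auto)
  qed
  moreover have "(deriv (per_ext S a) \<longlongrightarrow> deriv (per_ext S a) x) (at_right x)"
  proof (rule Lim_transform_eventually)
    show "((\<lambda>z. rat' (seg S l') \<mu>' (coeff_per S a l') (z + h')) \<longlongrightarrow> deriv (per_ext S a) x) (at_right x)"
      using one_sided_rep_isCont[OF r(2), of x a] uv one_sided_rep_deriv[OF r(2), of x]
      by (auto simp: isCont_def intro: filterlim_mono[OF _ order.refl at_le])
    show "\<forall>\<^sub>F z in at_right x. rat' (seg S l') \<mu>' (coeff_per S a l') (z + h') = deriv (per_ext S a) z"
      unfolding eventually_at_right_field by (intro exI[of _ v]) (use uv one_sided_rep_deriv[OF r(2)] in auto)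
  qed
  ultimately show ?thesis unfolding isCont_def by (rule filterlim_split_at)
qed

lemma per_ext_deriv_periodic:
  "deriv (per_ext S a) (x + real_of_int k * period) = deriv (per_ext S a) x"
proof -
  have "((\<lambda>x. per_ext S a (x + real_of_int k * period)) has_real_derivative
      deriv (per_ext S a) (x + real_of_int k * period)) (at x)"
    by (rule DERIV_shift[THEN iffD1]) (rule per_ext_has_derivative)
  then have "(per_ext S a has_real_derivative deriv (per_ext S a) (x + real_of_int k * period)) (at x)"
    by (simp add: per_ext_shift)
  then show ?thesis by (rule DERIV_imp_deriv[symmetric])
qed

text \<open>At the right end of the interval the spline is evaluated in the last segment and its extension
  in the first one. Both give the periodic junction value.\<close>

lemma per_ext_at_interval: "0 \<le> x \<Longrightarrow> x \<le> period \<Longrightarrow> per_ext S a x = spl_per S a x"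
proof (cases "x = period")
  case True
  have m: "1 \<le> length S" "length S \<le> length S" using length_pos[OF S] by auto
  have 1: "1 \<le> (1::nat)" "1 \<le> length S" using length_pos[OF S] by auto
  note g = seg_valid[OF S m]
  have tl: "to_local S (length S) period = right_end (seg S (length S))"
    using breakpoint_pred[OF m(1), of S] by (simp add: to_local_def)
  have p: "period \<in> piece S (length S)" using breakpoint_less[OF S m] by (simp add: piece_def)
  have s: "in_span (seg S (length S)) (dim (seg S (length S))) (right_end (seg S (length S)))"
    using last_span[OF g] seg_basic(8)[OF g] by (auto simp: in_span_def[OF g])
  have "spl_per S a period = coeff_per S a (length S) (dim (seg S (length S)))"
    using spl_per_eq[OF S m p, of a] seg_fun_eq_rat[OF g s] rat_right_end(1)[OF g] by (simp add: tl)
  also have "\<dots> = junction S a (length S)" using seg_basic(3)[OF g] by (simp add: coeff_per_def)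
  finally have L: "spl_per S a period = junction S a (length S)" .
  note g1 = seg_valid[OF S 1]
  have p0: "0 \<in> piece S 1" using breakpoint_less[OF S 1] by (auto simp: piece_def)
  have s0: "in_span (seg S 1) (deg (seg S 1) + 1) (left_end (seg S 1))"
    unfolding in_span_def[OF g1] using last_span[OF g1] first_span[OF g1] by simp
  have "spl_per S a 0 = coeff_per S a 1 1"
  proof -
    have "to_local S 1 0 = left_end (seg S 1)" by (simp add: to_local_def)
    then show ?thesis
      using spl_per_eq[OF S 1 p0, of a] seg_fun_eq_rat[OF g1 s0, of "coeff_per S a 1"]
        rat_left_end(1)[OF g1, of "coeff_per S a 1"] by metis
  qed
  also have "\<dots> = junction S a (length S)" by (simp add: coeff_per_def)
  finally have "spl_per S a 0 = junction S a (length S)" .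
  moreover have "per_ext S a period = per_ext S a 0" using per_ext_shift[of a 0 1] by simp
  ultimately show ?thesis using True L per_ext_eq[of 0 a] period_pos by simp
qed (use per_ext_eq in auto)

end

section \<open>The closed curve with control points on the unit circle\<close>

lemma det3_unit_circle:
  "det3 (sin A) (cos A) 1 (sin B) (cos B) 1 (sin C) (cos C) 1 =
     4 * sin ((A - B) / 2) * sin ((B - C) / 2) * sin ((A - C) / 2)"
proof -
  define p q where "p = (A - B) / 2" and "q = (B - C) / 2"
  have AC: "(A - C) / 2 = p + q" by (simp add: p_def q_def field_simps)
  have "det3 (sin A) (cos A) 1 (sin B) (cos B) 1 (sin C) (cos C) 1 = sin (A - B) + sin (B - C) - sin (A - C)"
    unfolding det3_def sin_diff by (simp add: algebra_simps)
  also have "\<dots> = sin (2 * p) + sin (2 * q) - sin (2 * p + 2 * q)"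
  proof -
    have "A - B = 2 * p" "B - C = 2 * q" "A - C = 2 * p + 2 * q" by (simp_all add: p_def q_def field_simps)
    then show ?thesis by (simp only:)
  qed
  also have "\<dots> = sin (2 * p) * (1 - cos (2 * q)) + sin (2 * q) * (1 - cos (2 * p))"
    by (simp add: sin_add algebra_simps)
  also have "\<dots> = 4 * sin p * sin q * sin (p + q)"
    unfolding sin_double cos_double_sin by (simp add: sin_add power2_eq_square algebra_simps)
  finally show ?thesis unfolding AC p_def[symmetric] q_def[symmetric] .
qed

lemma det3_scale_rows:
  "det3 (a * a1) (a * a2) (a * a3) (b * b1) (b * b2) (b * b3) (c * c1) (c * c2) (c * c3)
    = a * b * c * det3 a1 a2 a3 b1 b2 b3 c1 c2 c3"
  unfolding det3_def by (simp add: algebra_simps)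

lemma convex_chain_weighted:
  assumes "convex_chain X Y Z l h" "\<And>j. l \<le> j \<Longrightarrow> j \<le> h \<Longrightarrow> 0 < w j"
  shows "convex_chain (\<lambda>j. w j * X j) (\<lambda>j. w j * Y j) (\<lambda>j. w j * Z j) l h"
  using assms unfolding convex_chain_def tri_def det3_scale_rows
  by (auto intro!: mult_nonneg_nonneg mult_pos_pos simp: less_imp_le)

text \<open>The polygon \<open>C\<close> arises from \<open>E\<close> by moving the first and the last vertex into the adjacent edges.
  If it closes up, then \<open>E\<close> overlaps itself, and the triangles of \<open>E\<close> that contain both end points
  may be oriented the wrong way. The corresponding triangles of \<open>C\<close> are degenerate.\<close>

lemma convex_chain_end_cut:
  fixes Ex Ey Cx Cy :: "nat \<Rightarrow> real"
  defines "Ez \<equiv> (\<lambda>_. 1)" and "Cz \<equiv> (\<lambda>_. 1)"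
  assumes k: "3 \<le> k"
    and pos: "\<And>i. i + 2 \<le> k - 1 \<Longrightarrow> 0 < tri Ex Ey Ez i (i + 1) (i + 2)"
    and nn: "\<And>a b c. a \<le> b \<Longrightarrow> b \<le> c \<Longrightarrow> c \<le> k - 1 \<Longrightarrow> \<not> (a = 0 \<and> c = k - 1 \<and> is_closed) \<Longrightarrow> 0 \<le> tri Ex Ey Ez a b c"
    and is_closed: "is_closed \<Longrightarrow> Cx 1 = Cx k \<and> Cy 1 = Cy k \<and> 4 \<le> k"
    and s: "0 < s" "s < 1" "0 < t" "t < 1"
    and Cx: "Cx 1 = (1 - s) * Ex 0 + s * Ex 1" "Cx k = (1 - t) * Ex (k - 2) + t * Ex (k - 1)"
      "\<And>j. 1 < j \<Longrightarrow> j < k \<Longrightarrow> Cx j = Ex (j - 1)"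
    and Cy: "Cy 1 = (1 - s) * Ey 0 + s * Ey 1" "Cy k = (1 - t) * Ey (k - 2) + t * Ey (k - 1)"
      "\<And>j. 1 < j \<Longrightarrow> j < k \<Longrightarrow> Cy j = Ey (j - 1)"
  shows "convex_chain Cx Cy Cz 1 k"
proof -
  define u where "u i = (if i = 1 then s else 0)" for i :: nat
  define v where "v i = (if i = k then t else 1)" for i :: nat
  have first: "Cx i = (1 - u i) * Ex (i - 1) + u i * Ex i" "Cy i = (1 - u i) * Ey (i - 1) + u i * Ey i"
    "Cz i = (1 - u i) * Ez (i - 1) + u i * Ez i" if "1 \<le> i" "i < k" for i
    using that Cx(1) Cy(1) Cx(3)[of i] Cy(3)[of i] by (auto simp: u_def Ez_def Cz_def)
  have last: "Cx i = (1 - v i) * Ex (i - 2) + v i * Ex (i - 1)" "Cy i = (1 - v i) * Ey (i - 2) + v i * Ey (i - 1)"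
    "Cz i = (1 - v i) * Ez (i - 2) + v i * Ez (i - 1)" if "1 < i" "i \<le> k" for i
    using that Cx(2) Cy(2) Cx(3)[of i] Cy(3)[of i] by (auto simp: v_def Ez_def Cz_def)
  have mid: "Cx j = Ex (j - 1)" "Cy j = Ey (j - 1)" "Cz j = Ez (j - 1)" if "1 < j" "j < k" for j
    using that Cx(3) Cy(3) by (auto simp: Ez_def Cz_def)
  have ex: "tri Cx Cy Cz i j l =
      (1 - u i) * ((1 - v l) * tri Ex Ey Ez (i - 1) (j - 1) (l - 2) + v l * tri Ex Ey Ez (i - 1) (j - 1) (l - 1))
      + u i * ((1 - v l) * tri Ex Ey Ez i (j - 1) (l - 2) + v l * tri Ex Ey Ez i (j - 1) (l - 1))"
    if "1 \<le> i" "i < j" "j < l" "l \<le> k" for i j l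
  proof -
    have h: "i < k" "1 < j" "j < k" "1 < l" using that by auto
    show ?thesis unfolding tri_def first[OF that(1) h(1)] last[OF h(4) that(4)] mid[OF h(2,3)] det3_mix(1)
      unfolding det3_mix(3) ..
  qed
  have u: "0 \<le> u i" "u i < 1" and v: "0 < v i" "v i \<le> 1" for i using s by (auto simp: u_def v_def)
  show ?thesis unfolding convex_chain_def
  proof (intro conjI allI impI)
    fix i j l assume ijl: "1 \<le> i" "i < j" "j < l" "l \<le> k"
    show "0 \<le> tri Cx Cy Cz i j l"
    proof (cases "is_closed \<and> i = 1 \<and> l = k")
      case True
      then show ?thesis using is_closed by (simp add: tri_def Cz_def)
    next
      case False
      have "0 \<le> u i * ((1 - v l) * tri Ex Ey Ez i (j - 1) (l - 2) + v l * tri Ex Ey Ez i (j - 1) (l - 1))"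
        using u[of i] v[of l] ijl by (intro mult_nonneg_nonneg add_nonneg_nonneg nn) auto
      moreover have "0 \<le> (1 - v l) * tri Ex Ey Ez (i - 1) (j - 1) (l - 2)"
        using v[of l] ijl by (intro mult_nonneg_nonneg nn) auto
      moreover have "0 \<le> tri Ex Ey Ez (i - 1) (j - 1) (l - 1)"
        by (rule nn) (use ijl False in auto)
      then have "0 \<le> v l * tri Ex Ey Ez (i - 1) (j - 1) (l - 1)" using v[of l] by simp
      ultimately show ?thesis unfolding ex[OF ijl]
        by (intro add_nonneg_nonneg[OF mult_nonneg_nonneg[OF _ add_nonneg_nonneg]]) (use u[of i] in auto)
    qed
  next
    fix i assume i: "1 \<le> i" "i + 2 \<le> k"
    have ijl: "1 \<le> i" "i < i + 1" "i + 1 < i + 2" "i + 2 \<le> k" using i by auto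
    have nc: "\<not> (i - 1 = 0 \<and> i + 2 - 1 = k - 1 \<and> is_closed)" using is_closed i by auto
    have "0 \<le> u i * ((1 - v (i + 2)) * tri Ex Ey Ez i (i + 1 - 1) (i + 2 - 2) + v (i + 2) * tri Ex Ey Ez i (i + 1 - 1) (i + 2 - 1))"
      using u[of i] v[of "i + 2"] i by (intro mult_nonneg_nonneg add_nonneg_nonneg nn) auto
    moreover have "0 \<le> (1 - v (i + 2)) * tri Ex Ey Ez (i - 1) (i + 1 - 1) (i + 2 - 2)"
      using v[of "i + 2"] i by (intro mult_nonneg_nonneg nn) auto
    moreover have "0 < tri Ex Ey Ez (i - 1) (i - 1 + 1) (i - 1 + 2)" by (rule pos) (use i in auto)
    then have "0 < tri Ex Ey Ez (i - 1) (i + 1 - 1) (i + 2 - 1)" using i by simp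
    then have "0 < v (i + 2) * tri Ex Ey Ez (i - 1) (i + 1 - 1) (i + 2 - 1)" using v[of "i + 2"] by simp
    ultimately show "0 < tri Cx Cy Cz i (i + 1) (i + 2)"
      unfolding ex[OF ijl]
      by (intro add_pos_nonneg[OF mult_pos_pos[OF _ add_nonneg_pos]]) (use u[of i] in auto)
  qed
qed

context
  fixes S :: segments
  assumes S: "valid_segments S" and n3: "3 \<le> dim_per S"
begin

abbreviation "sin_angle \<equiv> (\<lambda>i. sin (theta S i))"
abbreviation "cos_angle \<equiv> (\<lambda>i. cos (theta S i))"

lemma theta_periodic:
  "sin (theta S (dim_per S + 1)) = sin (theta S 1)" "cos (theta S (dim_per S + 1)) = cos (theta S 1)"
  "sin (theta S (dim_per S)) = sin (theta S 0)" "cos (theta S (dim_per S)) = cos (theta S 0)"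
proof -
  have a: "theta S 1 = theta S (dim_per S + 1) + 2 * pi" and b: "theta S 0 = theta S (dim_per S) + 2 * pi"
    using n3 by (simp_all add: theta_def field_simps)
  show "sin (theta S (dim_per S + 1)) = sin (theta S 1)" "cos (theta S (dim_per S + 1)) = cos (theta S 1)"
    unfolding a by simp_all
  show "sin (theta S (dim_per S)) = sin (theta S 0)" "cos (theta S (dim_per S)) = cos (theta S 0)"
    unfolding b by simp_all
qed

lemma theta_diff: "(theta S i - theta S j) / 2 = (real j - real i) * pi / real (dim_per S)"
  using n3 by (simp add: theta_def field_simps)

text \<open>The angles decrease with the index. With the order sine, cosine of the coordinates the triangles
  are positively oriented, as long as the polygon does not go round more than once.\<close>

lemma tri_theta:
  assumes "i \<le> j" "j \<le> k" "k \<le> i + dim_per S"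
  shows "0 \<le> tri sin_angle cos_angle (\<lambda>_. 1) i j k"
proof -
  have s: "0 \<le> sin ((real b - real a) * pi / real (dim_per S))" if "a \<le> b" "b \<le> a + dim_per S" for a b
  proof (rule sin_ge_zero)
    show "0 \<le> (real b - real a) * pi / real (dim_per S)" using that by simp
    have "(real b - real a) * pi \<le> real (dim_per S) * pi" using that by (intro mult_right_mono) auto
    then show "(real b - real a) * pi / real (dim_per S) \<le> pi" using n3 by (simp add: field_simps)
  qed
  show ?thesis unfolding tri_def det3_unit_circle theta_diff
    using assms by (intro mult_nonneg_nonneg s) auto
qed

lemma tri_theta_pos: "0 < tri sin_angle cos_angle (\<lambda>_. 1) i (i + 1) (i + 2)"
proof -
  have s: "0 < sin ((real b - real a) * pi / real (dim_per S))" if "a < b" "b < a + dim_per S" for a b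
  proof (rule sin_gt_zero)
    show "0 < (real b - real a) * pi / real (dim_per S)" using that n3 by simp
    have "(real b - real a) * pi < real (dim_per S) * pi" using that by (intro mult_strict_right_mono) auto
    then show "(real b - real a) * pi / real (dim_per S) < pi" using n3 by (simp add: field_simps)
  qed
  show ?thesis unfolding tri_def det3_unit_circle theta_diff
    using n3 by (intro mult_pos_pos s) auto
qed

text \<open>The junctions lie on edges of the regular polygon, so one segment sees a part of that polygon with
  its two ends cut. A single segment sees the whole polygon, closed at the periodic junction.\<close>

lemma coeff_convex_chain:
  assumes l: "1 \<le> l" "l \<le> length S"
  shows "convex_chain (coeff_per S sin_angle l) (coeff_per S cos_angle l) (\<lambda>_. 1) 1 (dim (seg S l))"
proof -
  let ?m = "length S" and ?n = "dim_per S"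
  define e where "e = eta S (l - 1)"
  define k where "k = dim (seg S l)"
  define i where "i = (if l = 1 then ?m else l - 1)"
  have k3: "3 \<le> k" using dim_ge_3[OF S l] by (simp add: k_def)
  have i: "1 \<le> i" "i \<le> ?m" using l length_pos[OF S] by (auto simp: i_def)
  define s where "s = beta S i / (alpha S i + beta S i)"
  define t where "t = beta S l / (alpha S l + beta S l)"
  have st: "0 < s" "s < 1" "0 < t" "t < 1"
    using alpha_pos[OF S i] beta_pos[OF S i] alpha_pos[OF S l] beta_pos[OF S l] by (auto simp: s_def t_def)
  have s1: "1 - s = alpha S i / (alpha S i + beta S i)" "1 - t = alpha S l / (alpha S l + beta S l)"
    using alpha_pos[OF S i] beta_pos[OF S i] alpha_pos[OF S l] beta_pos[OF S l] by (auto simp: s_def t_def field_simps)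
  have el: "eta S l = e + (k - 2)" using eta_pred[OF S l] by (simp add: e_def k_def)
  have n: "?n = eta S ?m" by (simp add: dim_per_def)
  have J: "junction S a i = (1 - s) * a e + s * a (e + 1)"
    "junction S a l = (1 - t) * a (e + (k - 2)) + t * a (e + (k - 1))"
    if "a (?n + 1) = a 1" "a ?n = a 0" for a
  proof -
    have jj: "junction S a q = (alpha S q * a (eta S q) + beta S q * a (eta S q + 1)) / (alpha S q + beta S q)" for q
      using that n by (auto simp: junction_def)
    have "a (eta S i) = a e" "a (eta S i + 1) = a (e + 1)"
      using that n by (auto simp: i_def e_def)
    then show "junction S a i = (1 - s) * a e + s * a (e + 1)"
      unfolding jj s1 by (simp add: s_def add_divide_distrib)
    have "Suc (e + k - 2) = e + k - Suc 0" "e + (k - 2) + 1 = e + (k - 1)" using k3 by auto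
    then show "junction S a l = (1 - t) * a (e + (k - 2)) + t * a (e + (k - 1))"
      unfolding jj s1 el by (simp add: t_def add_divide_distrib)
  qed
  have c: "coeff_per S a l 1 = junction S a i" "coeff_per S a l k = junction S a l" for a
    using k3 by (auto simp: coeff_per_def i_def k_def)
  have cm: "coeff_per S a l j = a (e + (j - 1))" if "1 < j" "j < k" for a j
    using that by (simp add: coeff_per_def k_def e_def)
  have tr: "tri (\<lambda>i. sin_angle (e + i)) (\<lambda>i. cos_angle (e + i)) (\<lambda>_. 1) a b c = tri sin_angle cos_angle (\<lambda>_. 1) (e + a) (e + b) (e + c)" for a b c
    by (simp add: tri_def)
  have span: "e + (k - 1) \<le> e + ?n" if "?m \<noteq> 1"
  proof -
    have "eta S (l - 1) + (k - 2) + 1 \<le> ?n \<or> 1 \<le> eta S (l - 1) \<and> eta S (l - 1) + (k - 2) \<le> ?n"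
    proof (cases "l = ?m")
      case True
      then have "1 \<le> eta S (l - 1)" using eta_lower[OF S, of "l - 1"] that l by auto
      then show ?thesis using el n True by (auto simp: e_def)
    next
      case False
      then show ?thesis using eta_mono[OF S, of l ?m] el l n by (auto simp: e_def)
    qed
    then show ?thesis using k3 by linarith
  qed
  have m1: "e = 0 \<and> k - 2 = ?n \<and> i = l" if "?m = 1"
    using that l el n by (auto simp: e_def i_def)
  show ?thesis unfolding k_def[symmetric]
  proof (rule convex_chain_end_cut[where Ex = "\<lambda>i. sin_angle (e + i)" and Ey = "\<lambda>i. cos_angle (e + i)" and s = s and t = t and is_closed = "?m = 1"])
    show "3 \<le> k" by (rule k3)
    show "0 < tri (\<lambda>i. sin_angle (e + i)) (\<lambda>i. cos_angle (e + i)) (\<lambda>_. 1) i (i + 1) (i + 2)" for i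
      unfolding tr using tri_theta_pos[of "e + i"] by (simp add: add.assoc)
    show "0 \<le> tri (\<lambda>i. sin_angle (e + i)) (\<lambda>i. cos_angle (e + i)) (\<lambda>_. 1) a b c"
      if "a \<le> b" "b \<le> c" "c \<le> k - 1" "\<not> (a = 0 \<and> c = k - 1 \<and> ?m = 1)" for a b c
      unfolding tr
    proof (rule tri_theta)
      show "e + c \<le> e + a + ?n" using that span m1 k3 by (cases "?m = 1") auto
    qed (use that in auto)
    show "coeff_per S sin_angle l 1 = coeff_per S sin_angle l k \<and> coeff_per S cos_angle l 1 = coeff_per S cos_angle l k \<and> 4 \<le> k" if "?m = 1"
      using m1[OF that] n3 unfolding c by auto
    show "0 < s" "s < 1" "0 < t" "t < 1" by (fact st)+
  qed (use theta_periodic k3 in \<open>auto simp: c[simplified] c J cm\<close>)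
qed

lemma radial_tangent_side:
  assumes r: "one_sided_rep S l \<mu> h u v" and x: "u \<le> x" "x \<le> v"
    and d: "deriv (per_ext S sin_angle) x = c * per_ext S sin_angle x" "deriv (per_ext S cos_angle) x = c * per_ext S cos_angle x"
    and dr: "\<And>a. deriv (per_ext S a) x = rat' (seg S l) \<mu> (coeff_per S a l) (x + h)"
  shows "eventually (\<lambda>z. z \<in> {u..v} \<longrightarrow> 0 < c * (per_ext S sin_angle x * per_ext S cos_angle z - per_ext S cos_angle x * per_ext S sin_angle z)) (at x)"
proof -
  let ?g = "seg S l"
  have l: "1 \<le> l" "l \<le> length S" using r by (auto simp: one_sided_rep_def[OF S])
  have \<mu>: "deg ?g + 1 \<le> \<mu>" "\<mu> \<le> dim ?g" using r by (auto simp: one_sided_rep_def[OF S])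
  note g = seg_valid[OF S l]
  note sp = one_sided_rep_denom(1)[OF S r x]
  have W: "0 < denom ?g \<mu> (z + h)" if "u \<le> z" "z \<le> v" for z by (rule one_sided_rep_denom(2)[OF S r that])
  define P where "P a z = numer ?g \<mu> (coeff_per S a l) (z + h)" for a z
  define P1 where "P1 a z = numer' ?g \<mu> (coeff_per S a l) (z + h)" for a z
  have DP: "(P a has_real_derivative P1 a z) (at z)" for a z
    unfolding P_def[abs_def] P1_def by (rule DERIV_shift[THEN iffD1], rule numer_has_derivative[OF g sp])
  have DP1: "(P1 a has_real_derivative deboor'' (knot ?g) (deg ?g) (z + h) (\<lambda>j. wt ?g j * coeff_per S a l j) \<mu>) (at z)" for a z
    unfolding P1_def[abs_def] numer'_def
    by (rule DERIV_shift[THEN iffD1], rule deboor'_has_derivative[OF sp])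
  have val: "per_ext S a z = P a z / denom ?g \<mu> (z + h)" if "u \<le> z" "z \<le> v" for a z
    using r that by (simp add: one_sided_rep_def[OF S] rat_def P_def)
  have rad: "P1 a x * denom ?g \<mu> (x + h) - P a x * denom' ?g \<mu> (x + h) = c * P a x * denom ?g \<mu> (x + h)"
    if "deriv (per_ext S a) x = c * per_ext S a x" for a
  proof -
    have "(P1 a x * denom ?g \<mu> (x + h) - P a x * denom' ?g \<mu> (x + h)) / (denom ?g \<mu> (x + h) * denom ?g \<mu> (x + h))
       = c * (P a x / denom ?g \<mu> (x + h))"
      using that dr[of a] val[OF x, of a] unfolding rat'_def P_def P1_def by simp
    moreover have "N = c * Q * V" if "N / (V * V) = c * (Q / V)" "0 < V" for N Q V :: real
      using that by (simp add: field_simps)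
    ultimately show ?thesis using W[OF x] by blast
  qed
  have cc: "convex_chain (\<lambda>j. wt ?g j * coeff_per S sin_angle l j) (\<lambda>j. wt ?g j * coeff_per S cos_angle l j) (\<lambda>j. wt ?g j * 1) (\<mu> - deg ?g) \<mu>"
    by (rule convex_chain_weighted[OF convex_chain_subset[OF coeff_convex_chain[OF l]]])
      (use \<mu> seg_basic(9)[OF g] in auto)
  have kn: "knot ?g \<mu> \<le> x + h" "x + h \<le> knot ?g (\<mu> + 1)" using r x by (auto simp: one_sided_rep_def[OF S])
  note det = deboor_wronskian_pos[OF sp seg_basic(1)[OF g] kn cc]
  have "eventually (\<lambda>z. 0 < c * (P sin_angle x * P cos_angle z - P cos_angle x * P sin_angle z)) (at x)"
    by (rule curve_on_one_side_of_radial_tangent[where P = "P sin_angle" and Q = "P cos_angle" and ?P1.0 = "P1 sin_angle" and ?Q1.0 = "P1 cos_angle"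
          and W = "\<lambda>z. denom ?g \<mu> (z + h)" and ?W1.0 = "\<lambda>z. denom' ?g \<mu> (z + h)",
          OF DP DP DP1 DP1 W[OF x] det[folded numer_def numer'_def, folded P_def P1_def]])
      (rule rad[OF d(1)], rule rad[OF d(2)])
  then show ?thesis
  proof eventually_elim
    case (elim z)
    show ?case
    proof
      assume z: "z \<in> {u..v}"
      have "c * (per_ext S sin_angle x * per_ext S cos_angle z - per_ext S cos_angle x * per_ext S sin_angle z)
         = c * (P sin_angle x * P cos_angle z - P cos_angle x * P sin_angle z) / (denom ?g \<mu> (x + h) * denom ?g \<mu> (z + h))"
        using val[OF x] val[of z] z by (simp add: diff_divide_distrib right_diff_distrib)
      moreover have "0 < denom ?g \<mu> (x + h) * denom ?g \<mu> (z + h)" using W[OF x] W[of z] z by simp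
      ultimately show "0 < c * (per_ext S sin_angle x * per_ext S cos_angle z - per_ext S cos_angle x * per_ext S sin_angle z)" using elim by simp
    qed
  qed
qed

text \<open>The Wronskian has the same sign on the spans to the left and to the right of \<open>x\<close>. So the curve
  lies on the same side of a radial tangent for both of them.\<close>

lemma radial_tangent:
  assumes d: "deriv (per_ext S sin_angle) x = c * per_ext S sin_angle x" "deriv (per_ext S cos_angle) x = c * per_ext S cos_angle x"
  shows "eventually (\<lambda>z. 0 < c * (per_ext S sin_angle x * per_ext S cos_angle z - per_ext S cos_angle x * per_ext S sin_angle z)) (at x)"
proof -
  obtain l \<mu> h u l' \<mu>' h' v where r: "one_sided_rep S l \<mu> h u x" "one_sided_rep S l' \<mu>' h' x v"
    using C1_match_everywhere[OF S, of x] unfolding C1_match_at_def[OF S] by blast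
  have uv: "u < x" "x < v" using r by (auto simp: one_sided_rep_def[OF S])
  have dr: "deriv (per_ext S a) z = rat' (seg S l) \<mu> (coeff_per S a l) (z + h)"
    if "one_sided_rep S l \<mu> h u v" "u \<le> z" "z \<le> v" for a l \<mu> h u v z
    by (rule one_sided_rep_deriv[OF S that])
  have e1: "eventually (\<lambda>z. z \<in> {u..x} \<longrightarrow> 0 < c * (per_ext S sin_angle x * per_ext S cos_angle z - per_ext S cos_angle x * per_ext S sin_angle z)) (at x)"
    by (rule radial_tangent_side[OF r(1) _ _ d dr[OF r(1)]]) (use uv in auto)
  have e2: "eventually (\<lambda>z. z \<in> {x..v} \<longrightarrow> 0 < c * (per_ext S sin_angle x * per_ext S cos_angle z - per_ext S cos_angle x * per_ext S sin_angle z)) (at x)"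
    by (rule radial_tangent_side[OF r(2) _ _ d dr[OF r(2)]]) (use uv in auto)
  have e3: "eventually (\<lambda>z. z \<in> {u<..<v}) (at x)"
    by (rule eventually_at_in_open') (use uv in auto)
  show ?thesis using e1 e2 e3 by eventually_elim (use linear in auto)
qed

end

section \<open>The radial functions near the collapsed edge\<close>

definition unit_coeff :: "nat \<Rightarrow> nat \<Rightarrow> real" where
  "unit_coeff j = (\<lambda>r. if r = j then 1 else 0)"

context
  fixes T :: segments
  assumes T: "valid_segments T"
begin

definition first_seg where "first_seg = seg T 1"

definition first_knot :: real where
  "first_knot = knot first_seg (deg first_seg + 2) - left_end first_seg"

text \<open>The rational function that equals the \<open>j\<close>-th non-periodic basis function on the first knot span.
  It is differentiable from both sides at 0, where the basis function itself starts.\<close>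

definition nonper_germ :: "nat \<Rightarrow> real \<Rightarrow> real" where
  "nonper_germ j t = rat first_seg (deg first_seg + 1) (coeff_nonper T (unit_coeff j) 1) (t + left_end first_seg)"

definition nonper_germ' :: "nat \<Rightarrow> real \<Rightarrow> real" where
  "nonper_germ' j t = rat' first_seg (deg first_seg + 1) (coeff_nonper T (unit_coeff j) 1) (t + left_end first_seg)"

lemma first_valid: "valid_segment first_seg"
  using seg_valid[OF T, of 1] length_pos[OF T] by (simp add: first_seg_def)

lemma first_knot_pos: "0 < first_knot"
  using seg_basic(7)[OF first_valid] by (simp add: first_knot_def)

lemma first_knot_le: "first_knot \<le> breakpoint T 1" "breakpoint T 1 \<le> breakpoint T (length T)"
proof -
  have "knot first_seg (deg first_seg + 2) \<le> knot first_seg (dim first_seg + deg first_seg + 1)"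
    by (rule seg_basic(4)[OF first_valid]) (use seg_basic(3)[OF first_valid] in auto)
  then show "first_knot \<le> breakpoint T 1"
    using breakpoint_pred[of 1 T] by (simp add: first_knot_def first_seg_def right_end_def)
  show "breakpoint T 1 \<le> breakpoint T (length T)" by (rule breakpoint_mono[OF T]) (use length_pos[OF T] in auto)
qed

lemma first_in_span:
  assumes "0 \<le> t" "t < first_knot"
  shows "in_span first_seg (deg first_seg + 1) (t + left_end first_seg)"
  unfolding in_span_def[OF first_valid]
  using assms first_span[OF first_valid] last_span(1)[OF first_valid] by (simp add: first_knot_def)

lemma dim_nonper_ge: "3 \<le> dim_nonper T"
  using eta_lower[OF T, of "length T"] length_pos[OF T] by (simp add: dim_nonper_def)

lemma basis_nonper_germ:
  assumes "j \<in> {1..dim_nonper T}" "0 \<le> t" "t < first_knot"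
  shows "basis_nonper T j t = nonper_germ j t"
proof -
  have l: "1 \<le> (1::nat)" "1 \<le> length T" using length_pos[OF T] by auto
  have p: "t \<in> piece T 1" using assms first_knot_le by (auto simp: piece_def)
  have tl: "to_local T 1 t = t + left_end first_seg" by (simp add: to_local_def first_seg_def)
  show ?thesis
    unfolding basis_nonper_eq_spl[OF T assms(1)] spl_nonper_eq[OF T l p] tl nonper_germ_def first_seg_def[symmetric]
    by (subst seg_fun_eq_rat[OF first_valid first_in_span[OF assms(2,3)]]) (simp add: unit_coeff_def)
qed

lemma germ_denom:
  assumes "0 \<le> t" "t \<le> first_knot"
  shows "is_span (knot first_seg) (deg first_seg) (deg first_seg + 1)"
    "0 < denom first_seg (deg first_seg + 1) (t + left_end first_seg)"
  using seg_is_span[OF first_valid] denom_pos[OF first_valid] first_span[OF first_valid] last_span(1)[OF first_valid] assms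
  by (auto simp: first_knot_def)

lemma nonper_germ_derivative:
  assumes "0 \<le> t" "t \<le> first_knot"
  shows "(nonper_germ j has_real_derivative nonper_germ' j t) (at t)"
  unfolding nonper_germ_def[abs_def] nonper_germ'_def
  by (rule DERIV_shift[THEN iffD1], rule rat_has_derivative[OF first_valid]) (use germ_denom[OF assms] in auto)

lemma nonper_germ'_isCont:
  assumes "0 \<le> t" "t \<le> first_knot"
  shows "isCont (nonper_germ' j) t"
proof -
  have "isCont (rat' first_seg (deg first_seg + 1) (coeff_nonper T (unit_coeff j) 1)) (t + left_end first_seg)"
    by (rule rat'_isCont[OF first_valid]) (use germ_denom[OF assms] in auto)
  then show ?thesis unfolding nonper_germ'_def[abs_def]
    by (intro isCont_o2[where g = "rat' first_seg (deg first_seg + 1) (coeff_nonper T (unit_coeff j) 1)"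
          and f = "\<lambda>t. t + left_end first_seg"]) auto
qed

lemma coeff_nonper_12:
  "coeff_nonper T a 1 1 = a 1" "coeff_nonper T a 1 2 = a 2"
  using dim_ge_3[OF T, of 1] length_pos[OF T] by (auto simp: coeff_nonper_def numeral_2_eq_2)

lemma nonper_germ_0: "nonper_germ j 0 = (if j = 1 then 1 else 0)"
  using rat_left_end(1)[OF first_valid] by (simp add: nonper_germ_def coeff_nonper_12[simplified] unit_coeff_def)

text \<open>The end derivative is proportional to the difference of the first two coefficients. These are
  \<open>a 1\<close> and \<open>a 2\<close> because every segment has at least three NURBS.\<close>

lemma nonper_germ'_0:
  "nonper_germ' 2 0 > 0" "3 \<le> j \<Longrightarrow> nonper_germ' j 0 = 0"
proof -
  let ?K = "real (deg first_seg) / (knot first_seg (deg first_seg + 2) - left_end first_seg) * (wt first_seg 2 / wt first_seg 1)"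
  have e: "nonper_germ' j 0 = ?K * (unit_coeff j 2 - unit_coeff j 1)" for j
    unfolding nonper_germ'_def add_0 rat_left_end(2)[OF first_valid] coeff_nonper_12 ..
  have "0 < wt first_seg 1" "0 < wt first_seg 2"
    by (rule seg_basic(9)[OF first_valid]; use seg_basic(3)[OF first_valid] in linarith)+
  then have "0 < ?K" using seg_basic(1,7)[OF first_valid] by auto
  then show "nonper_germ' 2 0 > 0" by (simp add: e unit_coeff_def)
  show "3 \<le> j \<Longrightarrow> nonper_germ' j 0 = 0" by (simp add: e unit_coeff_def)
qed

lemma basis_nonper_at_0:
  assumes "j \<in> {1..dim_nonper T}"
  shows "basis_nonper T j 0 = (if j = 1 then 1 else 0)"
  using basis_nonper_germ[OF assms, of 0] first_knot_pos nonper_germ_0 by simp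

lemma junction_first:
  assumes "1 \<le> i" "i < length T"
  shows "junction T (\<lambda>r. unit_coeff 1 (r + 1)) i = 0"
  using assms eta_lower[OF T, of i] by (simp add: junction_def unit_coeff_def)

lemma coeff_first:
  assumes "1 \<le> l" "l \<le> length T" "1 \<le> j" "j \<le> dim (seg T l)"
  shows "coeff_nonper T (unit_coeff 1) l j = (if l = 1 \<and> j = 1 then 1 else 0)"
  using assms junction_first[of l] junction_first[of "l - 1"] dim_nonper_ge dim_ge_3[OF T assms(1,2)]
  by (auto simp: coeff_nonper_def unit_coeff_def)

lemma germ_first_less_1:
  assumes "0 < t" "t \<le> first_knot"
  shows "nonper_germ 1 t < 1"
proof -
  have l: "1 \<le> (1::nat)" "1 \<le> length T" using length_pos[OF T] by auto
  let ?p = "deg first_seg"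
  have "rat first_seg (?p + 1) (coeff_nonper T (unit_coeff 1) 1) y = rat first_seg (?p + 1) (\<lambda>j. if j = 1 then 1 else 0) y" for y
  proof -
    have "numer first_seg (?p + 1) (coeff_nonper T (unit_coeff 1) 1) y = numer first_seg (?p + 1) (\<lambda>j. if j = 1 then 1 else 0) y"
      unfolding numer_def
      by (rule level_cong[where \<mu> = "?p + 1"])
        (use coeff_first[OF l] last_span(1)[OF first_valid] in \<open>auto simp: first_seg_def\<close>)
    then show ?thesis by (simp add: rat_def)
  qed
  moreover have "rat first_seg (?p + 1) (\<lambda>j. if j = 1 then 1 else 0) (t + left_end first_seg) < 1"
    by (rule rat_first_less_1[OF first_valid]) (use assms first_span[OF first_valid] in \<open>auto simp: first_knot_def\<close>)
  ultimately show ?thesis by (simp add: nonper_germ_def)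
qed

lemma basis_nonper_first_eq_0:
  assumes "first_knot \<le> t" "t \<in> interval T"
  shows "basis_nonper T 1 t = 0 \<or> t = first_knot \<and> basis_nonper T 1 t = nonper_germ 1 t"
proof -
  have j: "1 \<in> {1..dim_nonper T}" using dim_nonper_ge by simp
  obtain l where l: "1 \<le> l" "l \<le> length T" "t \<in> piece T l" using piece_exists[OF T assms(2)] by blast
  note g = seg_valid[OF T l(1,2)]
  note tb = to_local_bounds[OF T l(1,3)]
  obtain \<mu> where \<mu>: "in_span (seg T l) \<mu> (to_local T l t)" using in_span_exists[OF g tb] by blast
  have e: "basis_nonper T 1 t = rat (seg T l) \<mu> (coeff_nonper T (unit_coeff 1) l) (to_local T l t)"
    unfolding basis_nonper_eq_spl[OF T j] spl_nonper_eq[OF T l] seg_fun_eq_rat[OF g \<mu>] unit_coeff_def ..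
  have mu: "deg (seg T l) + 1 \<le> \<mu>" "\<mu> \<le> dim (seg T l)" using \<mu> by (auto simp: in_span_def[OF g])
  show ?thesis
  proof (cases "l = 1 \<and> \<mu> = deg (seg T l) + 1")
    case True
    then have l1: "seg T l = first_seg" "\<mu> = deg first_seg + 1" by (auto simp: first_seg_def)
    have tl: "to_local T l t = t + left_end first_seg" using True by (simp add: to_local_def first_seg_def)
    have "t + left_end first_seg \<le> knot first_seg (deg first_seg + 2)"
      using in_span_bounds(2)[OF first_valid, of \<mu>] \<mu> unfolding l1 tl by simp
    then have "t = first_knot" using assms(1) by (simp add: first_knot_def)
    then show ?thesis using True e unfolding tl nonper_germ_def l1 by simp
  next
    case False
    have "numer (seg T l) \<mu> (coeff_nonper T (unit_coeff 1) l) y = deboor (knot (seg T l)) (deg (seg T l)) y (\<lambda>j. 0 * 0) \<mu>" for y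
      unfolding numer_def
    proof (rule level_cong[where \<mu> = \<mu>])
      fix j assume "\<mu> - (0 + deg (seg T l)) \<le> j" "j \<le> \<mu>"
      then show "wt (seg T l) j * coeff_nonper T (unit_coeff 1) l j = 0 * 0"
        using coeff_first[OF l(1,2), of j] mu False by auto
    qed (use mu in auto)
    then show ?thesis unfolding e rat_def level_scale by simp
  qed
qed

text \<open>This bounds the radius from below outside each neighbourhood of the collapsed edge, so that only
  points near that edge are mapped close to the pole.\<close>

lemma basis_nonper_first_bound:
  assumes "0 < t0" "t0 < first_knot"
  obtains \<epsilon> where "0 < \<epsilon>" "\<And>t. t \<in> interval T \<Longrightarrow> t0 \<le> t \<Longrightarrow> basis_nonper T 1 t \<le> 1 - \<epsilon>"
proof -
  have c: "continuous_on {t0..first_knot} (nonper_germ 1)"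
    by (intro continuous_at_imp_continuous_on ballI DERIV_isCont[OF nonper_germ_derivative]) (use assms in auto)
  have "compact {t0..first_knot}" "{t0..first_knot} \<noteq> {}" using assms by auto
  from continuous_attains_sup[OF this c] obtain tm where tm: "tm \<in> {t0..first_knot}"
    "\<And>t. t \<in> {t0..first_knot} \<Longrightarrow> nonper_germ 1 t \<le> nonper_germ 1 tm" by blast
  define \<epsilon> where "\<epsilon> = min 1 (1 - nonper_germ 1 tm)"
  show ?thesis
  proof (rule that[of \<epsilon>])
    show "0 < \<epsilon>" using germ_first_less_1[of tm] tm(1) assms by (auto simp: \<epsilon>_def)
    fix t assume t: "t \<in> interval T" "t0 \<le> t"
    have j: "1 \<in> {1..dim_nonper T}" using dim_nonper_ge by simp
    show "basis_nonper T 1 t \<le> 1 - \<epsilon>"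
    proof (cases "t < first_knot")
      case True
      then show ?thesis using basis_nonper_germ[OF j, of t] tm(2)[of t] t assms by (auto simp: \<epsilon>_def)
    next
      case False
      then show ?thesis using basis_nonper_first_eq_0[of t] tm(2)[of first_knot] t assms by (auto simp: \<epsilon>_def)
    qed
  qed
qed

end

section \<open>Polar coordinates along a star-shaped curve\<close>

text \<open>If the Jacobian vanishes at \<open>x\<close>, then the tangent there is radial, and by assumption the curve lies
  strictly on one side of it. Hence two parameters on different sides of \<open>x\<close> belong to the same ray,
  and by \<open>ray\<close> to the same point. But the radial component of the curve is strictly monotone near
  \<open>x\<close>.\<close>

lemma jacobian_nonzero:
  fixes X Y :: "real \<Rightarrow> real"
  assumes DX: "\<And>s. (X has_real_derivative X' s) (at s)" and DY: "\<And>s. (Y has_real_derivative Y' s) (at s)"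
    and cX: "\<And>s. isCont X' s" and cY: "\<And>s. isCont Y' s"
    and nz: "X x \<noteq> 0 \<or> Y x \<noteq> 0"
    and ray: "\<And>s s' \<kappa>. 0 < \<kappa> \<Longrightarrow> X s = \<kappa> * X s' \<Longrightarrow> Y s = \<kappa> * Y s' \<Longrightarrow> X s = X s' \<and> Y s = Y s'"
    and tangent: "\<And>c. X' x = c * X x \<Longrightarrow> Y' x = c * Y x \<Longrightarrow>
      eventually (\<lambda>z. 0 < c * (Y x * X z - X x * Y z)) (at x)"
  shows "X x * Y' x - Y x * X' x \<noteq> 0"
proof
  assume J: "X x * Y' x - Y x * X' x = 0"
  define N where "N = X x * X x + Y x * Y x"
  have N: "0 < N" using nz unfolding N_def sum_squares_gt_zero_iff .
  define c where "c = (X x * X' x + Y x * Y' x) / N"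
  have "X' x * N = (X x * X' x + Y x * Y' x) * X x" "Y' x * N = (X x * X' x + Y x * Y' x) * Y x"
    unfolding N_def using J by algebra+
  then have c: "X' x = c * X x" "Y' x = c * Y x" using N by (simp_all add: c_def field_simps)
  \<comment> \<open>The radial and the scaled tangential component with respect to the point at \<open>x\<close>. Their quotient \<open>q\<close> identifies the ray.\<close>
  define e where "e z = X x * X z + Y x * Y z" for z
  define e' where "e' z = X x * X' z + Y x * Y' z" for z
  define f where "f z = c * (Y x * X z - X x * Y z)" for z
  have De: "(e has_real_derivative e' z) (at z)" for z
    unfolding e_def[abs_def] e'_def by (intro DERIV_add DERIV_cmult DX DY)
  have Cf: "isCont f z" for z
    unfolding f_def[abs_def] by (intro continuous_intros DERIV_isCont[OF DX] DERIV_isCont[OF DY])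
  have ev: "eventually (\<lambda>z. 0 < f z) (at x)" unfolding f_def by (rule tangent[OF c])
  have "c \<noteq> 0"
  proof
    assume "c = 0"
    with ev have "eventually (\<lambda>z. False) (at x)" by (simp add: f_def)
    then show False by simp
  qed
  moreover have "e' x = c * N" unfolding e'_def N_def c by algebra
  moreover have "0 < c * c" using \<open>c \<noteq> 0\<close> not_real_square_gt_zero[of c] by blast
  ultimately have cc: "0 < c * e' x" using N by (simp add: mult.assoc[symmetric])
  have "isCont (\<lambda>z. c * e' z) x" unfolding e'_def by (intro continuous_intros cX cY)
  then have ev2: "eventually (\<lambda>z. 0 < c * e' z) (at x)"
    using cc unfolding isCont_def by (rule order_tendstoD(1))
  have "isCont e x" by (rule DERIV_isCont[OF De])
  moreover have "0 < e x" using N by (simp add: e_def N_def)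
  ultimately have ev3: "eventually (\<lambda>z. 0 < e z) (at x)" unfolding isCont_def by (rule order_tendstoD(1))
  have "eventually (\<lambda>z. 0 < f z \<and> 0 < c * e' z \<and> 0 < e z) (at x)"
    using ev ev2 ev3 by eventually_elim simp
  then obtain d where d: "0 < d" "\<And>z. z \<noteq> x \<Longrightarrow> dist z x < d \<Longrightarrow> 0 < f z \<and> 0 < c * e' z \<and> 0 < e z"
    unfolding eventually_at by auto
  define \<delta> where "\<delta> = d / 2"
  have \<delta>: "0 < \<delta>" using d by (simp add: \<delta>_def)
  have near: "0 < c * e' z" "0 < e z" if "\<bar>z - x\<bar> \<le> \<delta>" for z
    using that d(2)[of z] cc \<open>0 < e x\<close> d(1) by (cases "z = x"; auto simp: \<delta>_def dist_real_def)+
  have fpos: "0 < f z" if "z \<noteq> x" "\<bar>z - x\<bar> \<le> \<delta>" for z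
    using that d(2)[of z] d(1) by (auto simp: \<delta>_def dist_real_def)
  define q where "q z = f z / e z" for z
  have Cq: "continuous_on {x - \<delta>..x + \<delta>} q"
    unfolding q_def[abs_def]
  proof (intro continuous_at_imp_continuous_on ballI)
    fix z assume "z \<in> {x - \<delta>..x + \<delta>}"
    then have "e z \<noteq> 0" using near(2)[of z] by (auto simp: abs_le_iff)
    then show "isCont (\<lambda>z. f z / e z) z" by (intro continuous_intros Cf DERIV_isCont[OF De])
  qed
  have q0: "q x = 0" by (simp add: q_def f_def)
  define m where "m = min (q (x - \<delta>)) (q (x + \<delta>))"
  have m: "0 < m" using fpos[of "x - \<delta>"] fpos[of "x + \<delta>"] near(2)[of "x - \<delta>"] near(2)[of "x + \<delta>"] \<delta>
    by (auto simp: m_def q_def)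
  have C1: "continuous_on {x - \<delta>..x} q" and C2: "continuous_on {x..x + \<delta>} q"
    by (rule continuous_on_subset[OF Cq]; use \<delta> in auto)+
  obtain s1 where s1: "x - \<delta> \<le> s1" "s1 \<le> x" "q s1 = m"
    using IVT2'[of q x m "x - \<delta>"] C1 m q0 \<delta> by (auto simp: m_def)
  obtain s2 where s2: "x \<le> s2" "s2 \<le> x + \<delta>" "q s2 = m"
    using IVT'[of q x m "x + \<delta>"] C2 m q0 \<delta> by (auto simp: m_def)
  have "s1 < s2" using s1 s2 m q0 by (metis less_eq_real_def less_le_trans not_le order_less_irrefl)
  have e12: "0 < e s1" "0 < e s2" using near(2)[of s1] near(2)[of s2] s1 s2 \<delta> by (auto simp: abs_le_iff)
  define \<kappa> where "\<kappa> = e s1 / e s2"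
  have ee: "e s1 = \<kappa> * e s2" using e12 by (simp add: \<kappa>_def)
  have "f s1 = m * e s1" "f s2 = m * e s2" using s1(3) s2(3) e12 by (auto simp: q_def field_simps)
  then have "f s1 = \<kappa> * f s2" using ee by simp
  then have "c * ((Y x * X s1 - X x * Y s1) - \<kappa> * (Y x * X s2 - X x * Y s2)) = 0"
    by (simp add: f_def algebra_simps)
  then have ff: "Y x * X s1 - X x * Y s1 = \<kappa> * (Y x * X s2 - X x * Y s2)" using \<open>c \<noteq> 0\<close> by simp
  have "N * (X s1 - \<kappa> * X s2) = 0" "N * (Y s1 - \<kappa> * Y s2) = 0"
    using ee ff unfolding N_def e_def by algebra+
  then have "X s1 = \<kappa> * X s2" "Y s1 = \<kappa> * Y s2" using N by auto
  moreover have "0 < \<kappa>" using e12 by (simp add: \<kappa>_def)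
  ultimately have "X s1 = X s2" "Y s1 = Y s2" using ray by blast+
  then have "e s1 = e s2" by (simp add: e_def)
  moreover obtain y where y: "s1 < y" "y < s2" "e s2 - e s1 = (s2 - s1) * e' y"
    using MVT2[OF \<open>s1 < s2\<close>, of e e'] De by blast
  moreover have "e' y \<noteq> 0" using near(1)[of y] y s1 s2 by (auto simp: abs_le_iff)
  ultimately show False using \<open>s1 < s2\<close> by simp
qed

text \<open>Polar coordinates whose unit circle is replaced by the curve \<open>(X, Y)\<close>. The bounds and the lower
  bound of the Jacobian are uniform in \<open>s\<close>, since a neighbourhood of the pole involves all \<open>s\<close> at
  the same time.\<close>

locale polar_coords =
  fixes X Y X' Y' r r' :: "real \<Rightarrow> real" and \<tau> K J0 :: real
  assumes DX: "\<And>s. (X has_real_derivative X' s) (at s)"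
    and DY: "\<And>s. (Y has_real_derivative Y' s) (at s)"
    and cX: "\<And>s. isCont X' s" and cY: "\<And>s. isCont Y' s"
    and bd: "\<And>s. \<bar>X s\<bar> \<le> K" "\<And>s. \<bar>Y s\<bar> \<le> K" "\<And>s. \<bar>X' s\<bar> \<le> K" "\<And>s. \<bar>Y' s\<bar> \<le> K"
    and J0: "0 < J0" "\<And>s. J0 \<le> \<bar>X s * Y' s - Y s * X' s\<bar>"
    and Dr: "\<And>t. 0 < t \<Longrightarrow> t < \<tau> \<Longrightarrow> (r has_real_derivative r' t) (at t)"
    and cr: "\<And>t. 0 < t \<Longrightarrow> t < \<tau> \<Longrightarrow> isCont r' t"
    and rpos: "\<And>t. 0 < t \<Longrightarrow> t < \<tau> \<Longrightarrow> 0 < r t" "\<And>t. 0 < t \<Longrightarrow> t < \<tau> \<Longrightarrow> 0 < r' t"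
    and \<tau>: "0 < \<tau>"
begin

definition polar :: "real \<times> real \<Rightarrow> real \<times> real" where
  "polar = (\<lambda>(s, t). (r t * X s, r t * Y s))"

definition polar_deriv :: "real \<times> real \<Rightarrow> real \<times> real \<Rightarrow> real \<times> real" where
  "polar_deriv = (\<lambda>(s, t) (h, k). (r t * X' s * h + r' t * X s * k, r t * Y' s * h + r' t * Y s * k))"

lemma polar_deriv_linear: "bounded_linear (polar_deriv x)"
proof -
  have "linear (polar_deriv x)"
    by (rule linearI) (auto simp: polar_deriv_def algebra_simps split: prod.splits)
  then show ?thesis by (simp add: linear_conv_bounded_linear)
qed

lemma real_fst_derivative:
  assumes "(f has_real_derivative f') (at s)"
  shows "((\<lambda>x. f (fst x)) has_derivative (\<lambda>h. f' * fst h)) (at (s, t))"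
  using has_derivative_compose[OF has_derivative_fst[OF has_derivative_ident], of f "(*) f'" "(s, t)" UNIV] assms
  by (simp add: has_field_derivative_def)

lemma real_snd_derivative:
  assumes "(f has_real_derivative f') (at t)"
  shows "((\<lambda>x. f (snd x)) has_derivative (\<lambda>h. f' * snd h)) (at (s, t))"
  using has_derivative_compose[OF has_derivative_snd[OF has_derivative_ident], of f "(*) f'" "(s, t)" UNIV] assms
  by (simp add: has_field_derivative_def)

lemma polar_has_derivative:
  assumes "0 < t" "t < \<tau>"
  shows "(polar has_derivative polar_deriv (s, t)) (at (s, t))"
proof -
  have "((\<lambda>x. (r (snd x) * X (fst x), r (snd x) * Y (fst x))) has_derivative
     (\<lambda>h. (r (snd (s, t)) * (X' s * fst h) + r' t * snd h * X (fst (s, t)),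
           r (snd (s, t)) * (Y' s * fst h) + r' t * snd h * Y (fst (s, t))))) (at (s, t))"
    by (intro has_derivative_Pair has_derivative_mult real_snd_derivative real_fst_derivative DX DY Dr assms)
  moreover have "polar = (\<lambda>x. (r (snd x) * X (fst x), r (snd x) * Y (fst x)))"
    by (auto simp: polar_def)
  moreover have "polar_deriv (s, t) = (\<lambda>h. (r (snd (s, t)) * (X' s * fst h) + r' t * snd h * X (fst (s, t)),
           r (snd (s, t)) * (Y' s * fst h) + r' t * snd h * Y (fst (s, t))))"
    by (auto simp: polar_deriv_def algebra_simps)
  ultimately show ?thesis by simp
qed

definition strip :: "(real \<times> real) set" where "strip = UNIV \<times> {0<..<\<tau>}"

text \<open>The Jacobian determinant is \<open>r r' (X Y' - Y X')\<close> up to sign, so the inverse function theorem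
  applies.\<close>

lemma polar_local_inverse:
  assumes t0: "0 < t0" "t0 < \<tau>"
  obtains U V g g' where "open U" "U \<subseteq> strip" "(s0, t0) \<in> U" "open V" "polar (s0, t0) \<in> V" "homeomorphism U V polar g"
    "\<And>y. y \<in> V \<Longrightarrow> (g has_derivative g' y) (at y)"
proof -
  define f' where "f' x = Blinfun (polar_deriv x)" for x
  have f': "blinfun_apply (f' x) = polar_deriv x" for x
    unfolding f'_def by (rule bounded_linear_Blinfun_apply[OF polar_deriv_linear])
  have od: "open strip" unfolding strip_def by (intro open_Times) auto
  have cont: "continuous_on strip f'"
  proof (rule continuous_on_blinfun_componentwise)
    fix i :: "real \<times> real" assume "i \<in> Basis"
    have cc: "continuous_on strip (\<lambda>x. f (fst x))" if "\<And>s. isCont f s" for f :: "real \<Rightarrow> real"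
      using that by (intro continuous_at_imp_continuous_on ballI isCont_o2[where f = fst and g = f] isCont_fst) auto
    have cr': "continuous_on strip (\<lambda>x. f (snd x))" if "\<And>t. 0 < t \<Longrightarrow> t < \<tau> \<Longrightarrow> isCont f t" for f :: "real \<Rightarrow> real"
      using that by (intro continuous_at_imp_continuous_on ballI isCont_o2[where f = snd and g = f] isCont_snd) (auto simp: strip_def)
    have "continuous_on strip (\<lambda>x. polar_deriv x i)"
      unfolding polar_deriv_def split_def
      by (intro continuous_intros cc cX cY DERIV_isCont[OF DX] DERIV_isCont[OF DY] cr' cr DERIV_isCont[OF Dr])
    then show "continuous_on strip (\<lambda>x. blinfun_apply (f' x) i)" by (simp add: f')
  qed
  let ?J = "X s0 * Y' s0 - Y s0 * X' s0"
  have J: "?J \<noteq> 0" using J0(1) J0(2)[of s0] by auto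
  have rp: "r t0 \<noteq> 0" "r' t0 \<noteq> 0" using rpos[OF t0] by auto
  \<comment> \<open>the inverse of the Jacobian matrix, by Cramer's rule\<close>
  define iv where "iv = (\<lambda>(a, b). ((X s0 * b - Y s0 * a) / (r t0 * ?J), (Y' s0 * a - X' s0 * b) / (r' t0 * ?J)))"
  have biv: "bounded_linear iv"
  proof -
    have "linear iv" by (rule linearI) (auto simp: iv_def add_divide_distrib diff_divide_distrib algebra_simps split: prod.splits)
    then show ?thesis by (simp add: linear_conv_bounded_linear)
  qed
  have inv: "Blinfun iv o\<^sub>L f' (s0, t0) = id_blinfun"
  proof (rule blinfun_eqI)
    fix h :: "real \<times> real"
    obtain a b where h: "h = (a, b)" by (cases h)
    have 1: "X s0 * (r t0 * Y' s0 * a + r' t0 * Y s0 * b) - Y s0 * (r t0 * X' s0 * a + r' t0 * X s0 * b) = a * (r t0 * ?J)"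
      by algebra
    have 2: "Y' s0 * (r t0 * X' s0 * a + r' t0 * X s0 * b) - X' s0 * (r t0 * Y' s0 * a + r' t0 * Y s0 * b) = b * (r' t0 * ?J)"
      by algebra
    have "iv (polar_deriv (s0, t0) (a, b)) = (a, b)"
      unfolding polar_deriv_def iv_def prod.case 1 2 using J rp by simp
    then show "blinfun_apply (Blinfun iv o\<^sub>L f' (s0, t0)) h = blinfun_apply id_blinfun h"
      by (simp add: f' h bounded_linear_Blinfun_apply[OF biv])
  qed
  have x0: "(s0, t0) \<in> strip" using t0 by (simp add: strip_def)
  have der: "(polar has_derivative blinfun_apply (f' x)) (at x)" if "x \<in> strip" for x
    using that polar_has_derivative by (auto simp: f' strip_def)
  show ?thesis
    by (rule inverse_function_theorem[OF od der cont x0 inv]) (assumption, rule that, assumption+)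
qed

text \<open>The chain rule gives \<open>G\<^sub>s / r = X' p + Y' q\<close> and \<open>G\<^sub>t / r' = X p + Y q\<close> for the gradient \<open>(p, q)\<close>.
  Cramer's rule bounds its solution. The partial derivatives of \<open>G\<close> have to be small compared with
  \<open>r\<close> and \<open>r'\<close>, respectively.\<close>

lemma polar_gradient:
  fixes g :: "real \<times> real \<Rightarrow> real"
  assumes t0: "0 < t0" "t0 < \<tau>"
    and G: "\<And>s t. 0 < t \<Longrightarrow> t < \<tau> \<Longrightarrow> g (polar (s, t)) = G (s, t)"
    and DG0: "(G has_derivative (\<lambda>(h, k). Gs * h + Gt * k)) (at (s0, t0))"
    and uv: "polar (s0, t0) = (u, v)"
    and bdG: "\<bar>Gs\<bar> \<le> M * r t0" "\<bar>Gt\<bar> \<le> M * r' t0"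
  obtains p q where "((\<lambda>u'. g (u', v)) has_real_derivative p) (at u)"
    "((\<lambda>v'. g (u, v')) has_real_derivative q) (at v)"
    "\<bar>p\<bar> \<le> 2 * K * M / J0" "\<bar>q\<bar> \<le> 2 * K * M / J0"
proof -
  obtain U V k k' where I: "open U" "U \<subseteq> strip" "(s0, t0) \<in> U" "open V" "polar (s0, t0) \<in> V" "homeomorphism U V polar k"
    "\<And>y. y \<in> V \<Longrightarrow> (k has_derivative k' y) (at y)"
    using polar_local_inverse[OF t0] by metis
  have eq: "g y = G (k y)" if "y \<in> V" for y
  proof -
    have k: "k y \<in> U" "polar (k y) = y" using I(6) that by (auto simp: homeomorphism_def)
    then have "k y \<in> strip" using I(2) by auto
    then show ?thesis using G[of "snd (k y)" "fst (k y)"] k by (auto simp: strip_def)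
  qed
  have k0: "k (u, v) = (s0, t0)" using I(3,6) uv by (metis homeomorphism_def)
  have uvV: "(u, v) \<in> V" using I(5) uv by simp
  have "(G \<circ> k has_derivative (\<lambda>(h, k). Gs * h + Gt * k) \<circ> k' (u, v)) (at (u, v))"
    by (rule diff_chain_at[OF I(7)[OF uvV]]) (use DG0 k0 in simp)
  then have "(g has_derivative (\<lambda>(h, k). Gs * h + Gt * k) \<circ> k' (u, v)) (at (u, v))"
    by (rule has_derivative_transform_within_open[OF _ I(4) uvV]) (use eq in simp)
  then obtain D where D: "(g has_derivative D) (at (u, v))" by blast
  have linD: "linear D" using D has_derivative_linear by blast
  define p where "p = D (1, 0)"
  define q where "q = D (0, 1)"
  have Dpq: "D (a, b) = a * p + b * q" for a b
  proof -
    have "D (a, b) = D (a *\<^sub>R (1, 0) + b *\<^sub>R (0, 1))" by simp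
    also have "\<dots> = a *\<^sub>R p + b *\<^sub>R q"
      unfolding p_def q_def linear_add[OF linD] linear_scale[OF linD] ..
    finally show ?thesis by simp
  qed
  have 1: "((\<lambda>u'. g (u', v)) has_real_derivative p) (at u)"
  proof -
    have "((\<lambda>u'. (u', v)) has_derivative (\<lambda>h. (h, 0))) (at u)"
      by (intro has_derivative_Pair has_derivative_ident has_derivative_const)
    from diff_chain_at[OF this D] have "(g \<circ> (\<lambda>u'. (u', v)) has_derivative (\<lambda>h. p * h)) (at u)"
      by (simp add: comp_def Dpq mult.commute)
    then show ?thesis by (simp add: has_field_derivative_def comp_def)
  qed
  have 2: "((\<lambda>v'. g (u, v')) has_real_derivative q) (at v)"
  proof -
    have "((\<lambda>v'. (u, v')) has_derivative (\<lambda>h. (0, h))) (at v)"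
      by (intro has_derivative_Pair has_derivative_ident has_derivative_const)
    from diff_chain_at[OF this D] have "(g \<circ> (\<lambda>v'. (u, v')) has_derivative (\<lambda>h. q * h)) (at v)"
      by (simp add: comp_def Dpq mult.commute)
    then show ?thesis by (simp add: has_field_derivative_def comp_def)
  qed
  have x0: "(s0, t0) \<in> strip" using t0 by (simp add: strip_def)
  have "(g \<circ> polar has_derivative D \<circ> polar_deriv (s0, t0)) (at (s0, t0))"
    by (rule diff_chain_at[OF polar_has_derivative[OF t0]]) (use D uv in simp)
  then have "(G has_derivative D \<circ> polar_deriv (s0, t0)) (at (s0, t0))"
    by (rule has_derivative_transform_within_open[where s = strip])
      (use x0 G in \<open>auto simp: strip_def intro: open_Times\<close>)
  from has_derivative_unique[OF this DG0]
  have E: "D (polar_deriv (s0, t0) (a, b)) = Gs * a + Gt * b" for a b by (metis comp_apply prod.case)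
  have Es: "r t0 * X' s0 * p + r t0 * Y' s0 * q = Gs" using E[of 1 0] by (simp add: polar_deriv_def Dpq)
  have Et: "r' t0 * X s0 * p + r' t0 * Y s0 * q = Gt" using E[of 0 1] by (simp add: polar_deriv_def Dpq)
  let ?J = "X s0 * Y' s0 - Y s0 * X' s0"
  define A where "A = Gs / r t0"
  define B where "B = Gt / r' t0"
  have A: "A = X' s0 * p + Y' s0 * q" and B: "B = X s0 * p + Y s0 * q"
    unfolding A_def B_def Es[symmetric] Et[symmetric] using rpos[OF t0] by (simp_all add: field_simps)
  have bA: "\<bar>A\<bar> \<le> M" "\<bar>B\<bar> \<le> M"
    using bdG rpos[OF t0] by (simp_all add: A_def B_def abs_divide pos_divide_le_eq)
  have M: "0 \<le> M" using bA by linarith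
  have K: "0 \<le> K" using bd(1)[of 0] by linarith
  have pJ: "p * ?J = B * Y' s0 - A * Y s0" "q * ?J = A * X s0 - B * X' s0" unfolding A B by algebra+
  have bound: "\<bar>z\<bar> \<le> 2 * K * M / J0" if "z * ?J = a * b - c * d" "\<bar>a\<bar> \<le> M" "\<bar>c\<bar> \<le> M" "\<bar>b\<bar> \<le> K" "\<bar>d\<bar> \<le> K" for z a b c d
  proof -
    have "\<bar>z\<bar> * J0 \<le> \<bar>z\<bar> * \<bar>?J\<bar>" using J0(2)[of s0] by (intro mult_left_mono) auto
    also have "\<dots> = \<bar>a * b - c * d\<bar>" using that(1) by (simp add: abs_mult[symmetric])
    also have "\<dots> \<le> \<bar>a\<bar> * \<bar>b\<bar> + \<bar>c\<bar> * \<bar>d\<bar>" by (simp add: abs_mult[symmetric])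
    also have "\<dots> \<le> M * K + M * K" using that M K by (intro add_mono mult_mono) auto
    finally show ?thesis using J0(1) by (simp add: pos_le_divide_eq mult_ac)
  qed
  show ?thesis
    by (rule that[OF 1 2]) (rule bound[OF pJ(1)], use bA bd in auto, rule bound[OF pJ(2)], use bA bd in auto)
qed

text \<open>Up to an affine function, whose gradient is constant, \<open>g\<close> is a sum of terms that together with their
  \<open>t\<close>-derivatives are small compared with \<open>r\<close> and \<open>r'\<close>. So the rest has a gradient that tends to 0.
  The assumption \<open>near\<close> says that points near the pole have small radial parameters.\<close>

lemma C1_at_pole:
  fixes g :: "real \<times> real \<Rightarrow> real" and Q Q' b b' :: "nat \<Rightarrow> real \<Rightarrow> real" and K' :: "nat \<Rightarrow> real"
  assumes DQ: "\<And>j s. j \<in> A \<Longrightarrow> (Q j has_real_derivative Q' j s) (at s)"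
    and bQ: "\<And>j s. j \<in> A \<Longrightarrow> \<bar>Q j s\<bar> \<le> K' j" "\<And>j s. j \<in> A \<Longrightarrow> \<bar>Q' j s\<bar> \<le> K' j"
    and Db: "\<And>j t. j \<in> A \<Longrightarrow> 0 < t \<Longrightarrow> t < \<tau> \<Longrightarrow> (b j has_real_derivative b' j t) (at t)"
    and lim: "\<And>j. j \<in> A \<Longrightarrow> (b j \<longlongrightarrow> 0) (at_right 0)"
      "\<And>j. j \<in> A \<Longrightarrow> ((\<lambda>t. b j t / r t) \<longlongrightarrow> 0) (at_right 0)"
      "\<And>j. j \<in> A \<Longrightarrow> ((\<lambda>t. b' j t / r' t) \<longlongrightarrow> 0) (at_right 0)"
    and G: "\<And>s t. 0 < t \<Longrightarrow> t < \<tau> \<Longrightarrow> g (polar (s, t)) =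
      c + lx * fst (polar (s, t)) + ly * snd (polar (s, t)) + (\<Sum>j\<in>A. Q j s * b j t)"
    and near: "\<And>\<epsilon>. 0 < \<epsilon> \<Longrightarrow>
      eventually (\<lambda>x. \<exists>s t. 0 < t \<and> t < \<epsilon> \<and> t < \<tau> \<and> x = polar (s, t)) (at (0, 0) within D)"
  shows "C1_smooth_at_polar_point D g"
proof -
  define g0 where "g0 x = g x - (c + lx * fst x + ly * snd x)" for x
  define \<omega> where "\<omega> t = (\<Sum>j\<in>A. K' j * (\<bar>b j t\<bar> + \<bar>b j t / r t\<bar> + \<bar>b' j t / r' t\<bar>))" for t
  define C where "C = 2 * K / J0"
  have K: "0 \<le> K" using bd(1)[of 0] by linarith
  have C: "0 \<le> C" using K J0(1) by (simp add: C_def)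
  have K': "0 \<le> K' j" if "j \<in> A" for j using bQ(1)[OF that, of 0] by linarith
  have \<omega>lim: "(\<omega> \<longlongrightarrow> 0) (at_right 0)"
  proof -
    have "((\<lambda>t. \<Sum>j\<in>A. K' j * (\<bar>b j t\<bar> + \<bar>b j t / r t\<bar> + \<bar>b' j t / r' t\<bar>)) \<longlongrightarrow> (\<Sum>j\<in>A. K' j * (\<bar>0\<bar> + \<bar>0\<bar> + \<bar>0\<bar>))) (at_right 0)"
      by (intro tendsto_sum tendsto_mult tendsto_const tendsto_add tendsto_rabs lim)
    then show ?thesis by (simp add: \<omega>_def[abs_def])
  qed
  have key: "\<exists>p q. ((\<lambda>u'. g (u', v)) has_real_derivative p) (at u) \<and> ((\<lambda>v'. g (u, v')) has_real_derivative q) (at v)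
      \<and> \<bar>p - lx\<bar> \<le> C * \<omega> t \<and> \<bar>q - ly\<bar> \<le> C * \<omega> t \<and> \<bar>g0 (u, v)\<bar> \<le> \<omega> t"
    if t: "0 < t" "t < \<tau>" and uv: "polar (s, t) = (u, v)" for s t u v
  proof -
    note rp = rpos[OF t]
    define Gf where "Gf x = (\<Sum>j\<in>A. Q j (fst x) * b j (snd x))" for x
    define Gs where "Gs = (\<Sum>j\<in>A. Q' j s * b j t)"
    define Gt where "Gt = (\<Sum>j\<in>A. Q j s * b' j t)"
    have G0: "g0 (polar (s, t)) = Gf (s, t)" if "0 < t" "t < \<tau>" for s t
      using G[OF that, of s] by (simp add: g0_def Gf_def)
    have "(Gf has_derivative (\<lambda>h. \<Sum>j\<in>A. Q j (fst (s, t)) * (b' j t * snd h) + Q' j s * fst h * b j (snd (s, t)))) (at (s, t))"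
      unfolding Gf_def[abs_def]
      by (intro has_derivative_sum has_derivative_mult real_fst_derivative real_snd_derivative DQ Db t)
    moreover have "(\<lambda>h. \<Sum>j\<in>A. Q j (fst (s, t)) * (b' j t * snd h) + Q' j s * fst h * b j (snd (s, t))) = (\<lambda>(h, k). Gs * h + Gt * k)"
      by (auto simp: Gs_def Gt_def sum_distrib_left sum.distrib mult_ac add_ac intro!: ext)
    ultimately have DG: "(Gf has_derivative (\<lambda>(h, k). Gs * h + Gt * k)) (at (s, t))" by simp
    have est: "\<bar>\<Sum>j\<in>A. F j * B j\<bar> \<le> \<omega> t * w"
      if "\<And>j. j \<in> A \<Longrightarrow> \<bar>F j\<bar> \<le> K' j" "\<And>j. j \<in> A \<Longrightarrow> \<bar>B j\<bar> \<le> (\<bar>b j t\<bar> + \<bar>b j t / r t\<bar> + \<bar>b' j t / r' t\<bar>) * w" for F B w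
    proof -
      have "\<bar>\<Sum>j\<in>A. F j * B j\<bar> \<le> (\<Sum>j\<in>A. \<bar>F j * B j\<bar>)" by (rule sum_abs)
      also have "\<dots> \<le> (\<Sum>j\<in>A. K' j * (\<bar>b j t\<bar> + \<bar>b j t / r t\<bar> + \<bar>b' j t / r' t\<bar>) * w)"
      proof (rule sum_mono)
        fix j assume j: "j \<in> A"
        have "\<bar>F j * B j\<bar> \<le> K' j * ((\<bar>b j t\<bar> + \<bar>b j t / r t\<bar> + \<bar>b' j t / r' t\<bar>) * w)"
          unfolding abs_mult by (intro mult_mono that j K') auto
        then show "\<bar>F j * B j\<bar> \<le> K' j * (\<bar>b j t\<bar> + \<bar>b j t / r t\<bar> + \<bar>b' j t / r' t\<bar>) * w"
          by (simp add: mult.assoc)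
      qed
      also have "\<dots> = \<omega> t * w" by (simp add: \<omega>_def sum_distrib_right)
      finally show ?thesis .
    qed
    have bs: "\<bar>Gs\<bar> \<le> \<omega> t * r t"
      unfolding Gs_def by (rule est[OF bQ(2)]) (use rp in \<open>auto simp: abs_divide field_simps\<close>)
    have bt: "\<bar>Gt\<bar> \<le> \<omega> t * r' t"
      unfolding Gt_def by (rule est[OF bQ(1)]) (use rp in \<open>auto simp: abs_divide field_simps\<close>)
    have b0: "\<bar>g0 (u, v)\<bar> \<le> \<omega> t"
    proof -
      have "\<bar>\<Sum>j\<in>A. Q j s * b j t\<bar> \<le> \<omega> t * 1" by (rule est[OF bQ(1)]) auto
      then show ?thesis using G0[OF t, of s] uv by (simp add: Gf_def)
    qed
    obtain p q where pq: "((\<lambda>u'. g0 (u', v)) has_real_derivative p) (at u)"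
      "((\<lambda>v'. g0 (u, v')) has_real_derivative q) (at v)"
      "\<bar>p\<bar> \<le> 2 * K * \<omega> t / J0" "\<bar>q\<bar> \<le> 2 * K * \<omega> t / J0"
      by (rule polar_gradient[where g = g0, OF t G0 DG uv bs bt])
    have gg: "g x = g0 x + (c + lx * fst x + ly * snd x)" for x by (simp add: g0_def)
    have "((\<lambda>u'. g0 (u', v) + (c + lx * u' + ly * v)) has_real_derivative p + lx) (at u)"
      by (rule DERIV_add[OF pq(1)]) (auto intro!: derivative_eq_intros)
    moreover have "((\<lambda>v'. g0 (u, v') + (c + lx * u + ly * v')) has_real_derivative q + ly) (at v)"
      by (rule DERIV_add[OF pq(2)]) (auto intro!: derivative_eq_intros)
    ultimately show ?thesis using pq(3,4) b0
      by (intro exI[of _ "p + lx"] exI[of _ "q + ly"]) (simp add: gg C_def)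
  qed
  define gu where "gu x = deriv (\<lambda>u'. g (u', snd x)) (fst x)" for x
  define gv where "gv x = deriv (\<lambda>v'. g (fst x, v')) (snd x)" for x
  have key': "((\<lambda>u'. g (u', v)) has_real_derivative gu (u, v)) (at u) \<and> ((\<lambda>v'. g (u, v')) has_real_derivative gv (u, v)) (at v)
      \<and> \<bar>gu (u, v) - lx\<bar> \<le> C * \<omega> t \<and> \<bar>gv (u, v) - ly\<bar> \<le> C * \<omega> t \<and> \<bar>g0 (u, v)\<bar> \<le> \<omega> t"
    if t: "0 < t" "t < \<tau>" and uv: "polar (s, t) = (u, v)" for s t u v
  proof -
    obtain p q where pq: "((\<lambda>u'. g (u', v)) has_real_derivative p) (at u)" "((\<lambda>v'. g (u, v')) has_real_derivative q) (at v)"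
      "\<bar>p - lx\<bar> \<le> C * \<omega> t" "\<bar>q - ly\<bar> \<le> C * \<omega> t" "\<bar>g0 (u, v)\<bar> \<le> \<omega> t"
      using key[OF t uv] by blast
    moreover have "gu (u, v) = p" "gv (u, v) = q"
      using DERIV_imp_deriv[OF pq(1)] DERIV_imp_deriv[OF pq(2)] by (simp_all add: gu_def gv_def)
    ultimately show ?thesis by simp
  qed
  have \<omega>0: "0 \<le> \<omega> t" if "0 < t" "t < \<tau>" for t
    unfolding \<omega>_def by (intro sum_nonneg mult_nonneg_nonneg K') auto
  have weak: "C * \<omega> t \<le> (1 + C) * \<omega> t" "\<omega> t \<le> (1 + C) * \<omega> t" if "0 < t" "t < \<tau>" for t
    using \<omega>0[OF that] C by (auto simp: algebra_simps)
  have close: "(h \<longlongrightarrow> a) (at (0, 0) within D)"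
    if h: "\<And>s t. 0 < t \<Longrightarrow> t < \<tau> \<Longrightarrow> \<bar>h (polar (s, t)) - a\<bar> \<le> (1 + C) * \<omega> t" for h :: "real \<times> real \<Rightarrow> real" and a
  proof (rule tendstoI)
    fix e :: real assume e: "0 < e"
    have "0 < e / (1 + C)" using e C by simp
    with \<omega>lim have "eventually (\<lambda>t. \<omega> t < e / (1 + C)) (at_right 0)" by (rule order_tendstoD(2))
    then obtain \<epsilon> where \<epsilon>: "0 < \<epsilon>" "\<And>t. 0 < t \<Longrightarrow> t < \<epsilon> \<Longrightarrow> \<omega> t < e / (1 + C)"
      unfolding eventually_at_right_field by auto
    show "eventually (\<lambda>x. dist (h x) a < e) (at (0, 0) within D)" using near[OF \<epsilon>(1)]
    proof eventually_elim
      case (elim x)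
      then obtain s t where st: "0 < t" "t < \<epsilon>" "t < \<tau>" "x = polar (s, t)" by blast
      have "\<bar>h x - a\<bar> \<le> (1 + C) * \<omega> t" using h[OF st(1,3)] st(4) by simp
      also have "\<dots> < (1 + C) * (e / (1 + C))" using \<epsilon>(2)[OF st(1,2)] C by (intro mult_strict_left_mono) auto
      finally show ?case using C by (simp add: dist_real_def)
    qed
  qed
  have est: "\<bar>gu (polar (s, t)) - lx\<bar> \<le> (1 + C) * \<omega> t" "\<bar>gv (polar (s, t)) - ly\<bar> \<le> (1 + C) * \<omega> t"
    "\<bar>g0 (polar (s, t)) - 0\<bar> \<le> (1 + C) * \<omega> t" if t: "0 < t" "t < \<tau>" for s t
    using key'[OF t, of s] weak[OF t] by (cases "polar (s, t)"; force)+
  note Lu = close[of gu lx, OF est(1)] and Lv = close[of gv ly, OF est(2)] and L0 = close[of g0 0, OF est(3)]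
  have Lg: "(g \<longlongrightarrow> c) (at (0, 0) within D)"
  proof -
    have "((\<lambda>x. g0 x + (c + lx * fst x + ly * snd x)) \<longlongrightarrow> 0 + (c + lx * fst (0::real, 0::real) + ly * snd (0::real, 0::real))) (at (0, 0) within D)"
      by (intro tendsto_intros L0)
    then show ?thesis by (simp add: g0_def)
  qed
  show ?thesis unfolding C1_smooth_at_polar_point_def
  proof (intro exI conjI)
    show "\<forall>\<^sub>F (u, v) in at (0, 0) within D.
           ((\<lambda>u'. g (u', v)) has_real_derivative gu (u, v)) (at u) \<and>
           ((\<lambda>v'. g (u, v')) has_real_derivative gv (u, v)) (at v)"
      using near[OF zero_less_one]
    proof eventually_elim
      case (elim x)
      then obtain s t where st: "0 < t" "t < \<tau>" "x = polar (s, t)" by blast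
      then show ?case using key'[OF st(1,2), of s] by (cases x) auto
    qed
    show "((\<lambda>x. (g x, gu x, gv x)) \<longlongrightarrow> (c, lx, ly)) (at (0, 0) within D)"
      by (intro tendsto_Pair Lg Lu Lv)
  qed
qed

end

section \<open>Tensor-product functions under the polar map\<close>

lemma periodic_attains:
  fixes f :: "real \<Rightarrow> real"
  assumes "\<And>x. isCont f x" "\<And>x k. f (x + real_of_int k * p) = f x" "0 < p"
  shows "\<exists>K. \<forall>x. \<bar>f x\<bar> \<le> K" "(\<And>x. f x \<noteq> 0) \<Longrightarrow> \<exists>J>0. \<forall>x. J \<le> \<bar>f x\<bar>"
proof -
  have c: "continuous_on {0..p} (\<lambda>x. \<bar>f x\<bar>)"
    by (intro continuous_at_imp_continuous_on ballI continuous_rabs assms(1))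
  have ne: "{0..p} \<noteq> {}" using assms(3) by simp
  have red: "\<exists>y\<in>{0..p}. f x = f y" for x
  proof -
    obtain k where k: "real_of_int k \<le> x / p" "x / p < real_of_int k + 1"
      by (metis floor_correct of_int_add of_int_1)
    have "real_of_int k * p \<le> x" "x < (real_of_int k + 1) * p"
      using k assms(3) by (simp_all add: pos_le_divide_eq pos_divide_less_eq)
    then have "x - real_of_int k * p \<in> {0..p}" by (auto simp: algebra_simps)
    moreover have "f x = f (x - real_of_int k * p)" using assms(2)[of "x - real_of_int k * p" k] by simp
    ultimately show ?thesis by blast
  qed
  obtain y where "y \<in> {0..p}" "\<And>x. x \<in> {0..p} \<Longrightarrow> \<bar>f x\<bar> \<le> \<bar>f y\<bar>"
    using continuous_attains_sup[OF compact_Icc ne c] by blast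
  then show "\<exists>K. \<forall>x. \<bar>f x\<bar> \<le> K" using red by metis
  obtain y where y: "y \<in> {0..p}" "\<And>x. x \<in> {0..p} \<Longrightarrow> \<bar>f y\<bar> \<le> \<bar>f x\<bar>"
    using continuous_attains_inf[OF compact_Icc ne c] by blast
  show "\<exists>J>0. \<forall>x. J \<le> \<bar>f x\<bar>" if "\<And>x. f x \<noteq> 0"
  proof (intro exI[of _ "\<bar>f y\<bar>"] conjI allI)
    show "0 < \<bar>f y\<bar>" using that[of y] by simp
    show "\<bar>f y\<bar> \<le> \<bar>f x\<bar>" for x using red[of x] y(2) by metis
  qed
qed

lemma spl_per_cong: "(\<And>i. 1 \<le> i \<Longrightarrow> i \<le> dim_per S \<Longrightarrow> a i = b i) \<Longrightarrow> spl_per S a x = spl_per S b x"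
  by (simp add: spl_per_def)

lemma spl_per_add: "spl_per S (\<lambda>i. a i + b i) x = spl_per S a x + spl_per S b x"
  by (simp add: spl_per_def sum.distrib algebra_simps)

lemma spl_per_scale: "spl_per S (\<lambda>i. m * a i) x = m * spl_per S a x"
  by (simp add: spl_per_def sum_distrib_left mult.assoc)

lemma pos_cases:
  assumes "1 \<le> i" "i \<le> dim_per S" "1 \<le> j"
  shows "pos S i j \<le> 2 * dim_per S \<longleftrightarrow> j \<le> 2" "pos S i 1 = i" "pos S i 2 = i + dim_per S"
    "3 \<le> j \<Longrightarrow> pos S i j = 2 * dim_per S + (i + (j - 3) * dim_per S)"
proof -
  show *: "3 \<le> j \<Longrightarrow> pos S i j = 2 * dim_per S + (i + (j - 3) * dim_per S)"
  proof -
    assume "3 \<le> j"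
    then obtain q where "j = q + 3" by (metis le_Suc_ex add.commute)
    then show ?thesis by (simp add: pos_def algebra_simps)
  qed
  show 1: "pos S i 1 = i" and 2: "pos S i 2 = i + dim_per S" by (simp_all add: pos_def)
  consider "j = 1" | "j = 2" | "3 \<le> j" using assms by linarith
  then show "pos S i j \<le> 2 * dim_per S \<longleftrightarrow> j \<le> 2"
    by cases (use * 1 2 assms in auto)
qed

lemma E_bar_affine:
  obtains lx ly where "\<And>i. 1 \<le> i \<Longrightarrow> E_bar S l (i + dim_per S) = 1/3 + lx * cos (theta S i) + ly * sin (theta S i)"
proof -
  consider "l = 1" | "l = 2" | "l \<noteq> 1" "l \<noteq> 2" by blast
  then show ?thesis
  proof cases
    case 1 then show ?thesis by (intro that[of "1/3" 0]) (simp add: E_bar_def Let_def)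
  next
    case 2 then show ?thesis by (intro that[of "-1/6" "sqrt 3 / 6"]) (simp add: E_bar_def Let_def)
  next
    case 3 then show ?thesis by (intro that[of "-1/6" "-(sqrt 3 / 6)"]) (simp add: E_bar_def Let_def)
  qed
qed

text \<open>The reason for the entries of the extraction matrix: on the first two rings of functions each row
  is an affine function of the control points of the polar map.\<close>

lemma E_mat_affine:
  assumes "1 \<le> l"
  obtains c lx ly where "\<And>i. 1 \<le> i \<Longrightarrow> i \<le> dim_per S \<Longrightarrow> E_mat S l (pos S i 1) = c"
    "\<And>i. 1 \<le> i \<Longrightarrow> i \<le> dim_per S \<Longrightarrow> E_mat S l (pos S i 2) = c + lx * cos (theta S i) + ly * sin (theta S i)"
proof (cases "l \<le> 3")
  case True
  obtain lx ly where e: "\<And>i. 1 \<le> i \<Longrightarrow> E_bar S l (i + dim_per S) = 1/3 + lx * cos (theta S i) + ly * sin (theta S i)"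
    using E_bar_affine[of S l] by blast
  show ?thesis
  proof (rule that[of "1/3" lx ly])
    fix i assume i: "1 \<le> i" "i \<le> dim_per S"
    show "E_mat S l (pos S i 1) = 1/3" using True i by (simp add: E_mat_def pos_def E_bar_def)
    show "E_mat S l (pos S i 2) = 1/3 + lx * cos (theta S i) + ly * sin (theta S i)"
      using True i e[of i] by (simp add: E_mat_def pos_def)
  qed
next
  case False
  then show ?thesis by (intro that[of 0 0 0]) (auto simp: E_mat_def pos_def)
qed

lemma E_mat_nonneg: "0 \<le> E_mat S l q"
proof -
  have s3: "sqrt 3 / 2 * sqrt 3 / 2 = 3 / (4::real)" by simp
  have "0 \<le> 1 + (a * cos x + b * sin x)" if "a * a + b * b = 1" for a b x :: real
  proof -
    have "(a * cos x + b * sin x)\<^sup>2 \<le> (a * cos x + b * sin x)\<^sup>2 + (a * sin x - b * cos x)\<^sup>2" by simp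
    also have "\<dots> = (a * a + b * b) * ((sin x)\<^sup>2 + (cos x)\<^sup>2)" by algebra
    also have "\<dots> = 1" using that by simp
    finally have "\<bar>a * cos x + b * sin x\<bar> \<le> 1" by (simp add: abs_square_le_1)
    then show ?thesis by linarith
  qed
  note * = this
  have "0 \<le> E_bar S l q" for l
  proof -
    let ?x = "theta S (q - dim_per S)"
    have "0 \<le> 1 + (1 * cos ?x + 0 * sin ?x)" "0 \<le> 1 + ((-1/2) * cos ?x + (sqrt 3 / 2) * sin ?x)"
      "0 \<le> 1 + ((-1/2) * cos ?x + (- (sqrt 3 / 2)) * sin ?x)"
      by (rule *; simp)+
    then show ?thesis unfolding E_bar_def Let_def by auto
  qed
  then show ?thesis by (simp add: E_mat_def)
qed

lemma E_mat_column_sum: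
  assumes "1 \<le> q" "q \<le> dim_per S * dim_nonper T" "2 \<le> dim_nonper T"
  shows "(\<Sum>l=1..dim_pol S T. E_mat S l q) = 1"
proof (cases "q \<le> 2 * dim_per S")
  case True
  have "(\<Sum>l=1..dim_pol S T. E_mat S l q) = (\<Sum>l=1..3. E_mat S l q)"
    by (rule sum.mono_neutral_right) (use True in \<open>auto simp: dim_pol_def E_mat_def\<close>)
  also have "{1..3::nat} = {1, 2, 3}" by auto
  finally show ?thesis using True by (simp add: E_mat_def E_bar_def Let_def)
next
  case False
  let ?l = "q - 2 * dim_per S + 3"
  have "dim_per S * dim_nonper T = dim_per S * (dim_nonper T - 2) + 2 * dim_per S"
    using assms(3) by (metis le_add_diff_inverse2 add_mult_distrib2 mult.commute)
  then have le: "?l \<le> dim_pol S T" using assms False by (simp add: dim_pol_def)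
  have "(\<Sum>l=1..dim_pol S T. E_mat S l q) = (\<Sum>l=1..dim_pol S T. if l = ?l then 1 else 0)"
    by (intro sum.cong refl) (use False in \<open>auto simp: E_mat_def\<close>)
  then show ?thesis using le by simp
qed

context
  fixes S T :: segments and Bpol :: "nat \<Rightarrow> nat \<Rightarrow> real \<times> real \<Rightarrow> real"
  assumes S: "valid_segments S" and T: "valid_segments T" and n3: "3 \<le> dim_per S"
    and img: "polar_image S T Bpol"
begin

abbreviation "curve_x \<equiv> per_ext S (cos_angle S)"
abbreviation "curve_y \<equiv> per_ext S (sin_angle S)"

definition radius :: "real \<Rightarrow> real" where
  "radius t = (\<Sum>j=1..dim_nonper T. rho T j * basis_nonper T j t)"

lemma N3: "3 \<le> dim_nonper T" by (rule dim_nonper_ge[OF T])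

lemma rho_1: "rho T 1 = 0" and rho_2: "0 < rho T 2" and rho_mono: "2 \<le> j \<Longrightarrow> rho T 2 \<le> rho T j"
  using N3 by (auto simp: rho_def divide_right_mono)

lemma per_ext_interval: "s \<in> interval S \<Longrightarrow> per_ext S a s = spl_per S a s"
  using per_ext_at_interval[OF S] by (auto simp: interval_def)

lemma polar_map_eq:
  assumes "s \<in> interval S"
  shows "polar_map S T (s, t) = (radius t * curve_x s, radius t * curve_y s)"
proof -
  have "fst (polar_map S T (s, t)) = (\<Sum>i=1..dim_per S. \<Sum>j=1..dim_nonper T. (cos_angle S i * basis_per S i s) * (rho T j * basis_nonper T j t))"
    by (simp add: polar_map_def fst_sum B_tensor_def F_coeff_def mult_ac)
  moreover have "snd (polar_map S T (s, t)) = (\<Sum>i=1..dim_per S. \<Sum>j=1..dim_nonper T. (sin_angle S i * basis_per S i s) * (rho T j * basis_nonper T j t))"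
    by (simp add: polar_map_def snd_sum B_tensor_def F_coeff_def mult_ac)
  ultimately show ?thesis
    unfolding sum_product[symmetric] per_ext_interval[OF assms]
    by (intro prod_eqI) (simp_all add: spl_per_def radius_def mult.commute)
qed

lemma radius_0: "radius 0 = 0"
proof -
  have "radius 0 = (\<Sum>j=1..dim_nonper T. if j = 1 then rho T 1 else 0)"
    unfolding radius_def by (intro sum.cong refl) (use basis_nonper_at_0[OF T] in auto)
  then show ?thesis using N3 rho_1 by simp
qed

text \<open>On the collapsed edge the images \<open>Bpol\<close> take the values of one fixed branch, so also at the pole all
  of them are simultaneous values of tensor functions.\<close>

lemma branch:
  assumes "x \<in> Omega_pol S T"
  obtains s t where "s \<in> interval S" "t \<in> interval T" "x = polar_map S T (s, t)"
    "\<And>i j. i \<in> {1..dim_per S} \<Longrightarrow> j \<in> {1..dim_nonper T} \<Longrightarrow> Bpol i j x = basis_per S i s * basis_nonper T j t"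
proof -
  obtain s t where st: "s \<in> interval S" "t \<in> interval T" "x = polar_map S T (s, t)"
    using assms by (auto simp: Omega_pol_def Omega_def)
  show ?thesis
  proof (cases "0 < t")
    case True
    then show ?thesis using st img by (intro that[of s t]) (auto simp: polar_image_def Omega_def B_tensor_def)
  next
    case False
    then have "t = 0" using st(2) by (auto simp: interval_def)
    then have x0: "x = (0, 0)" using st polar_map_eq[OF st(1), of 0] radius_0 by simp
    obtain s' where s': "s' \<in> interval S"
      "\<And>i j. i \<in> {1..dim_per S} \<Longrightarrow> j \<in> {1..dim_nonper T} \<Longrightarrow> Bpol i j (0, 0) = B_tensor S T i j (s', 0)"
      using img by (auto simp: polar_image_def)
    show ?thesis
    proof (rule that[of s' 0])
      show "0 \<in> interval T" using period_pos[OF T] by (simp add: interval_def)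
      show "x = polar_map S T (s', 0)" unfolding polar_map_eq[OF s'(1)] x0 by (simp add: radius_0)
    qed (use s' x0 in \<open>auto simp: B_tensor_def\<close>)
  qed
qed

lemma Bpol_eq:
  assumes "s \<in> interval S" "t \<in> interval T" "0 < t" "i \<in> {1..dim_per S}" "j \<in> {1..dim_nonper T}"
  shows "Bpol i j (polar_map S T (s, t)) = basis_per S i s * basis_nonper T j t"
  using img assms by (auto simp: polar_image_def Omega_def B_tensor_def)

lemma N_pol_eq:
  assumes "\<And>i j. i \<in> {1..dim_per S} \<Longrightarrow> j \<in> {1..dim_nonper T} \<Longrightarrow> Bpol i j x = basis_per S i s * basis_nonper T j t"
  shows "N_pol S T Bpol l x = (\<Sum>j=1..dim_nonper T. spl_per S (\<lambda>i. E_mat S l (pos S i j)) s * basis_nonper T j t)"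
  unfolding N_pol_def spl_per_def sum_distrib_right
  by (intro sum.cong refl) (use assms in \<open>auto simp: mult_ac\<close>)

lemma partition_of_unity: "convex_partition_of_unity_on (Omega_pol S T) (dim_pol S T) (N_pol S T Bpol)"
  unfolding convex_partition_of_unity_on_def
proof (intro conjI ballI)
  fix x assume "x \<in> Omega_pol S T"
  then obtain s t where st: "s \<in> interval S" "t \<in> interval T"
    and B: "\<And>i j. i \<in> {1..dim_per S} \<Longrightarrow> j \<in> {1..dim_nonper T} \<Longrightarrow> Bpol i j x = basis_per S i s * basis_nonper T j t"
    using branch by metis
  show "0 \<le> N_pol S T Bpol l x" for l
    unfolding N_pol_def
    by (intro sum_nonneg mult_nonneg_nonneg E_mat_nonneg)
      (simp add: B, intro mult_nonneg_nonneg basis_per_nonneg[OF S st(1)] basis_nonper_nonneg[OF T st(2)], auto)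
  have "(\<Sum>l=1..dim_pol S T. N_pol S T Bpol l x)
     = (\<Sum>j=1..dim_nonper T. \<Sum>i=1..dim_per S. (\<Sum>l=1..dim_pol S T. E_mat S l (pos S i j)) * Bpol i j x)"
    unfolding N_pol_def sum_distrib_right by (subst sum.swap, rule sum.cong[OF refl], rule sum.swap)
  also have "\<dots> = (\<Sum>j=1..dim_nonper T. \<Sum>i=1..dim_per S. basis_per S i s * basis_nonper T j t)"
  proof (intro sum.cong refl)
    fix i j assume ij: "j \<in> {1..dim_nonper T}" "i \<in> {1..dim_per S}"
    have "i + (j - 1) * dim_per S \<le> dim_per S + (dim_nonper T - 1) * dim_per S"
      using ij by (intro add_mono mult_right_mono) auto
    also have "\<dots> = dim_per S * dim_nonper T" using N3 by (cases "dim_nonper T") (auto simp: algebra_simps)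
    finally have "(\<Sum>l=1..dim_pol S T. E_mat S l (pos S i j)) = 1"
      using ij N3 by (intro E_mat_column_sum) (auto simp: pos_def)
    then show "(\<Sum>l=1..dim_pol S T. E_mat S l (pos S i j)) * Bpol i j x = basis_per S i s * basis_nonper T j t"
      using B[OF ij(2,1)] by simp
  qed
  also have "\<dots> = 1"
    unfolding sum_distrib_right[symmetric] basis_per_sum[OF S st(1)] using basis_nonper_sum[OF T st(2)] by simp
  finally show "(\<Sum>l=1..dim_pol S T. N_pol S T Bpol l x) = 1" .
qed

lemma local_support: "locally_supported S T (N_pol S T Bpol)"
  unfolding locally_supported_def
proof (intro ballI subsetI)
  fix l x assume "x \<in> support_on (Omega_pol S T) (N_pol S T Bpol l)"
  then have x: "x \<in> Omega_pol S T" "N_pol S T Bpol l x \<noteq> 0" by (auto simp: in_support_on)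
  obtain s t where st: "s \<in> interval S" "t \<in> interval T" "x = polar_map S T (s, t)"
    and B: "\<And>i j. i \<in> {1..dim_per S} \<Longrightarrow> j \<in> {1..dim_nonper T} \<Longrightarrow> Bpol i j x = basis_per S i s * basis_nonper T j t"
    using branch[OF x(1)] by metis
  obtain j where j: "j \<in> {1..dim_nonper T}" "(\<Sum>i=1..dim_per S. E_mat S l (pos S i j) * Bpol i j x) \<noteq> 0"
    using x(2) unfolding N_pol_def by (metis (no_types, lifting) sum.neutral)
  obtain i where i: "i \<in> {1..dim_per S}" "E_mat S l (pos S i j) * Bpol i j x \<noteq> 0"
    using j(2) by (metis (no_types, lifting) sum.neutral)
  have "basis_per S i s \<noteq> 0" "basis_nonper T j t \<noteq> 0" using i B[OF i(1) j(1)] by auto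
  then have "s \<in> supp_per S i" "t \<in> supp_nonper T j"
    using basis_per_support[OF S] basis_nonper_support[OF T] by auto
  then have "x \<in> polar_map S T ` (Omega S T \<inter> supp_per S i \<times> supp_nonper T j)"
    using st by (auto simp: Omega_def)
  then show "x \<in> (\<Union>(i, j)\<in>{(i, j)\<in>{1..dim_per S} \<times> {1..dim_nonper T}. E_mat S l (pos S i j) \<noteq> 0}.
           polar_map S T ` (Omega S T \<inter> supp_per S i \<times> supp_nonper T j))"
    using i j(1) by auto
qed

text \<open>The coefficients \<open>c i j\<close> of the tensor functions vanish: first \<open>t\<close> is fixed and the independence in
  direction \<open>s\<close> is used, then that in direction \<open>t\<close>. For \<open>j \<ge> 3\<close> a coefficient \<open>c i j\<close> is some
  \<open>a l\<close>. For \<open>j = 2\<close> it is an affine function at \<open>(cos \<theta>\<^sub>i, sin \<theta>\<^sub>i)\<close>, which is zero since it vanishes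
  at three points that are not collinear.\<close>

lemma linear_independence: "linearly_independent_on (Omega_pol S T) (dim_pol S T) (N_pol S T Bpol)"
  unfolding linearly_independent_on_def
proof (intro allI impI ballI)
  fix a l assume z: "\<forall>x\<in>Omega_pol S T. (\<Sum>l=1..dim_pol S T. a l * N_pol S T Bpol l x) = 0" and l: "l \<in> {1..dim_pol S T}"
  define c where "c i j = (\<Sum>l=1..dim_pol S T. a l * E_mat S l (pos S i j))" for i j
  have zero: "(\<Sum>j=1..dim_nonper T. spl_per S (\<lambda>i. c i j) s * basis_nonper T j t) = 0"
    if s: "s \<in> interval S" and t: "t \<in> interval T" "0 < t" for s t
  proof -
    have "polar_map S T (s, t) \<in> Omega_pol S T" using s t by (auto simp: Omega_pol_def Omega_def)
    then have "0 = (\<Sum>l=1..dim_pol S T. a l * N_pol S T Bpol l (polar_map S T (s, t)))" using z by simp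
    also have "\<dots> = (\<Sum>l=1..dim_pol S T. \<Sum>j=1..dim_nonper T. a l * (spl_per S (\<lambda>i. E_mat S l (pos S i j)) s * basis_nonper T j t))"
      by (subst N_pol_eq[OF Bpol_eq[OF s t]]) (auto simp: sum_distrib_left)
    also have "\<dots> = (\<Sum>j=1..dim_nonper T. spl_per S (\<lambda>i. c i j) s * basis_nonper T j t)"
      unfolding spl_per_def c_def
      by (subst sum.swap, intro sum.cong refl)
        (simp add: sum_distrib_left sum_distrib_right mult_ac, subst sum.swap, simp)
    finally show ?thesis by simp
  qed
  have c0: "c i j = 0" if i: "1 \<le> i" "i \<le> dim_per S" and j: "1 \<le> j" "j \<le> dim_nonper T" for i j
  proof -
    have "spl_nonper T (c i) t = 0" if t: "0 < t" "t < breakpoint T (length T)" for t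
    proof -
      have ti: "t \<in> interval T" using t by (simp add: interval_def)
      have "spl_per S (\<lambda>i. spl_nonper T (c i) t) s = 0" if "0 < s" "s < breakpoint S (length S)" for s
      proof -
        have "spl_per S (\<lambda>i. spl_nonper T (c i) t) s = (\<Sum>j=1..dim_nonper T. spl_per S (\<lambda>i. c i j) s * basis_nonper T j t)"
          unfolding spl_per_def spl_nonper_def sum_distrib_right by (subst sum.swap) (simp add: mult_ac)
        then show ?thesis using zero[OF _ ti t(1), of s] that by (simp add: interval_def)
      qed
      from spl_per_eq_0_imp[OF S this i] show ?thesis .
    qed
    from spl_nonper_eq_0_imp[OF T this j] show ?thesis .
  qed
  have big: "a l = 0" if l: "3 < l" "l \<le> dim_pol S T" for l
  proof -
    \<comment> \<open>the position of the row \<open>l\<close> in the identity block, counted from 0\<close>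
    define q where "q = l - 4"
    define i where "i = q mod dim_per S + 1"
    define j where "j = q div dim_per S + 3"
    have q: "q < dim_per S * (dim_nonper T - 2)" using l by (auto simp: q_def dim_pol_def)
    have i: "1 \<le> i" "i \<le> dim_per S" using n3 by (auto simp: i_def Suc_leI)
    have "q div dim_per S < dim_nonper T - 2" using q by (simp add: less_mult_imp_div_less mult.commute)
    then have j: "1 \<le> j" "j \<le> dim_nonper T" "3 \<le> j" by (auto simp: j_def)
    have p: "pos S i j = 2 * dim_per S + (l - 3)"
      unfolding pos_cases(4)[OF i j(1) j(3)] using l by (simp add: i_def j_def q_def)
    have "c i j = (\<Sum>l'=1..dim_pol S T. if l' = l then a l else 0)"
      unfolding c_def p by (intro sum.cong refl) (use l in \<open>auto simp: E_mat_def\<close>)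
    then show ?thesis using c0[OF i j(1,2)] l by simp
  qed
  have low: "a 1 = 0 \<and> a 2 = 0 \<and> a 3 = 0"
  proof -
    have D: "3 \<le> dim_pol S T" by (simp add: dim_pol_def)
    define \<gamma> where "\<gamma> = (a 1 + a 2 + a 3) / 3"
    define \<alpha> where "\<alpha> = a 1 / 3 - a 2 / 6 - a 3 / 6"
    define \<beta> where "\<beta> = sqrt 3 / 6 * (a 2 - a 3)"
    have e: "\<alpha> * cos_angle S i + \<beta> * sin_angle S i + \<gamma> = 0" if i: "1 \<le> i" "i \<le> dim_per S" for i
    proof -
      have "c i 2 = (\<Sum>l=1..3. a l * E_mat S l (pos S i 2))"
        unfolding c_def using D i by (intro sum.mono_neutral_right) (auto simp: E_mat_def pos_def)
      also have "{1..3::nat} = {1, 2, 3}" by auto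
      also have "(\<Sum>l\<in>{1,2,3}. a l * E_mat S l (pos S i 2)) = \<alpha> * cos_angle S i + \<beta> * sin_angle S i + \<gamma>"
      proof -
        define w where "w = sqrt 3 / 6"
        have E: "E_mat S 1 (pos S i 2) = 1/3 * cos_angle S i + 1/3" "E_mat S 2 (pos S i 2) = - (1/6) * cos_angle S i + w * sin_angle S i + 1/3"
          "E_mat S 3 (pos S i 2) = - (1/6) * cos_angle S i - w * sin_angle S i + 1/3"
          using i by (simp_all add: E_mat_def E_bar_def Let_def pos_def w_def)
        have "(\<Sum>l\<in>{1,2,3}. a l * E_mat S l (pos S i 2)) =
            a 1 * E_mat S 1 (pos S i 2) + a 2 * E_mat S 2 (pos S i 2) + a 3 * E_mat S 3 (pos S i 2)" by simp
        also have "\<dots> = \<alpha> * cos_angle S i + w * (a 2 - a 3) * sin_angle S i + \<gamma>"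
          unfolding E \<alpha>_def \<gamma>_def by (simp add: field_simps)
        finally show ?thesis by (simp add: \<beta>_def w_def)
      qed
      finally show ?thesis using c0[OF i, of 2] N3 by simp
    qed
    have t: "0 < det3 (sin_angle S 1) (cos_angle S 1) 1 (sin_angle S 2) (cos_angle S 2) 1 (sin_angle S 3) (cos_angle S 3) 1"
      using tri_theta_pos[OF S n3, of 1] by (simp add: tri_def numeral_3_eq_3 numeral_2_eq_2)
    have e1: "\<alpha> * cos_angle S 1 + \<beta> * sin_angle S 1 + \<gamma> = 0" and e2: "\<alpha> * cos_angle S 2 + \<beta> * sin_angle S 2 + \<gamma> = 0" and e3: "\<alpha> * cos_angle S 3 + \<beta> * sin_angle S 3 + \<gamma> = 0"
      by (rule e; use n3 in simp)+
    let ?d = "det3 (sin_angle S 1) (cos_angle S 1) 1 (sin_angle S 2) (cos_angle S 2) 1 (sin_angle S 3) (cos_angle S 3) 1"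
    have "\<alpha> * ?d = 0" "\<beta> * ?d = 0" "\<gamma> * ?d = 0" unfolding det3_def using e1 e2 e3 by algebra+
    then have "\<alpha> = 0" "\<beta> = 0" "\<gamma> = 0" using t by auto
    then show ?thesis by (auto simp: \<alpha>_def \<beta>_def \<gamma>_def)
  qed
  have "l = 1 \<or> l = 2 \<or> l = 3 \<or> 3 < l" using l by auto
  then show "a l = 0" using low big l by auto
qed

section \<open>Smoothness at the polar point\<close>

definition germ_radius :: "real \<Rightarrow> real" where "germ_radius t = (\<Sum>j=1..dim_nonper T. rho T j * nonper_germ T j t)"
definition germ_radius' :: "real \<Rightarrow> real" where "germ_radius' t = (\<Sum>j=1..dim_nonper T. rho T j * nonper_germ' T j t)"

lemma radius_eq_germ: "0 \<le> t \<Longrightarrow> t < first_knot T \<Longrightarrow> radius t = germ_radius t"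
  unfolding radius_def germ_radius_def by (intro sum.cong refl) (simp add: basis_nonper_germ[OF T])

lemma germ_radius_derivative: "0 \<le> t \<Longrightarrow> t \<le> first_knot T \<Longrightarrow> (germ_radius has_real_derivative germ_radius' t) (at t)"
  unfolding germ_radius_def[abs_def] germ_radius'_def by (intro DERIV_sum DERIV_cmult nonper_germ_derivative[OF T])

lemma germ_radius'_isCont: "0 \<le> t \<Longrightarrow> t \<le> first_knot T \<Longrightarrow> isCont germ_radius' t"
  unfolding germ_radius'_def[abs_def] by (intro continuous_intros nonper_germ'_isCont[OF T])

lemma germ_radius_0: "germ_radius 0 = 0"
  using radius_eq_germ[of 0] radius_0 first_knot_pos[OF T] by simp

lemma germ_radius'_0: "0 < germ_radius' 0"
proof -
  have "germ_radius' 0 = (\<Sum>j=1..dim_nonper T. if j = 2 then rho T 2 * nonper_germ' T 2 0 else 0)"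
    unfolding germ_radius'_def
  proof (intro sum.cong refl)
    fix j assume "j \<in> {1..dim_nonper T}"
    then consider "j = 1" | "j = 2" | "3 \<le> j" by force
    then show "rho T j * nonper_germ' T j 0 = (if j = 2 then rho T 2 * nonper_germ' T 2 0 else 0)"
      using rho_1 nonper_germ'_0[OF T] by cases auto
  qed
  also have "\<dots> = rho T 2 * nonper_germ' T 2 0" using N3 by simp
  finally show ?thesis using rho_2 nonper_germ'_0(1)[OF T] by simp
qed

lemma radial_range:
  obtains \<tau> where "0 < \<tau>" "\<tau> \<le> first_knot T" "\<And>t. 0 \<le> t \<Longrightarrow> t < \<tau> \<Longrightarrow> 0 < germ_radius' t" "\<And>t. 0 < t \<Longrightarrow> t < \<tau> \<Longrightarrow> 0 < germ_radius t"
proof -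
  have "(germ_radius' \<longlongrightarrow> germ_radius' 0) (at 0)" using germ_radius'_isCont[of 0] first_knot_pos[OF T] by (simp add: isCont_def)
  then have "eventually (\<lambda>t. 0 < germ_radius' t) (at 0)" using germ_radius'_0 by (rule order_tendstoD(1))
  then obtain d where d: "0 < d" "\<And>t. t \<noteq> 0 \<Longrightarrow> dist t 0 < d \<Longrightarrow> 0 < germ_radius' t" unfolding eventually_at by auto
  define \<tau> where "\<tau> = min d (first_knot T)"
  have p: "0 < germ_radius' t" if "0 \<le> t" "t < \<tau>" for t
    using that d(2)[of t] germ_radius'_0 by (cases "t = 0") (auto simp: \<tau>_def)
  show ?thesis
  proof (rule that[of \<tau>])
    show "0 < \<tau>" "\<tau> \<le> first_knot T" using d first_knot_pos[OF T] by (auto simp: \<tau>_def)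
    fix t assume t: "0 < t" "t < \<tau>"
    obtain z where z: "0 < z" "z < t" "germ_radius t - germ_radius 0 = (t - 0) * germ_radius' z"
      using MVT2[OF t(1), of germ_radius germ_radius'] germ_radius_derivative t by (auto simp: \<tau>_def)
    show "0 < germ_radius t" using z t p[of z] germ_radius_0 by simp
  qed (rule p)
qed

lemma interval_T: "0 \<le> t \<Longrightarrow> t < first_knot T \<Longrightarrow> t \<in> interval T"
  using first_knot_le[OF T] by (auto simp: interval_def)

lemma wrap_interval:
  obtains s0 where "s0 \<in> interval S" "\<And>a. per_ext S a s = spl_per S a s0" "\<And>a. per_ext S a s0 = spl_per S a s0"
proof -
  obtain s0 k where s: "s = s0 + real_of_int k * breakpoint S (length S)" "0 \<le> s0" "s0 < breakpoint S (length S)"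
    using wrap_exists[OF S] by blast
  show ?thesis
    by (rule that[of s0]) (use s per_ext_shift[OF S] per_ext_eq[OF S] in \<open>auto simp: interval_def\<close>)
qed

lemma B_tensor_determined:
  assumes s: "s \<in> interval S" "s' \<in> interval S" and t: "t \<in> interval T" "0 < t" "t' \<in> interval T" "0 < t'"
    and eq: "polar_map S T (s, t) = polar_map S T (s', t')" and i: "i \<in> {1..dim_per S}"
  shows "basis_per S i s = basis_per S i s'"
proof -
  have "basis_per S i s * basis_nonper T j t = basis_per S i s' * basis_nonper T j t'" if "j \<in> {1..dim_nonper T}" for j
    using Bpol_eq[OF s(1) t(1,2) i that] Bpol_eq[OF s(2) t(3,4) i that] eq by simp
  then have "(\<Sum>j=1..dim_nonper T. basis_per S i s * basis_nonper T j t) = (\<Sum>j=1..dim_nonper T. basis_per S i s' * basis_nonper T j t')"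
    by (intro sum.cong refl)
  then show ?thesis unfolding sum_distrib_left[symmetric] using basis_nonper_sum[OF T t(1)] basis_nonper_sum[OF T t(3)] by simp
qed

text \<open>A zero of the curve would map points with \<open>t > 0\<close> to the pole. There \<open>Bpol\<close> has the values of a
  branch with \<open>t = 0\<close>. Equal values of the radial functions mean equal radii, but
  only \<open>t = 0\<close> has radius 0 near the edge.\<close>

lemma curve_nonzero: "curve_x s \<noteq> 0 \<or> curve_y s \<noteq> 0"
proof (rule ccontr)
  assume "\<not> ?thesis"
  then have z: "curve_x s = 0" "curve_y s = 0" by auto
  obtain s0 where s0: "s0 \<in> interval S" "\<And>a. per_ext S a s = spl_per S a s0" "\<And>a. per_ext S a s0 = spl_per S a s0"
    using wrap_interval[of s] by blast
  obtain \<tau> where \<tau>: "0 < \<tau>" "\<tau> \<le> first_knot T" "\<And>t. 0 \<le> t \<Longrightarrow> t < \<tau> \<Longrightarrow> 0 < germ_radius' t" "\<And>t. 0 < t \<Longrightarrow> t < \<tau> \<Longrightarrow> 0 < germ_radius t"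
    using radial_range by blast
  define t where "t = \<tau> / 2"
  have t: "0 < t" "t < \<tau>" "t < first_knot T" using \<tau>(1,2) by (auto simp: t_def)
  have ti: "t \<in> interval T" by (rule interval_T) (use t in auto)
  have "polar_map S T (s0, t) = (0, 0)"
    unfolding polar_map_eq[OF s0(1)] s0(3) using z s0(2) by simp
  then have b: "Bpol i j (0, 0) = basis_per S i s0 * basis_nonper T j t"
    if "i \<in> {1..dim_per S}" "j \<in> {1..dim_nonper T}" for i j
    using Bpol_eq[OF s0(1) ti t(1) that] by simp
  obtain s' where s': "s' \<in> interval S"
    "\<And>i j. i \<in> {1..dim_per S} \<Longrightarrow> j \<in> {1..dim_nonper T} \<Longrightarrow> Bpol i j (0, 0) = basis_per S i s' * basis_nonper T j 0"
    using img by (auto simp: polar_image_def B_tensor_def)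
  have "basis_nonper T j t = basis_nonper T j 0" if j: "j \<in> {1..dim_nonper T}" for j
  proof -
    have "(\<Sum>i=1..dim_per S. basis_per S i s0 * basis_nonper T j t) = (\<Sum>i=1..dim_per S. basis_per S i s' * basis_nonper T j 0)"
      using b[OF _ j] s'(2)[OF _ j] by (intro sum.cong refl) simp
    then show ?thesis
      unfolding sum_distrib_right[symmetric] using basis_per_sum[OF S s0(1)] basis_per_sum[OF S s'(1)] by simp
  qed
  then have "radius t = radius 0"
    unfolding radius_def by (intro sum.cong refl) simp
  then show False using radius_0 radius_eq_germ[of t] \<tau>(4)[of t] t by simp
qed

text \<open>Points of the curve on the same ray can be moved to the same point of the plane by a choice of small
  radii. The images of the tensor functions are single-valued there, and summation over \<open>j\<close> shows
  that all periodic basis functions agree at the two parameters.\<close>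

lemma curve_ray:
  assumes c: "0 < c" and eq: "curve_x s = c * curve_x s'" "curve_y s = c * curve_y s'"
  shows "curve_x s = curve_x s' \<and> curve_y s = curve_y s'"
proof -
  obtain s0 where s0: "s0 \<in> interval S" "\<And>a. per_ext S a s = spl_per S a s0" "\<And>a. per_ext S a s0 = spl_per S a s0"
    using wrap_interval[of s] by blast
  obtain s1 where s1: "s1 \<in> interval S" "\<And>a. per_ext S a s' = spl_per S a s1" "\<And>a. per_ext S a s1 = spl_per S a s1"
    using wrap_interval[of s'] by blast
  obtain \<tau> where \<tau>: "0 < \<tau>" "\<tau> \<le> first_knot T" "\<And>t. 0 \<le> t \<Longrightarrow> t < \<tau> \<Longrightarrow> 0 < germ_radius' t" "\<And>t. 0 < t \<Longrightarrow> t < \<tau> \<Longrightarrow> 0 < germ_radius t"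
    using radial_range by blast
  define h where "h = \<tau> / 2"
  have h: "0 < h" "h < \<tau>" "h < first_knot T" using \<tau>(1,2) by (auto simp: h_def)
  have cont: "continuous_on {0..h} germ_radius"
    by (intro continuous_at_imp_continuous_on ballI DERIV_isCont[OF germ_radius_derivative]) (use h in auto)
  have ex: "\<exists>t. 0 < t \<and> t \<le> h \<and> germ_radius t = y" if y: "0 < y" "y \<le> germ_radius h" for y
  proof -
    obtain t where "0 \<le> t" "t \<le> h" "germ_radius t = y" using IVT'[of germ_radius 0 y h] cont y germ_radius_0 h by auto
    then show ?thesis using germ_radius_0 y(1) by (intro exI[of _ t]) (auto simp: less_le)
  qed
  have rh: "0 < germ_radius h" by (rule \<tau>(4)) (use h in auto)
  obtain t t' where tt: "0 < t" "t \<le> h" "0 < t'" "t' \<le> h" "germ_radius t * c = germ_radius t'"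
  proof (cases "c \<le> 1")
    case True
    have "0 < germ_radius h * c" "germ_radius h * c \<le> germ_radius h" using rh c True by auto
    from ex[OF this] show ?thesis using that[of h] h by auto
  next
    case False
    have "0 < germ_radius h / c" "germ_radius h / c \<le> germ_radius h" using rh c False by (auto simp: field_simps)
    from ex[OF this] show ?thesis using that[of _ h] h c by auto
  qed
  have ti: "t \<in> interval T" "t' \<in> interval T" by (rule interval_T; use tt h in auto)+
  have r: "radius t = germ_radius t" "radius t' = germ_radius t'" by (rule radius_eq_germ; use tt h in auto)+
  have "polar_map S T (s0, t) = polar_map S T (s1, t')"
    unfolding polar_map_eq[OF s0(1)] polar_map_eq[OF s1(1)] r s0(3) s1(3) tt(5)[symmetric]
    using eq by (simp add: s0(2) s1(2))
  then have b: "basis_per S i s0 = basis_per S i s1" if "i \<in> {1..dim_per S}" for i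
    using B_tensor_determined[OF s0(1) s1(1) ti(1) tt(1) ti(2) tt(3) _ that] by simp
  have "spl_per S a s0 = spl_per S a s1" for a unfolding spl_per_def by (intro sum.cong refl) (simp add: b)
  then show ?thesis by (simp add: s0(2) s1(2))
qed

lemma curve_jacobian: "curve_x s * deriv curve_y s - curve_y s * deriv curve_x s \<noteq> 0"
proof (rule jacobian_nonzero[where X = curve_x and Y = curve_y and X' = "deriv curve_x" and Y' = "deriv curve_y" and x = s])
  show "curve_x s \<noteq> 0 \<or> curve_y s \<noteq> 0" by (rule curve_nonzero)
  show "0 < c \<Longrightarrow> curve_x s = c * curve_x s' \<Longrightarrow> curve_y s = c * curve_y s' \<Longrightarrow> curve_x s = curve_x s' \<and> curve_y s = curve_y s'" for s s' c
    by (rule curve_ray)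
  show "deriv curve_x s = c * curve_x s \<Longrightarrow> deriv curve_y s = c * curve_y s \<Longrightarrow>
      eventually (\<lambda>z. 0 < c * (curve_y s * curve_x z - curve_x s * curve_y z)) (at s)" for c
    by (rule radial_tangent[OF S n3])
qed (rule per_ext_has_derivative[OF S] per_ext_deriv_isCont[OF S])+

text \<open>The terms with \<open>j = 1\<close> and \<open>j = 2\<close> are eliminated with the help of \<open>\<Sum>\<^sub>j B\<^sup>t\<^sub>j = 1\<close> and
  \<open>r = \<Sum>\<^sub>j \<rho>\<^sub>j B\<^sup>t\<^sub>j\<close>. They leave an affine function of the polar map and terms with \<open>j \<ge> 3\<close>, whose radial
  factors vanish to second order at the edge.\<close>

lemma N_pol_C1:
  assumes l: "1 \<le> l"
  shows "C1_smooth_at_polar_point (Omega_pol S T) (N_pol S T Bpol l)"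
proof -
  let ?L = "breakpoint S (length S)" and ?N = "dim_nonper T"
  have L: "0 < ?L" by (rule period_pos[OF S])
  note shift = per_ext_shift[OF S] per_ext_deriv_periodic[OF S]
  have C: "isCont (per_ext S a) x" "isCont (deriv (per_ext S a)) x" for a x
    using DERIV_isCont[OF per_ext_has_derivative[OF S]] per_ext_deriv_isCont[OF S] by auto
  have bnd: "\<exists>K. (\<forall>x. \<bar>per_ext S a x\<bar> \<le> K) \<and> (\<forall>x. \<bar>deriv (per_ext S a) x\<bar> \<le> K)" for a
  proof -
    obtain K1 where "\<forall>x. \<bar>per_ext S a x\<bar> \<le> K1"
      using periodic_attains(1)[OF C(1) shift(1) L] by blast
    moreover obtain K2 where "\<forall>x. \<bar>deriv (per_ext S a) x\<bar> \<le> K2"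
      using periodic_attains(1)[OF C(2) shift(2) L] by blast
    ultimately show ?thesis by (intro exI[of _ "max K1 K2"]) (simp add: le_max_iff_disj)
  qed
  obtain Kx where Kx: "\<And>x. \<bar>curve_x x\<bar> \<le> Kx" "\<And>x. \<bar>deriv curve_x x\<bar> \<le> Kx" using bnd[of "cos_angle S"] by blast
  obtain Ky where Ky: "\<And>x. \<bar>curve_y x\<bar> \<le> Ky" "\<And>x. \<bar>deriv curve_y x\<bar> \<le> Ky" using bnd[of "sin_angle S"] by blast
  define K where "K = max Kx Ky"
  define Jf where "Jf s = curve_x s * deriv curve_y s - curve_y s * deriv curve_x s" for s
  have Jf: "isCont Jf x" "Jf (x + real_of_int k * ?L) = Jf x" "Jf x \<noteq> 0" for x k
    unfolding Jf_def[abs_def] by (intro continuous_intros C) (simp_all only: shift curve_jacobian not_False_eq_True)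
  obtain J0 where J0: "0 < J0" "\<And>s. J0 \<le> \<bar>curve_x s * deriv curve_y s - curve_y s * deriv curve_x s\<bar>"
    using periodic_attains(2)[of Jf, OF Jf(1,2) L Jf(3)] unfolding Jf_def by blast
  define Mf where "Mf s = curve_x s * curve_x s + curve_y s * curve_y s" for s
  have Mf: "isCont Mf x" "Mf (x + real_of_int k * ?L) = Mf x" "Mf x \<noteq> 0" for x k
    unfolding Mf_def[abs_def]
    by (intro continuous_intros C) (simp_all only: shift sum_squares_eq_zero_iff de_Morgan_conj curve_nonzero)
  obtain m where m: "0 < m" "\<And>s. m \<le> \<bar>curve_x s * curve_x s + curve_y s * curve_y s\<bar>"
    using periodic_attains(2)[of Mf, OF Mf(1,2) L Mf(3)] unfolding Mf_def by blast
  obtain \<tau> where tau: "0 < \<tau>" "\<tau> \<le> first_knot T" "\<And>t. 0 \<le> t \<Longrightarrow> t < \<tau> \<Longrightarrow> 0 < germ_radius' t" "\<And>t. 0 < t \<Longrightarrow> t < \<tau> \<Longrightarrow> 0 < germ_radius t"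
    using radial_range by blast
  interpret polar_coords curve_x curve_y "deriv curve_x" "deriv curve_y" germ_radius germ_radius' \<tau> K J0
  proof
    show "(germ_radius has_real_derivative germ_radius' t) (at t)" "isCont germ_radius' t" if "0 < t" "t < \<tau>" for t
      using germ_radius_derivative germ_radius'_isCont that tau(2) by auto
    show "\<bar>curve_x s\<bar> \<le> K" "\<bar>curve_y s\<bar> \<le> K" "\<bar>deriv curve_x s\<bar> \<le> K" "\<bar>deriv curve_y s\<bar> \<le> K" for s
      using Kx Ky by (auto simp: K_def le_max_iff_disj)
  qed (use per_ext_has_derivative[OF S] C J0 tau in auto)
  obtain c lx ly where E1: "\<And>i. 1 \<le> i \<Longrightarrow> i \<le> dim_per S \<Longrightarrow> E_mat S l (pos S i 1) = c"
    and E2: "\<And>i. 1 \<le> i \<Longrightarrow> i \<le> dim_per S \<Longrightarrow> E_mat S l (pos S i 2) = c + lx * cos_angle S i + ly * sin_angle S i"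
    using E_mat_affine[OF l, of S] by blast
  define \<rho> where "\<rho> j = rho T j / rho T 2" for j
  have r2: "0 < rho T 2" by (rule rho_2)
  \<comment> \<open>coefficients of the periodic factor \<open>Q\<^sub>j\<close> of the remainder\<close>
  define q where "q j i = E_mat S l (pos S i j) + (- c) + (- \<rho> j * lx) * cos_angle S i + (- \<rho> j * ly) * sin_angle S i" for j i
  have N3': "3 \<le> ?N" by (rule N3)
  have split: "(\<Sum>j=1..?N. f j) = f 1 + f 2 + (\<Sum>j=3..?N. f j)" for f :: "nat \<Rightarrow> real"
  proof -
    have "{1..?N} = {1, 2} \<union> {3..?N}" using N3' by auto
    then show ?thesis by (simp add: sum.union_disjoint)
  qed
  have "\<forall>j. \<exists>K. (\<forall>x. \<bar>per_ext S (q j) x\<bar> \<le> K) \<and> (\<forall>x. \<bar>deriv (per_ext S (q j)) x\<bar> \<le> K)" using bnd by blast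
  then obtain K' where K': "\<And>j x. \<bar>per_ext S (q j) x\<bar> \<le> K' j" "\<And>j x. \<bar>deriv (per_ext S (q j)) x\<bar> \<le> K' j"
    by metis
  show ?thesis
  proof (rule C1_at_pole[where A = "{3..?N}" and Q = "\<lambda>j. per_ext S (q j)" and Q' = "\<lambda>j. deriv (per_ext S (q j))"
        and b = "nonper_germ T" and b' = "nonper_germ' T" and K' = K' and c = c and lx = "lx / rho T 2" and ly = "ly / rho T 2"])
    show "(per_ext S (q j) has_real_derivative deriv (per_ext S (q j)) s) (at s)" for j s
      by (rule per_ext_has_derivative[OF S])
    show "\<bar>per_ext S (q j) s\<bar> \<le> K' j" "\<bar>deriv (per_ext S (q j)) s\<bar> \<le> K' j" for j s by (fact K')+
    show "(nonper_germ T j has_real_derivative nonper_germ' T j t) (at t)" if "0 < t" "t < \<tau>" for j t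
      by (rule nonper_germ_derivative[OF T]) (use that tau(2) in auto)
    fix j assume j: "j \<in> {3..?N}"
    have fk: "0 < first_knot T" by (rule first_knot_pos[OF T])
    have b0: "nonper_germ T j 0 = 0" "nonper_germ' T j 0 = 0"
      using nonper_germ_0[OF T, of j] nonper_germ'_0(2)[OF T, of j] j by auto
    have le: "at_right (0::real) \<le> at 0" by (rule at_le) simp
    have Db: "(nonper_germ T j has_real_derivative 0) (at 0)"
      using nonper_germ_derivative[OF T, of 0 j] fk b0 by simp
    show "(nonper_germ T j \<longlongrightarrow> 0) (at_right 0)"
      using DERIV_isCont[OF Db] b0 unfolding isCont_def by (auto intro: tendsto_mono[OF le])
    have Dq: "((\<lambda>t. nonper_germ T j t / t) \<longlongrightarrow> 0) (at_right 0)"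
      using Db b0 unfolding has_field_derivative_iff by (auto intro: tendsto_mono[OF le])
    have Dr: "((\<lambda>t. germ_radius t / t) \<longlongrightarrow> germ_radius' 0) (at_right 0)"
      using germ_radius_derivative[of 0] fk germ_radius_0 unfolding has_field_derivative_iff by (auto intro: tendsto_mono[OF le])
    have "((\<lambda>t. (nonper_germ T j t / t) / (germ_radius t / t)) \<longlongrightarrow> 0 / germ_radius' 0) (at_right 0)"
      by (rule tendsto_divide[OF Dq Dr]) (use germ_radius'_0 in simp)
    moreover have "\<forall>\<^sub>F t in at_right 0. (nonper_germ T j t / t) / (germ_radius t / t) = nonper_germ T j t / germ_radius t"
      unfolding eventually_at_right_field by (intro exI[of _ 1]) auto
    ultimately have "((\<lambda>t. nonper_germ T j t / germ_radius t) \<longlongrightarrow> 0 / germ_radius' 0) (at_right 0)"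
      by (rule Lim_transform_eventually)
    then show "((\<lambda>t. nonper_germ T j t / germ_radius t) \<longlongrightarrow> 0) (at_right 0)" by simp
    have "((\<lambda>t. nonper_germ' T j t / germ_radius' t) \<longlongrightarrow> nonper_germ' T j 0 / germ_radius' 0) (at_right 0)"
      using nonper_germ'_isCont[OF T, of 0 j] germ_radius'_isCont[of 0] fk germ_radius'_0 unfolding isCont_def
      by (intro tendsto_divide) (auto intro: tendsto_mono[OF le])
    then show "((\<lambda>t. nonper_germ' T j t / germ_radius' t) \<longlongrightarrow> 0) (at_right 0)" by (simp add: b0)
  next
    fix s t :: real assume t: "0 < t" "t < \<tau>"
    obtain s0 where s0: "s0 \<in> interval S" "\<And>a. per_ext S a s = spl_per S a s0" "\<And>a. per_ext S a s0 = spl_per S a s0"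
      using wrap_interval[of s] by blast
    have tf: "0 \<le> t" "t < first_knot T" using t tau(2) by auto
    have ti: "t \<in> interval T" by (rule interval_T[OF tf])
    have P: "polar (s, t) = polar_map S T (s0, t)"
      unfolding polar_def polar_map_eq[OF s0(1)] radius_eq_germ[OF tf] s0(3) by (simp add: s0(2))
    let ?b = "\<lambda>j. nonper_germ T j t"
    have bg: "basis_nonper T j t = ?b j" if "j \<in> {1..?N}" for j by (rule basis_nonper_germ[OF T that tf])
    have sum1: "?b 1 + ?b 2 + (\<Sum>j=3..?N. ?b j) = 1"
    proof -
      have "(\<Sum>j=1..?N. ?b j) = 1" using basis_nonper_sum[OF T ti] bg by simp
      then show ?thesis unfolding split .
    qed
    have rad: "germ_radius t = rho T 2 * ?b 2 + (\<Sum>j=3..?N. rho T j * ?b j)"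
      unfolding germ_radius_def split using rho_1 by simp
    have s1: "spl_per S (\<lambda>i. E_mat S l (pos S i 1)) s0 = c"
      using spl_per_cong[of S "\<lambda>i. E_mat S l (pos S i 1)" "\<lambda>_. c" s0] E1 spl_per_const[OF S s0(1)] by simp
    have s2: "spl_per S (\<lambda>i. E_mat S l (pos S i 2)) s0 = c + lx * curve_x s + ly * curve_y s"
    proof -
      have "spl_per S (\<lambda>i. E_mat S l (pos S i 2)) s0 = spl_per S (\<lambda>i. c + lx * cos_angle S i + ly * sin_angle S i) s0"
        by (rule spl_per_cong) (rule E2)
      then show ?thesis by (simp add: spl_per_add spl_per_scale spl_per_const[OF S s0(1)] s0(2))
    qed
    have sq: "per_ext S (q j) s = spl_per S (\<lambda>i. E_mat S l (pos S i j)) s0 - c - \<rho> j * (lx * curve_x s + ly * curve_y s)" for j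
      unfolding s0(2) q_def spl_per_add spl_per_scale spl_per_const[OF S s0(1)] by (simp add: algebra_simps)
    have "N_pol S T Bpol l (polar (s, t)) = (\<Sum>j=1..?N. spl_per S (\<lambda>i. E_mat S l (pos S i j)) s0 * ?b j)"
      unfolding P using N_pol_eq[OF Bpol_eq[OF s0(1) ti t(1)]] bg by simp
    also have "\<dots> = c * ?b 1 + (c + lx * curve_x s + ly * curve_y s) * ?b 2
        + (\<Sum>j=3..?N. spl_per S (\<lambda>i. E_mat S l (pos S i j)) s0 * ?b j)"
      unfolding split s1 s2 ..
    also have "(\<Sum>j=3..?N. spl_per S (\<lambda>i. E_mat S l (pos S i j)) s0 * ?b j)
       = (\<Sum>j=3..?N. per_ext S (q j) s * ?b j) + c * (\<Sum>j=3..?N. ?b j)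
         + (lx * curve_x s + ly * curve_y s) / rho T 2 * (\<Sum>j=3..?N. rho T j * ?b j)"
      unfolding sum_distrib_left sum.distrib[symmetric]
      by (intro sum.cong refl) (simp add: sq \<rho>_def algebra_simps add_divide_distrib)
    also have "(\<Sum>j=3..?N. ?b j) = 1 - ?b 1 - ?b 2" using sum1 by simp
    also have "(\<Sum>j=3..?N. rho T j * ?b j) = germ_radius t - rho T 2 * ?b 2" using rad by simp
    finally have "N_pol S T Bpol l (polar (s, t)) = c * ?b 1 + (c + lx * curve_x s + ly * curve_y s) * ?b 2 +
      ((\<Sum>j=3..?N. per_ext S (q j) s * ?b j) + c * (1 - ?b 1 - ?b 2) +
       (lx * curve_x s + ly * curve_y s) / rho T 2 * (germ_radius t - rho T 2 * ?b 2))" .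
    also have "\<dots> = c + (lx * curve_x s + ly * curve_y s) / rho T 2 * germ_radius t + (\<Sum>j=3..?N. per_ext S (q j) s * ?b j)"
      using r2 by (simp add: field_simps)
    finally show "N_pol S T Bpol l (polar (s, t)) = c + lx / rho T 2 * fst (polar (s, t)) + ly / rho T 2 * snd (polar (s, t)) +
       (\<Sum>j=3..?N. per_ext S (q j) s * ?b j)"
      by (simp add: polar_def add_divide_distrib algebra_simps)
  next
    fix \<epsilon> :: real assume \<epsilon>: "0 < \<epsilon>"
    \<comment> \<open>Parameters from \<open>t0\<close> on have radius at least \<open>\<rho>\<^sub>2 e\<close>, and the curve keeps the distance \<open>sqrt m\<close> from the origin.\<close>
    define t0 where "t0 = min \<epsilon> \<tau> / 2"
    have t0: "0 < t0" "t0 < \<epsilon>" "t0 < \<tau>" using \<epsilon> tau(1) by (auto simp: t0_def)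
    obtain e where e: "0 < e" "\<And>t. t \<in> interval T \<Longrightarrow> t0 \<le> t \<Longrightarrow> basis_nonper T 1 t \<le> 1 - e"
      using basis_nonper_first_bound[OF T t0(1)] t0(3) tau(2) by (metis order.strict_trans2)
    have rad: "rho T 2 * e \<le> radius t" if "t \<in> interval T" "t0 \<le> t" for t
    proof -
      have "rho T 2 * (1 - basis_nonper T 1 t) = (\<Sum>j=1..?N. if j = 1 then 0 else rho T 2 * basis_nonper T j t)"
      proof -
        have "(\<Sum>j=3..?N. if j = 1 then 0 else rho T 2 * basis_nonper T j t) = rho T 2 * (\<Sum>j=3..?N. basis_nonper T j t)"
          unfolding sum_distrib_left by (intro sum.cong) auto
        moreover have "1 - basis_nonper T 1 t = basis_nonper T 2 t + (\<Sum>j=3..?N. basis_nonper T j t)"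
          using basis_nonper_sum[OF T that(1)] unfolding split by linarith
        ultimately show ?thesis unfolding split by (simp add: distrib_left)
      qed
      also have "\<dots> \<le> radius t" unfolding radius_def
      proof (rule sum_mono)
        fix j assume j: "j \<in> {1..?N}"
        show "(if j = 1 then 0 else rho T 2 * basis_nonper T j t) \<le> rho T j * basis_nonper T j t"
          using rho_1 rho_mono[of j] basis_nonper_nonneg[OF T that(1) j] j
          by (cases "j = 1") (auto intro: mult_right_mono)
      qed
      finally have "rho T 2 * (1 - basis_nonper T 1 t) \<le> radius t" .
      moreover have "rho T 2 * e \<le> rho T 2 * (1 - basis_nonper T 1 t)"
        using e(2)[OF that] r2 by (intro mult_left_mono) auto
      ultimately show ?thesis by linarith
    qed
    define \<delta> where "\<delta> = rho T 2 * e * sqrt m"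
    have \<delta>: "0 < \<delta>" using r2 e(1) m(1) by (simp add: \<delta>_def)
    show "\<forall>\<^sub>F x in at (0, 0) within Omega_pol S T. \<exists>s t. 0 < t \<and> t < \<epsilon> \<and> t < \<tau> \<and> x = polar (s, t)"
      unfolding eventually_at
    proof (rule exI[of _ \<delta>], intro conjI ballI impI \<delta>)
      fix x assume x: "x \<in> Omega_pol S T" "x \<noteq> (0, 0) \<and> dist x (0, 0) < \<delta>"
      obtain s t where st: "s \<in> interval S" "t \<in> interval T" "x = polar_map S T (s, t)"
        using x(1) by (auto simp: Omega_pol_def Omega_def)
      have xe: "x = (radius t * curve_x s, radius t * curve_y s)" using st(3) polar_map_eq[OF st(1)] by simp
      have "0 \<le> t" using st(2) by (simp add: interval_def)
      moreover have "t \<noteq> 0" using x(2) xe radius_0 by auto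
      ultimately have tp: "0 < t" by simp
      have "t < t0"
      proof (rule ccontr)
        assume "\<not> t < t0"
        then have r: "rho T 2 * e \<le> radius t" using rad st(2) by simp
        have "norm x = sqrt ((radius t * curve_x s)\<^sup>2 + (radius t * curve_y s)\<^sup>2)" unfolding xe norm_Pair by simp
        also have "(radius t * curve_x s)\<^sup>2 + (radius t * curve_y s)\<^sup>2 = (radius t)\<^sup>2 * (curve_x s * curve_x s + curve_y s * curve_y s)"
          by (simp add: power2_eq_square algebra_simps)
        also have "sqrt \<dots> = \<bar>radius t\<bar> * sqrt (curve_x s * curve_x s + curve_y s * curve_y s)" by (simp add: real_sqrt_mult)
        finally have "norm x = \<bar>radius t\<bar> * sqrt (curve_x s * curve_x s + curve_y s * curve_y s)" .
        moreover have "sqrt m \<le> sqrt (curve_x s * curve_x s + curve_y s * curve_y s)" using m(2)[of s] by simp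
        moreover have "0 \<le> rho T 2 * e" using r2 e(1) by simp
        ultimately have "\<delta> \<le> norm x" unfolding \<delta>_def using r m(1) by (simp only:) (intro mult_mono, auto)
        moreover have "dist x (0, 0) = norm x" by (simp add: dist_norm zero_prod_def[symmetric])
        ultimately show False using x(2) by simp
      qed
      moreover have "radius t = germ_radius t" by (rule radius_eq_germ) (use tp \<open>t < t0\<close> t0 tau(2) in auto)
      then have "x = polar (s, t)" using xe by (simp add: polar_def)
      ultimately show "\<exists>s t. 0 < t \<and> t < \<epsilon> \<and> t < \<tau> \<and> x = polar (s, t)" using tp t0 by (intro exI[of _ s] exI[of _ t]) auto
    qed
  qed
qed

end

theorem theorem3p2:
  fixes S T :: segments
    and Bpol :: "nat \<Rightarrow> nat \<Rightarrow> real \<times> real \<Rightarrow> real"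
  assumes "valid_segments S" and "valid_segments T"
    and "3 \<le> dim_per S"
    and "polar_image S T Bpol"
  shows "(\<forall>l\<in>{1..dim_pol S T}. C1_smooth_at_polar_point (Omega_pol S T) (N_pol S T Bpol l)) \<and>
         linearly_independent_on (Omega_pol S T) (dim_pol S T) (N_pol S T Bpol) \<and>
         locally_supported S T (N_pol S T Bpol) \<and>
         convex_partition_of_unity_on (Omega_pol S T) (dim_pol S T) (N_pol S T Bpol)"
  using N_pol_C1[OF assms] linear_independence[OF assms] local_support[OF assms] partition_of_unity[OF assms]
  by auto

end
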